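(* Let $X$ be an infinite-dimensional complex Banach space, let $K$ be a compact Hausdorff space, and let $A(K,X)$ be a function space over an infinite-dimensional base algebra $A$. Then $$\mathrm{Daug}_p(A(K,X)) = \max\{\mathrm{Daug}_p(A), \mathrm{Daug}_p(X)\}.$$
   Context: $C(K)$ and $C(K,X)$ are the spaces of continuous complex-valued, respectively $X$-valued, functions on $K$ with the supremum norm. A uniform algebra on $K$ is a closed subalgebra of $C(K)$ that separates the points of $K$ and contains the constant functions. A subspace $A(K,X)$ of $C(K,X)$ is called a function space over the base algebra $A$ if: (i) $A := \{x^*\circ f : x^* \in X^*, f \in A(K,X)\}$ is a uniform algebra on $K$; (ii) $A\otimes X := \{f\otimes x : f\in A, x\in X\} \subset A(K,X)$, where $(f\otimes x)(t)=f(t)x$; (iii) $g\cdot f \in A(K,X)$ for every $g\in A$ and $f\in A(K,X)$. For a space $Z$, a bounded $k$-homogeneous polynomial on $Z$ is a map $z\mapsto F(z,\dots,z)$ with $F: Z^k\to Z$ bounded $k$-linear; a polynomial is a finite sum of bounded homogeneous polynomials, with norm $\|P\|=\sup_{z\in B_Z}\|Pz\|$ ($B_Z$ the closed unit ball). $\mathcal{P}_K(Z,Z)$ is the set of compact polynomials $P:Z\to Z$ (those with $P(B_Z)$ relatively compact). For an infinite-dimensional complex space $Z$, the polynomial Daugavetian index is $$\mathrm{Daug}_p(Z) = \max\{m\geq 0 : \|I+P\| \geq 1+m\|P\| \text{ for every } P\in\mathcal{P}_K(Z,Z)\},$$ where $I$ is the identity on $Z$. *)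

theory Defs
  imports "HOL-Analysis.Analysis"
begin

section \<open>Complex normed spaces\<close>

class complex_normed_vector = real_normed_vector +
  fixes scaleC :: "complex \<Rightarrow> 'a \<Rightarrow> 'a" (infixr \<open>*\<^sub>C\<close> 75)
  assumes scaleC_add_right: "a *\<^sub>C (x + y) = a *\<^sub>C x + a *\<^sub>C y"
    and scaleC_add_left: "(a + b) *\<^sub>C x = a *\<^sub>C x + b *\<^sub>C x"
    and scaleC_scaleC: "a *\<^sub>C (b *\<^sub>C x) = (a * b) *\<^sub>C x"
    and scaleC_of_real: "complex_of_real r *\<^sub>C x = r *\<^sub>R x"
    and norm_scaleC: "norm (a *\<^sub>C x) = cmod a * norm x"

class complex_banach = complex_normed_vector + complete_space

interpretation complex_vector: vector_space "scaleC :: complex \<Rightarrow> 'a \<Rightarrow> 'a::complex_normed_vector"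
proof
  show "1 *\<^sub>C x = x" for x :: 'a
    using scaleC_of_real[of 1 x] by simp
qed (simp_all add: scaleC_add_right scaleC_add_left scaleC_scaleC)

lemma bounded_bilinear_scaleC:
  "bounded_bilinear (scaleC :: complex \<Rightarrow> 'a \<Rightarrow> 'a::complex_normed_vector)"
proof
  fix r :: real and a :: complex and x :: 'a
  show "(r *\<^sub>R a) *\<^sub>C x = r *\<^sub>R (a *\<^sub>C x)"
    by (simp add: scaleC_of_real[symmetric] scaleC_scaleC scaleR_conv_of_real)
  show "a *\<^sub>C (r *\<^sub>R x) = r *\<^sub>R (a *\<^sub>C x)"
    by (simp add: scaleC_of_real[symmetric] scaleC_scaleC mult.commute)
  show "\<exists>K. \<forall>a x. norm (a *\<^sub>C (x::'a)) \<le> norm a * norm x * K"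
    by (rule exI[of _ 1]) (simp add: norm_scaleC)
qed (simp_all add: scaleC_add_right scaleC_add_left)

instantiation complex :: complex_banach
begin

definition scaleC_complex :: "complex \<Rightarrow> complex \<Rightarrow> complex"
  where "scaleC_complex = (*)"

instance
  by standard (simp_all add: scaleC_complex_def algebra_simps norm_mult scaleR_conv_of_real)

end

definition infinite_dim :: "'a::complex_normed_vector set \<Rightarrow> bool"
  where "infinite_dim Z \<longleftrightarrow>
    \<not> (\<exists>B. finite B \<and> B \<subseteq> Z \<and> Z \<subseteq> complex_vector.span B)"

section \<open>Continuous functions on a compact space\<close>

text \<open>For a compact space \<open>'k\<close>, the library type \<open>'k \<Rightarrow>\<^sub>C 'a\<close> of bounded continuous
  functions with the supremum norm is the space of all continuous functions.\<close>

context
  includes bcontfun.lifting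
begin

lift_definition pointwise_scaleC ::
  "('k::topological_space \<Rightarrow>\<^sub>C complex) \<Rightarrow> ('k \<Rightarrow>\<^sub>C 'a) \<Rightarrow> ('k \<Rightarrow>\<^sub>C 'a::complex_normed_vector)"
  (infixr \<open>\<odot>\<close> 75) is "\<lambda>g f t. g t *\<^sub>C f t"
proof -
  fix g :: "'k \<Rightarrow> complex" and f :: "'k \<Rightarrow> 'a"
  assume "g \<in> bcontfun" "f \<in> bcontfun"
  then have c: "continuous_on UNIV g" "continuous_on UNIV f"
    and b: "bounded (range g)" "bounded (range f)"
    by (auto simp: bcontfun_def)
  obtain G where G: "cmod (g t) \<le> G" for t
    using b(1) by (auto simp: bounded_iff)
  obtain F where F: "norm (f t) \<le> F" for t
    using b(2) by (auto simp: bounded_iff)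
  show "(\<lambda>t. g t *\<^sub>C f t) \<in> bcontfun"
  proof (rule bcontfun_normI)
    show "continuous_on UNIV (\<lambda>t. g t *\<^sub>C f t)"
      using c by (rule bounded_bilinear.continuous_on[OF bounded_bilinear_scaleC])
    show "norm (g t *\<^sub>C f t) \<le> G * F" for t
      unfolding norm_scaleC using G[of t] F[of t]
      by (meson mult_mono norm_ge_zero order_trans)
  qed
qed

end

declare pointwise_scaleC.rep_eq [simp]

instantiation bcontfun :: (topological_space, complex_normed_vector) complex_normed_vector
begin

definition scaleC_bcontfun :: "complex \<Rightarrow> ('a \<Rightarrow>\<^sub>C 'b) \<Rightarrow> 'a \<Rightarrow>\<^sub>C 'b"
  where "scaleC_bcontfun a f = const_bcontfun a \<odot> f"

instance
proof
  fix a b :: complex and r :: real and f g :: "'a \<Rightarrow>\<^sub>C 'b"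
  show "a *\<^sub>C (f + g) = a *\<^sub>C f + a *\<^sub>C g" "(a + b) *\<^sub>C f = a *\<^sub>C f + b *\<^sub>C f"
    "a *\<^sub>C (b *\<^sub>C f) = (a * b) *\<^sub>C f" "complex_of_real r *\<^sub>C f = r *\<^sub>R f"
    by (auto intro!: bcontfun_eqI
        simp: scaleC_bcontfun_def scaleC_add_right scaleC_add_left scaleC_scaleC scaleC_of_real)
  have le: "norm (c *\<^sub>C h) \<le> cmod c * norm h" for c and h :: "'a \<Rightarrow>\<^sub>C 'b"
    by (rule norm_bound) (simp add: scaleC_bcontfun_def norm_scaleC norm_bounded mult_left_mono)
  show "norm (a *\<^sub>C f) = cmod a * norm f"
  proof (cases "a = 0")
    case True
    then show ?thesis using le[of a f] by simp
  next
    case False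
    have "inverse a *\<^sub>C (a *\<^sub>C f) = f"
      using False by (intro bcontfun_eqI) (simp add: scaleC_bcontfun_def)
    then have "norm f \<le> cmod (inverse a) * norm (a *\<^sub>C f)"
      using le[of "inverse a" "a *\<^sub>C f"] by simp
    then have "cmod a * norm f \<le> norm (a *\<^sub>C f)"
      using False by (simp add: norm_divide divide_simps mult.commute norm_inverse)
    with le[of a f] show ?thesis by simp
  qed
qed

end

lemma scaleC_bcontfun_apply [simp]: "apply_bcontfun (a *\<^sub>C f) t = a *\<^sub>C apply_bcontfun f t"
  by (simp add: scaleC_bcontfun_def)

text \<open>Here \<open>f \<odot> g\<close> is the pointwise product, since \<open>(*\<^sub>C)\<close> on \<open>complex\<close> is multiplication.\<close>

definition uniform_algebra :: "('k::topological_space \<Rightarrow>\<^sub>C complex) set \<Rightarrow> bool"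
  where "uniform_algebra A \<longleftrightarrow>
    closed A \<and> complex_vector.subspace A \<and>
    (\<forall>f\<in>A. \<forall>g\<in>A. f \<odot> g \<in> A) \<and>
    (\<forall>c. const_bcontfun c \<in> A) \<and>
    (\<forall>s t. s \<noteq> t \<longrightarrow> (\<exists>f\<in>A. apply_bcontfun f s \<noteq> apply_bcontfun f t))"

definition bounded_functional :: "('a::complex_normed_vector \<Rightarrow> complex) \<Rightarrow> bool"
  where "bounded_functional \<phi> \<longleftrightarrow>
    bounded_linear \<phi> \<and> (\<forall>c x. \<phi> (c *\<^sub>C x) = c * \<phi> x)"

definition base_algebra ::
  "('k::topological_space \<Rightarrow>\<^sub>C 'x::complex_normed_vector) set \<Rightarrow> ('k \<Rightarrow>\<^sub>C complex) set"
  where "base_algebra S =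
    {g. \<exists>\<phi> f. bounded_functional \<phi> \<and> f \<in> S \<and> apply_bcontfun g = \<phi> \<circ> apply_bcontfun f}"

definition tensor ::
  "('k::topological_space \<Rightarrow>\<^sub>C complex) \<Rightarrow> 'x \<Rightarrow> ('k \<Rightarrow>\<^sub>C 'x::complex_normed_vector)"
  where "tensor f x = f \<odot> const_bcontfun x"

text \<open>The subspace \<open>S\<close> of the continuous functions is not required to be closed.\<close>

definition function_space_over ::
  "('k::topological_space \<Rightarrow>\<^sub>C complex) set \<Rightarrow> ('k \<Rightarrow>\<^sub>C 'x::complex_normed_vector) set \<Rightarrow> bool"
  where "function_space_over A S \<longleftrightarrow>
    complex_vector.subspace S \<and>
    A = base_algebra S \<and> uniform_algebra A \<and>
    (\<forall>f\<in>A. \<forall>x. tensor f x \<in> S) \<and>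
    (\<forall>g\<in>A. \<forall>f\<in>S. g \<odot> f \<in> S)"

section \<open>Polynomials and the polynomial Daugavetian index\<close>

text \<open>A normed space \<open>Z\<close> is a complex subspace of a complex normed type, and a map \<open>Z \<rightarrow> Z\<close> is
  a function on the type of which only the values on \<open>Z\<close> matter. The power \<open>Z\<^sup>k\<close> consists of
  the extensional functions from \<open>{..<k}\<close> to \<open>Z\<close>; it is a single point for \<open>k = 0\<close>, so
  \<open>0\<close>-homogeneous polynomials are the constants.\<close>

definition bounded_multilinear_on ::
  "'a::complex_normed_vector set \<Rightarrow> nat \<Rightarrow> ((nat \<Rightarrow> 'a) \<Rightarrow> 'a) \<Rightarrow> bool"
  where "bounded_multilinear_on Z k F \<longleftrightarrow>
    (\<forall>x \<in> {..<k} \<rightarrow>\<^sub>E Z. F x \<in> Z) \<and>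
    (\<forall>x \<in> {..<k} \<rightarrow>\<^sub>E Z. \<forall>i<k. \<forall>y\<in>Z. F (x(i := x i + y)) = F x + F (x(i := y))) \<and>
    (\<forall>x \<in> {..<k} \<rightarrow>\<^sub>E Z. \<forall>i<k. \<forall>c. F (x(i := c *\<^sub>C x i)) = c *\<^sub>C F x) \<and>
    (\<exists>M. \<forall>x \<in> {..<k} \<rightarrow>\<^sub>E Z. norm (F x) \<le> M * (\<Prod>i<k. norm (x i)))"

definition homogeneous_polynomial_on ::
  "'a::complex_normed_vector set \<Rightarrow> nat \<Rightarrow> ('a \<Rightarrow> 'a) \<Rightarrow> bool"
  where "homogeneous_polynomial_on Z k P \<longleftrightarrow>
    (\<exists>F. bounded_multilinear_on Z k F \<and> (\<forall>z\<in>Z. P z = F (\<lambda>i\<in>{..<k}. z)))"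

definition polynomial_on :: "'a::complex_normed_vector set \<Rightarrow> ('a \<Rightarrow> 'a) \<Rightarrow> bool"
  where "polynomial_on Z P \<longleftrightarrow>
    (\<exists>(n::nat) d Q. (\<forall>j<n. homogeneous_polynomial_on Z (d j) (Q j)) \<and>
      (\<forall>z\<in>Z. P z = (\<Sum>j<n. Q j z)))"

definition unit_ball :: "'a::real_normed_vector set \<Rightarrow> 'a set"
  where "unit_ball Z = {z \<in> Z. norm z \<le> 1}"

definition poly_norm :: "'a::real_normed_vector set \<Rightarrow> ('a \<Rightarrow> 'a) \<Rightarrow> real"
  where "poly_norm Z P = (SUP z\<in>unit_ball Z. norm (P z))"

text \<open>Relative compactness is meant in \<open>Z\<close>: the closure is taken in the subspace topology.\<close>

definition compact_polynomial_on :: "'a::complex_normed_vector set \<Rightarrow> ('a \<Rightarrow> 'a) \<Rightarrow> bool"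
  where "compact_polynomial_on Z P \<longleftrightarrow>
    polynomial_on Z P \<and> compact (Z \<inter> closure (P ` unit_ball Z))"

definition Daug_p :: "'a::complex_normed_vector set \<Rightarrow> real"
  where "Daug_p Z = (GREATEST m. 0 \<le> m \<and>
    (\<forall>P. compact_polynomial_on Z P \<longrightarrow> poly_norm Z (\<lambda>z. z + P z) \<ge> 1 + m * poly_norm Z P))"

end

theory Submission
  imports Defs
begin

text \<open>Let \<open>D\<close> be the set of points of \<open>K\<close> all of whose neighbourhoods carry peaking functions
  of \<open>A\<close>. Every function of \<open>A\<close>, and by Hahn--Banach every function of \<open>A(K,X)\<close>, attains its
  norm on \<open>D\<close>. If \<open>\<phi> \<in> A\<close> peaks at \<open>t\<close> with values close to the segment from \<open>0\<close> to \<open>1\<close>, then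
  \<open>f + \<phi> \<otimes> (x - f t)\<close> has the value \<open>x\<close> at \<open>t\<close> and essentially still lies in the unit ball.

  If \<open>D\<close> has no isolated point, such modifications at infinitely many disjoint places give
  perturbations of \<open>f\<close> spanning a copy of \<open>c\<^sub>0\<close>. A compact polynomial \<open>P\<close> hardly notices some of
  them, so that \<open>x\<close> can be aligned with \<open>P f t\<close>; both \<open>A\<close> and \<open>A(K,X)\<close> then have index \<open>1\<close>.

  An isolated point \<open>t\<close> of \<open>D\<close> has its indicator in \<open>A\<close>. Then \<open>A\<close> has index \<open>0\<close> and \<open>A(K,X)\<close> has
  \<open>X\<close> as an \<open>\<ell>\<^sub>\<infinity>\<close>-summand, so its index is at most that of \<open>X\<close>. For the converse inequality,
  restrict \<open>P\<close> to the affine copy \<open>x \<mapsto> f + \<phi> \<otimes> (x - f t)\<close> of \<open>X\<close>, where \<open>f\<close> almost attains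
  the norm of \<open>P\<close>, and evaluate at \<open>t\<close>.\<close>

section \<open>The Hahn--Banach theorem\<close>

text \<open>The algebra \<open>A\<close> is a function space over itself with the complex numbers in
  the place of X, so statements about A(K,X) are reused for \<open>A\<close>. The obstacle is a
  boundary without isolated points: the vector x must be chosen before the value of P at the
  modified function is known. For a family \<open>z\<close> that behaves like the unit vectors of
  c_0, averaging over signs bounds the norm of a sum of differences P(f + z n) - P f by a constant
  independent of the number of terms. Compactness of P supplies a convergent subsequence of these
  differences, and its limit can only be 0. The values of \<phi> are kept near the segment because
  cmod \<phi> + cmod (1 - \<phi>) \<le> 1 + \<eta> makes \<phi> x + (1 - \<phi>) f(t) almost a
  convex combination. Constant polynomials show that no index exceeds 1. Infinite dimension gives
  norm at least 1 to every I + P with P compact: hence 0 is an admissible constant, and the part of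
  a function away from an isolated point, which contributes at most 1, does no harm.\<close>

definition sublinear :: "('a::real_vector \<Rightarrow> real) \<Rightarrow> bool"
  where "sublinear q \<longleftrightarrow> (\<forall>x y. q (x + y) \<le> q x + q y) \<and> (\<forall>r>0. \<forall>x. q (r *\<^sub>R x) \<le> r * q x)"

lemma sublinear_zero:
  assumes "sublinear q"
  shows "q 0 = 0"
proof -
  have "q (0 + 0) \<le> q 0 + q 0" "q ((1/2) *\<^sub>R 0) \<le> (1/2) * q 0"
    using assms unfolding sublinear_def by (blast, metis half_gt_zero_iff zero_less_one)
  then show ?thesis by simp
qed

lemma sublinear_ge:
  assumes "sublinear q"
  shows "- q (- x) \<le> q x"
proof -
  have "q (x + - x) \<le> q x + q (- x)"
    using assms unfolding sublinear_def by blast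
  then show ?thesis using sublinear_zero[OF assms] by simp
qed

text \<open>For sublinear \<open>q\<close>, the largest sublinear functional below \<open>q\<close>
  whose value at \<open>- y\<close> is at most \<open>- q y\<close>. A linear functional below it
  therefore takes the value \<open>q y\<close> at \<open>y\<close>.\<close>

definition sublinear_slope :: "('a::real_vector \<Rightarrow> real) \<Rightarrow> 'a \<Rightarrow> 'a \<Rightarrow> real"
  where "sublinear_slope q y x = (INF t\<in>{0..}. q (x + t *\<^sub>R y) - t * q y)"

lemma sublinear_slope_le:
  assumes q: "sublinear q" and "t \<ge> 0"
  shows "sublinear_slope q y x \<le> q (x + t *\<^sub>R y) - t * q y"
  unfolding sublinear_slope_def
proof (rule cINF_lower[OF bdd_belowI2[where m = "- q (- x)"]])
  fix s :: real assume "s \<in> {0..}"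
  have "q ((x + s *\<^sub>R y) + - x) \<le> q (x + s *\<^sub>R y) + q (- x)"
    using q unfolding sublinear_def by blast
  \<comment> \<open>Homogeneity with equality: the inequality is applied with \<open>s\<close> and
    with its inverse.\<close>
  moreover have "q (s *\<^sub>R y) = s * q y"
  proof (cases "s = 0")
    case False
    with \<open>s \<in> {0..}\<close> have s: "s > 0" by simp
    have "q (inverse s *\<^sub>R (s *\<^sub>R y)) \<le> inverse s * q (s *\<^sub>R y)"
      using q s unfolding sublinear_def by (meson positive_imp_inverse_positive)
    then have "s * q y \<le> q (s *\<^sub>R y)" using s by (simp add: field_simps)
    moreover have "q (s *\<^sub>R y) \<le> s * q y" using q s unfolding sublinear_def by blast
    ultimately show ?thesis by simp
  qed (simp add: sublinear_zero[OF q])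
  ultimately show "- q (- x) \<le> q (x + s *\<^sub>R y) - s * q y" by simp
qed (use \<open>t \<ge> 0\<close> in simp)

lemma le_sublinear_slope:
  assumes "\<And>t. t \<ge> 0 \<Longrightarrow> b \<le> q (x + t *\<^sub>R y) - t * q y"
  shows "b \<le> sublinear_slope q y x"
  unfolding sublinear_slope_def by (rule cINF_greatest) (use assms in auto)

lemma sublinear_sublinear_slope:
  assumes q: "sublinear q"
  shows "sublinear (sublinear_slope q y)"
  unfolding sublinear_def
proof (intro conjI allI impI)
  fix x x'
  have "sublinear_slope q y (x + x') - (q (x + s *\<^sub>R y) - s * q y) \<le> q (x' + t *\<^sub>R y) - t * q y"
    if "s \<ge> 0" "t \<ge> 0" for s t
  proof -
    have "q ((x + s *\<^sub>R y) + (x' + t *\<^sub>R y)) \<le> q (x + s *\<^sub>R y) + q (x' + t *\<^sub>R y)"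
      using q unfolding sublinear_def by blast
    moreover have "(x + s *\<^sub>R y) + (x' + t *\<^sub>R y) = x + x' + (s + t) *\<^sub>R y"
      by (simp add: algebra_simps)
    ultimately show ?thesis
      using sublinear_slope_le[OF q, of "s + t" y "x + x'"] that by (simp add: algebra_simps)
  qed
  then have "sublinear_slope q y (x + x') - (q (x + s *\<^sub>R y) - s * q y) \<le> sublinear_slope q y x'"
    if "s \<ge> 0" for s using that by (intro le_sublinear_slope)
  then have "sublinear_slope q y (x + x') - sublinear_slope q y x' \<le> sublinear_slope q y x"
    by (intro le_sublinear_slope) (smt (verit))
  then show "sublinear_slope q y (x + x') \<le> sublinear_slope q y x + sublinear_slope q y x'"
    by simp
next
  fix r :: real and x assume r: "0 < r"
  have "sublinear_slope q y (r *\<^sub>R x) / r \<le> q (x + t *\<^sub>R y) - t * q y" if t: "t \<ge> 0" for t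
  proof -
    have "sublinear_slope q y (r *\<^sub>R x) \<le> q (r *\<^sub>R x + (r * t) *\<^sub>R y) - (r * t) * q y"
      using sublinear_slope_le[OF q, of "r * t"] r t by simp
    also have "r *\<^sub>R x + (r * t) *\<^sub>R y = r *\<^sub>R (x + t *\<^sub>R y)" by (simp add: algebra_simps)
    also have "q \<dots> \<le> r * q (x + t *\<^sub>R y)" using q r unfolding sublinear_def by blast
    finally show ?thesis using r by (simp add: field_simps)
  qed
  then have "sublinear_slope q y (r *\<^sub>R x) / r \<le> sublinear_slope q y x"
    by (rule le_sublinear_slope)
  then show "sublinear_slope q y (r *\<^sub>R x) \<le> r * sublinear_slope q y x"
    using r by (simp add: field_simps)
qed

text \<open>Zorn's lemma for the reversed order. The infimum of a chain is finite because every
  member is at least \<open>- p (- x)\<close>, and it is subadditive because two members of a chain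
  can both be replaced by the smaller one.\<close>

lemma exists_minimal_sublinear:
  fixes p :: "'a::real_vector \<Rightarrow> real"
  assumes p: "sublinear p"
  obtains u where "sublinear u" "u \<le> p" "\<And>q. sublinear q \<Longrightarrow> q \<le> u \<Longrightarrow> q = u"
proof -
  define S where "S = {q. sublinear q \<and> q \<le> p}"
  define R where "R = (\<lambda>q q' :: 'a \<Rightarrow> real. q' \<le> q)"
  have "\<exists>m\<in>S. \<forall>a\<in>S. R m a \<longrightarrow> a = m"
  proof (rule predicate_Zorn)
    show "partial_order_on S (relation_of R S)"
      unfolding R_def by (rule partial_order_on_relation_ofI) auto
    fix C assume C: "C \<in> Chains (relation_of R S)"
    then have CS: "q \<in> S" if "q \<in> C" for q
      using that by (auto simp: Chains_def relation_of_def)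
    have chain: "q \<le> q' \<or> q' \<le> q" if "q \<in> C" "q' \<in> C" for q q'
      using C that by (auto simp: Chains_def relation_of_def R_def)
    show "\<exists>u\<in>S. \<forall>a\<in>C. R a u"
    proof (cases "C = {}")
      case True
      then show ?thesis using p by (auto simp: S_def)
    next
      case False
      define u where "u = (\<lambda>x. INF q\<in>C. q x)"
      have ge: "- p (- x) \<le> q x" if "q \<in> C" for q x
        using CS[OF that] sublinear_ge[of q x] le_funD[of q p "- x"] by (auto simp: S_def)
      have le: "u x \<le> q x" if "q \<in> C" for q x
        unfolding u_def by (rule cINF_lower[OF bdd_belowI2[where m = "- p (- x)"]]) (use ge that in auto)
      have greatest: "b \<le> u x" if "\<And>q. q \<in> C \<Longrightarrow> b \<le> q x" for b x
        unfolding u_def by (rule cINF_greatest) (use False that in auto)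
      have "sublinear u"
        unfolding sublinear_def
      proof (intro conjI allI impI)
        fix x y
        have "u (x + y) - q x \<le> q' y" if qq: "q \<in> C" "q' \<in> C" for q q'
        proof -
          obtain r where r: "r \<in> C" "r \<le> q" "r \<le> q'" using chain[OF qq] qq by blast
          have "u (x + y) \<le> r (x + y)" by (rule le[OF r(1)])
          also have "\<dots> \<le> r x + r y" using CS[OF r(1)] unfolding S_def sublinear_def by blast
          also have "\<dots> \<le> q x + q' y" using r by (auto simp: le_fun_def intro: add_mono)
          finally show ?thesis by simp
        qed
        then have "u (x + y) - q x \<le> u y" if "q \<in> C" for q by (intro greatest) (use that in auto)
        then have "u (x + y) - u y \<le> u x" by (intro greatest) (smt (verit))
        then show "u (x + y) \<le> u x + u y" by simp
      next
        fix r :: real and x assume r: "r > 0"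
        have "u (r *\<^sub>R x) / r \<le> q x" if "q \<in> C" for q
        proof -
          have "u (r *\<^sub>R x) \<le> q (r *\<^sub>R x)" by (rule le[OF that])
          also have "\<dots> \<le> r * q x" using CS[OF that] r unfolding S_def sublinear_def by blast
          finally show ?thesis using r by (simp add: field_simps)
        qed
        then have "u (r *\<^sub>R x) / r \<le> u x" by (rule greatest)
        then show "u (r *\<^sub>R x) \<le> r * u x" using r by (simp add: field_simps)
      qed
      moreover have "u \<le> p"
        using False le CS by (fastforce simp: S_def le_fun_def intro: order_trans)
      ultimately show ?thesis using le by (auto simp: S_def R_def le_fun_def)
    qed
  qed
  then obtain u where u: "u \<in> S" "\<And>q. q \<in> S \<Longrightarrow> q \<le> u \<Longrightarrow> q = u"
    by (auto simp: R_def)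
  show ?thesis
    by (rule that[of u]) (use u in \<open>auto simp: S_def intro: order_trans\<close>)
qed

text \<open>By minimality \<open>u\<close> coincides with its slope in each direction
  \<open>y\<close>; the parameter value 1 in that slope then gives superadditivity.\<close>

lemma minimal_sublinear_linear:
  assumes u: "sublinear u" and min: "\<And>q. sublinear q \<Longrightarrow> q \<le> u \<Longrightarrow> q = u"
  shows "linear u"
proof -
  have add: "u (x + y) = u x + u y" for x y
  proof -
    have "sublinear_slope u y \<le> u"
      using sublinear_slope_le[OF u, of 0 y] by (auto simp: le_fun_def)
    then have "sublinear_slope u y = u" by (intro min sublinear_sublinear_slope u)
    then have "u x \<le> u (x + y) - u y" using sublinear_slope_le[OF u, of 1 y x] by simp
    moreover have "u (x + y) \<le> u x + u y" using u unfolding sublinear_def by blast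
    ultimately show ?thesis by simp
  qed
  have neg: "u (- x) = - u x" for x
    using add[of x "- x"] sublinear_zero[OF u] by simp
  have pos: "u (r *\<^sub>R x) = r * u x" if "r > 0" for r x
  proof -
    have "u (r *\<^sub>R x) \<le> r * u x" "u (r *\<^sub>R (- x)) \<le> r * u (- x)"
      using u that unfolding sublinear_def by blast+
    then show ?thesis by (simp add: neg)
  qed
  show ?thesis
  proof (rule linearI)
    show "u (x + y) = u x + u y" for x y by (rule add)
    show "u (r *\<^sub>R x) = r *\<^sub>R u x" for r x
      using pos[of r x] pos[of "- r" x] sublinear_zero[OF u] neg[of "r *\<^sub>R x"]
      by (cases r "0 :: real" rule: linorder_cases) (auto simp: neg)
  qed
qed

text \<open>No functional is extended from a subspace: the slope of the norm in direction
  \<open>x0\<close> already forces the right value at \<open>x0\<close> on every minimal sublinear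
  functional below it.\<close>

lemma hahn_banach_norming_real:
  fixes x0 :: "'a::real_normed_vector"
  obtains u where "linear u" "\<And>x. u x \<le> norm x" "u x0 = norm x0"
proof -
  have n: "sublinear (norm :: 'a \<Rightarrow> real)"
    by (auto simp: sublinear_def norm_triangle_ineq)
  obtain u where u: "sublinear u" "u \<le> sublinear_slope norm x0"
    "\<And>q. sublinear q \<Longrightarrow> q \<le> u \<Longrightarrow> q = u"
    using exists_minimal_sublinear[OF sublinear_sublinear_slope[OF n]] by metis
  have lin: "linear u" by (rule minimal_sublinear_linear) (use u in auto)
  have le: "u x \<le> norm x" for x
    using u(2) sublinear_slope_le[OF n, of 0 x0 x] by (auto simp: le_fun_def intro: order_trans)
  have "u (- x0) \<le> - norm x0"
    using u(2) sublinear_slope_le[OF n, of 1 x0 "- x0"] by (auto simp: le_fun_def intro: order_trans)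
  then have "u x0 = norm x0" using le[of x0] linear_neg[OF lin, of x0] by simp
  with lin le show ?thesis using that by blast
qed

text \<open>A complex functional is determined by its real part \<open>u\<close>, as u(x) - i u(ix).
  The real bound carries over after rotating the argument so that \<open>\<phi> x\<close> becomes
  nonnegative.\<close>

lemma hahn_banach_norming:
  fixes x0 :: "'a::complex_normed_vector"
  obtains \<phi> where "bounded_functional \<phi>" "\<And>x. cmod (\<phi> x) \<le> norm x"
    "\<phi> x0 = complex_of_real (norm x0)"
proof -
  obtain u where lin: "linear u" and le: "\<And>x. u x \<le> norm (x::'a)" and u0: "u x0 = norm x0"
    using hahn_banach_norming_real[of x0] by metis
  define \<phi> where "\<phi> x = Complex (u x) (- u (\<i> *\<^sub>C x))" for x
  have add: "\<phi> (x + y) = \<phi> x + \<phi> y" for x y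
    by (simp add: \<phi>_def complex_eq_iff linear_add[OF lin] scaleC_add_right)
  have ii: "\<i> *\<^sub>C (\<i> *\<^sub>C x) = - x" for x :: 'a
    by (simp add: scaleC_scaleC complex_vector.scale_minus_left)
  have split: "c *\<^sub>C x = Re c *\<^sub>R x + Im c *\<^sub>R (\<i> *\<^sub>C x)" for c and x :: 'a
    by (metis complex_eq scaleC_add_left scaleC_of_real scaleC_scaleC mult.commute)
  have real: "\<phi> (r *\<^sub>R x) = complex_of_real r * \<phi> x" for r x
  proof -
    have "\<i> *\<^sub>C (r *\<^sub>R x) = r *\<^sub>R (\<i> *\<^sub>C x)"
      by (metis scaleC_of_real scaleC_scaleC mult.commute)
    then show ?thesis by (simp add: \<phi>_def complex_eq_iff linear_scale[OF lin])
  qed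
  have im: "\<phi> (\<i> *\<^sub>C x) = \<i> * \<phi> x" for x
    by (simp add: \<phi>_def complex_eq_iff ii linear_neg[OF lin])
  have scale: "\<phi> (c *\<^sub>C x) = c * \<phi> x" for c x
    by (subst split) (simp add: add real im complex_eq_iff)
  have bd: "cmod (\<phi> x) \<le> norm x" for x
  proof (cases "\<phi> x = 0")
    case False
    define c where "c = cnj (sgn (\<phi> x))"
    have "\<phi> (c *\<^sub>C x) = complex_of_real (cmod (\<phi> x))"
      using False unfolding scale c_def
      by (simp add: sgn_eq mult.commute[of "cnj _"] complex_mult_cnj flip: cmod_power2)
        (simp add: power2_eq_square)
    then have "cmod (\<phi> x) = u (c *\<^sub>C x)" by (simp add: \<phi>_def complex_eq_iff)
    also have "\<dots> \<le> norm (c *\<^sub>C x)" by (rule le)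
    also have "\<dots> = norm x" using False by (simp add: norm_scaleC c_def norm_sgn)
    finally show ?thesis .
  qed simp
  have "bounded_linear \<phi>"
    by (rule bounded_linear_intro[where K = 1]) (use add real bd in \<open>auto simp: scaleR_conv_of_real\<close>)
  moreover have "\<phi> x0 = complex_of_real (norm x0)"
  proof -
    have "Re (\<phi> x0) = norm x0" by (simp add: \<phi>_def u0)
    \<comment> \<open>The real part of \<open>\<phi> x0\<close> uses up the whole modulus, so no
      imaginary part is left.\<close>
    moreover have "(cmod (\<phi> x0))\<^sup>2 \<le> (norm x0)\<^sup>2" using bd[of x0] by (simp add: power_mono)
    ultimately have "Im (\<phi> x0) = 0" by (simp add: cmod_power2)
    with \<open>Re (\<phi> x0) = norm x0\<close> show ?thesis by (simp add: complex_eq_iff)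
  qed
  ultimately show ?thesis using that bd scale unfolding bounded_functional_def by blast
qed

section \<open>Polynomials\<close>

lemma multilinear_slot_add:
  assumes "bounded_multilinear_on Z k F" "x \<in> {..<k} \<rightarrow>\<^sub>E Z" "l < k" "u \<in> Z" "v \<in> Z"
  shows "F (x(l := u + v)) = F (x(l := u)) + F (x(l := v))"
proof -
  have "x(l := u) \<in> {..<k} \<rightarrow>\<^sub>E Z"
    using assms by (auto simp: PiE_iff extensional_def)
  then show ?thesis
    using assms unfolding bounded_multilinear_on_def
    by (metis fun_upd_same fun_upd_upd)
qed

lemma multilinear_slot_scaleC:
  assumes "bounded_multilinear_on Z k F" "x \<in> {..<k} \<rightarrow>\<^sub>E Z" "l < k" "u \<in> Z"
  shows "F (x(l := c *\<^sub>C u)) = c *\<^sub>C F (x(l := u))"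
proof -
  have "x(l := u) \<in> {..<k} \<rightarrow>\<^sub>E Z"
    using assms by (auto simp: PiE_iff extensional_def)
  then show ?thesis
    using assms unfolding bounded_multilinear_on_def
    by (metis fun_upd_same fun_upd_upd)
qed

lemma multilinear_slot_scaleR:
  assumes "bounded_multilinear_on Z k F" "x \<in> {..<k} \<rightarrow>\<^sub>E Z" "l < k" "u \<in> Z"
  shows "F (x(l := r *\<^sub>R u)) = r *\<^sub>R F (x(l := u))"
  using multilinear_slot_scaleC[OF assms, of "complex_of_real r"] by (simp add: scaleC_of_real)

lemma subspace_scaleR:
  assumes "complex_vector.subspace Z" "x \<in> Z"
  shows "r *\<^sub>R x \<in> Z"
  using complex_vector.subspace_scale[OF assms, of "complex_of_real r"] by (simp add: scaleC_of_real)

lemma multilinear_slot_sum: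
  assumes F: "bounded_multilinear_on Z k F" "x \<in> {..<k} \<rightarrow>\<^sub>E Z" "l < k"
    and Z: "complex_vector.subspace Z" and "finite I" "\<And>i. i \<in> I \<Longrightarrow> z i \<in> Z"
  shows "F (x(l := \<Sum>i\<in>I. s i *\<^sub>R z i)) = (\<Sum>i\<in>I. s i *\<^sub>R F (x(l := z i)))"
  using assms(5,6)
proof (induction I rule: finite_induct)
  case empty
  show ?case
    using multilinear_slot_scaleC[OF F complex_vector.subspace_0[OF Z], of 0] by (simp add: fun_upd_def)
next
  case (insert j I)
  have "(\<Sum>i\<in>I. s i *\<^sub>R z i) \<in> Z"
    using insert.prems by (intro complex_vector.subspace_sum[OF Z] subspace_scaleR[OF Z]) auto
  then show ?case
    using insert multilinear_slot_add[OF F, of "s j *\<^sub>R z j" "\<Sum>i\<in>I. s i *\<^sub>R z i"]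
      multilinear_slot_scaleR[OF F, of "z j" "s j"] subspace_scaleR[OF Z, of "z j" "s j"]
    by (auto simp: fun_upd_def)
qed

lemma multilinear_binomial:
  assumes F: "bounded_multilinear_on Z k F" and Z: "complex_vector.subspace Z"
    and a: "\<And>i. i < k \<Longrightarrow> a i \<in> Z" and b: "\<And>i. i < k \<Longrightarrow> b i \<in> Z"
  shows "F (\<lambda>i\<in>{..<k}. a i + b i) =
    (\<Sum>J\<in>Pow {..<k}. F (\<lambda>i\<in>{..<k}. if i \<in> J then b i else a i))"
proof -
  have "F (\<lambda>i\<in>{..<k}. if i < m then a i + b i else a i) =
      (\<Sum>J\<in>Pow {..<m}. F (\<lambda>i\<in>{..<k}. if i \<in> J then b i else a i))" if "m \<le> k" for m
    using that a
  proof (induction m arbitrary: a)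
    case 0
    then show ?case by simp
  next
    case (Suc m)
    define x where "x a = (\<lambda>i\<in>{..<k}. if i < m then a i + b i else a i)" for a :: "nat \<Rightarrow> 'a"
    \<comment> \<open>Hiding \<open>b m\<close> in the base vector lets the induction hypothesis,
      which is general in \<open>a\<close>, produce the subsets that contain
      \<open>m\<close>.\<close>
    define a' where "a' = a(m := b m)"
    have a': "a' i \<in> Z" if "i < k" for i using Suc.prems b that by (auto simp: a'_def)
    have x: "x a \<in> {..<k} \<rightarrow>\<^sub>E Z"
      using Suc.prems b by (auto simp: x_def intro!: complex_vector.subspace_add[OF Z])
    have eq: "(\<lambda>i\<in>{..<k}. if i < Suc m then a i + b i else a i) = (x a)(m := a m + b m)"
      using Suc.prems by (auto simp: x_def fun_eq_iff restrict_def less_Suc_eq)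
    have "F ((x a)(m := a m + b m)) = F ((x a)(m := a m)) + F ((x a)(m := b m))"
      using Suc.prems b by (intro multilinear_slot_add[OF F x]) auto
    also have "(x a)(m := a m) = x a"
      using Suc.prems by (auto simp: x_def fun_eq_iff)
    also have "(x a)(m := b m) = x a'"
      using Suc.prems by (auto simp: x_def a'_def fun_eq_iff restrict_def)
    also have "F (x a) = (\<Sum>J\<in>Pow {..<m}. F (\<lambda>i\<in>{..<k}. if i \<in> J then b i else a i))"
      unfolding x_def by (rule Suc.IH) (use Suc.prems in auto)
    also have "F (x a') = (\<Sum>J\<in>Pow {..<m}. F (\<lambda>i\<in>{..<k}. if i \<in> J then b i else a' i))"
      unfolding x_def by (rule Suc.IH) (use Suc.prems a' in auto)
    also have "\<dots> = (\<Sum>J\<in>Pow {..<m}. F (\<lambda>i\<in>{..<k}. if i \<in> insert m J then b i else a i))"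
      by (intro sum.cong refl arg_cong[of _ _ F]) (auto simp: a'_def fun_eq_iff)
    also have "\<dots> = (\<Sum>J\<in>insert m ` Pow {..<m}. F (\<lambda>i\<in>{..<k}. if i \<in> J then b i else a i))"
    proof (rule sum.reindex_cong[symmetric, where l = "insert m"])
      show "inj_on (insert m) (Pow {..<m})"
        by (rule inj_onI) (metis PowD insert_ident lessThan_iff less_irrefl subset_iff)
    qed auto
    also have "(\<Sum>J\<in>Pow {..<m}. F (\<lambda>i\<in>{..<k}. if i \<in> J then b i else a i)) + \<dots> =
        (\<Sum>J\<in>Pow {..<m} \<union> insert m ` Pow {..<m}. F (\<lambda>i\<in>{..<k}. if i \<in> J then b i else a i))"
      by (intro sum.union_disjoint[symmetric]) auto
    also have "Pow {..<m} \<union> insert m ` Pow {..<m} = Pow {..<Suc m}"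
      by (simp add: lessThan_Suc Pow_insert)
    finally show ?case unfolding eq .
  qed
  from this[of k] have "F (\<lambda>i\<in>{..<k}. if i < k then a i + b i else a i) =
      (\<Sum>J\<in>Pow {..<k}. F (\<lambda>i\<in>{..<k}. if i \<in> J then b i else a i))" by simp
  moreover have "(\<lambda>i\<in>{..<k}. if i < k then a i + b i else a i) = (\<lambda>i\<in>{..<k}. a i + b i)"
    by auto
  ultimately show ?thesis by simp
qed

lemma multilinear_bound:
  assumes "bounded_multilinear_on Z k F"
  obtains M where "M \<ge> 0" "\<And>x. x \<in> {..<k} \<rightarrow>\<^sub>E Z \<Longrightarrow> norm (F x) \<le> M * (\<Prod>i<k. norm (x i))"
proof -
  obtain M where M: "norm (F x) \<le> M * (\<Prod>i<k. norm (x i))" if "x \<in> {..<k} \<rightarrow>\<^sub>E Z" for x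
    using assms unfolding bounded_multilinear_on_def by blast
  show ?thesis
  proof (rule that[of "max M 0"])
    fix x assume x: "x \<in> {..<k} \<rightarrow>\<^sub>E Z"
    have "M * (\<Prod>i<k. norm (x i)) \<le> max M 0 * (\<Prod>i<k. norm (x i))"
      by (intro mult_right_mono prod_nonneg) auto
    with M[OF x] show "norm (F x) \<le> max M 0 * (\<Prod>i<k. norm (x i))" by linarith
  qed simp
qed

lemma multilinear_bound_power:
  assumes M: "\<And>x. x \<in> {..<k} \<rightarrow>\<^sub>E Z \<Longrightarrow> norm (F x) \<le> M * (\<Prod>i<k. norm (x i))" "M \<ge> 0"
    and x: "x \<in> {..<k} \<rightarrow>\<^sub>E Z" "\<And>i. i < k \<Longrightarrow> norm (x i) \<le> C"
  shows "norm (F x) \<le> M * C ^ k"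
proof -
  have "(\<Prod>i<k. norm (x i)) \<le> (\<Prod>i<k. C)"
    using x by (intro prod_mono) auto
  then have "M * (\<Prod>i<k. norm (x i)) \<le> M * C ^ k"
    using M(2) by (intro mult_left_mono) auto
  then show ?thesis using M(1)[OF x(1)] by linarith
qed

lemma multilinear_diagonal_scaleC:
  assumes F: "bounded_multilinear_on Z k F" and Z: "complex_vector.subspace Z" and z: "z \<in> Z"
  shows "F (\<lambda>i\<in>{..<k}. c *\<^sub>C z) = c ^ k *\<^sub>C F (\<lambda>i\<in>{..<k}. z)"
proof -
  have "F (\<lambda>i\<in>{..<k}. if i < m then c *\<^sub>C z else z) = c ^ m *\<^sub>C F (\<lambda>i\<in>{..<k}. z)"
    if "m \<le> k" for m
    using that
  proof (induction m)
    case 0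
    then show ?case by simp
  next
    case (Suc m)
    define x where "x = (\<lambda>i\<in>{..<k}. if i < m then c *\<^sub>C z else z)"
    have x: "x \<in> {..<k} \<rightarrow>\<^sub>E Z"
      using z by (auto simp: x_def intro: complex_vector.subspace_scale[OF Z])
    have eq: "(\<lambda>i\<in>{..<k}. if i < Suc m then c *\<^sub>C z else z) = x(m := c *\<^sub>C z)"
      using Suc.prems by (auto simp: x_def fun_eq_iff restrict_def less_Suc_eq)
    have "F (x(m := c *\<^sub>C z)) = c *\<^sub>C F (x(m := z))"
      using Suc.prems z by (intro multilinear_slot_scaleC[OF F x]) auto
    also have "x(m := z) = x" using Suc.prems by (auto simp: x_def fun_eq_iff)
    also have "F x = c ^ m *\<^sub>C F (\<lambda>i\<in>{..<k}. z)" unfolding x_def by (rule Suc.IH) (use Suc.prems in simp)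
    finally show ?case unfolding eq by (simp only: scaleC_scaleC power_Suc)
  qed
  from this[of k] have "F (\<lambda>i\<in>{..<k}. if i < k then c *\<^sub>C z else z) = c ^ k *\<^sub>C F (\<lambda>i\<in>{..<k}. z)"
    by simp
  moreover have "(\<lambda>i\<in>{..<k}. if i < k then c *\<^sub>C z else z) = (\<lambda>i\<in>{..<k}. c *\<^sub>C z)" by auto
  ultimately show ?thesis by simp
qed

section \<open>Sign averaging and sums of differences of a polynomial\<close>

text \<open>On average over independent signs the off-diagonal terms of the right-hand sum cancel
  and the diagonal sum remains, so some choice of signs does at least as well as the average. The
  induction fixes one sign at a time; \<open>a\<close> and \<open>g\<close> carry the contributions
  of the signs already chosen.\<close>

lemma exists_signs_norm_le:
  fixes B :: "'a::complex_normed_vector \<Rightarrow> 'i \<Rightarrow> 'b::real_normed_vector"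
  assumes Z: "complex_vector.subspace Z" and "finite I" and z: "\<And>i. i \<in> I \<Longrightarrow> z i \<in> Z"
    and add: "\<And>i x y. i \<in> I \<Longrightarrow> x \<in> Z \<Longrightarrow> y \<in> Z \<Longrightarrow> B (x + y) i = B x i + B y i"
  shows "\<exists>e :: 'i \<Rightarrow> real. (\<forall>i. e i \<in> {-1, 1}) \<and>
    norm (\<Sum>i\<in>I. B (z i) i) \<le> norm (\<Sum>i\<in>I. e i *\<^sub>R B (\<Sum>j\<in>I. e j *\<^sub>R z j) i)"
proof -
  have "\<exists>e :: 'i \<Rightarrow> real. (\<forall>i. e i \<in> {-1, 1}) \<and> norm (g a + (\<Sum>i\<in>I. B (z i) i)) \<le>
      norm (g (a + (\<Sum>j\<in>I. e j *\<^sub>R z j)) + (\<Sum>i\<in>I. e i *\<^sub>R B (a + (\<Sum>j\<in>I. e j *\<^sub>R z j)) i))"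
    if "a \<in> Z" "\<And>x y. x \<in> Z \<Longrightarrow> y \<in> Z \<Longrightarrow> g (x + y) = g x + g y" for a and g :: "'a \<Rightarrow> 'b"
    using \<open>finite I\<close> z add that
  proof (induction I arbitrary: a g rule: finite_induct)
    case empty
    show ?case by (intro exI[of _ "\<lambda>_. 1"]) simp
  next
    case (insert j I)
    note zj = insert.prems(1)[of j, simplified]
    have neg: "h (x - y) = h x - h y"
      if h: "\<And>x y. x \<in> Z \<Longrightarrow> y \<in> Z \<Longrightarrow> h (x + y) = h x + h y" and "x \<in> Z" "y \<in> Z"
      for h :: "'a \<Rightarrow> 'b" and x y
      using h[of "x - y" y] that by (simp add: complex_vector.subspace_diff[OF Z])
    define S where "S = (\<Sum>i\<in>I. B (z i) i)"
    define G where "G s x = g x + s *\<^sub>R B x j" for s :: real and x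
    have Gadd: "G s (x + y) = G s x + G s y" if "x \<in> Z" "y \<in> Z" for s x y
      using insert.prems(2)[of j x y] insert.prems(4)[of x y] that
      by (simp add: G_def algebra_simps)
    \<comment> \<open>Average of the two choices for the sign at \<open>j\<close>: the mixed terms
      \<open>g (z j)\<close> and \<open>B a j\<close> cancel.\<close>
    have Gsum: "2 *\<^sub>R (g a + B (z j) j) = G 1 (a + z j) + G (-1) (a - z j)"
      using insert.prems(2)[of j a "z j"] insert.prems(4)[of a "z j"] zj insert.prems(3)
        neg[of g a "z j"] neg[of "\<lambda>x. B x j" a "z j"] insert.prems(2)[of j]  insert.prems(4)
      by (simp add: G_def scaleR_2)
    have "2 *\<^sub>R (g a + (B (z j) j + S)) = (G 1 (a + z j) + S) + (G (-1) (a - z j) + S)"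
      using Gsum by (simp add: algebra_simps scaleR_2)
    then have "2 * norm (g a + (B (z j) j + S)) \<le> norm (G 1 (a + z j) + S) + norm (G (-1) (a - z j) + S)"
      by (metis norm_scaleR norm_triangle_ineq abs_numeral)
    then have "norm (g a + (B (z j) j + S)) \<le> norm (G 1 (a + 1 *\<^sub>R z j) + S) \<or>
        norm (g a + (B (z j) j + S)) \<le> norm (G (-1) (a + (-1) *\<^sub>R z j) + S)"
      by (simp, linarith)
    then obtain s :: real where s: "s \<in> {-1, 1}"
      and le: "norm (g a + (B (z j) j + S)) \<le> norm (G s (a + s *\<^sub>R z j) + S)"
      by (metis insertCI)
    define a' where "a' = a + s *\<^sub>R z j"
    have a': "a' \<in> Z"
      unfolding a'_def using insert.prems(3) zj
      by (intro complex_vector.subspace_add[OF Z] subspace_scaleR[OF Z])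
    obtain e :: "'i \<Rightarrow> real" where e: "\<And>i. e i \<in> {-1, 1}"
      and le': "norm (G s a' + (\<Sum>i\<in>I. B (z i) i)) \<le>
        norm (G s (a' + (\<Sum>j\<in>I. e j *\<^sub>R z j)) + (\<Sum>i\<in>I. e i *\<^sub>R B (a' + (\<Sum>j\<in>I. e j *\<^sub>R z j)) i))"
      using insert.IH[of a' "G s"] insert.prems a' Gadd by auto
    define e' where "e' = e(j := s)"
    have e'I: "e' i = e i" if "i \<in> I" for i using that insert.hyps by (auto simp: e'_def)
    have sum: "(\<Sum>i\<in>insert j I. e' i *\<^sub>R v i) = s *\<^sub>R v j + (\<Sum>i\<in>I. e i *\<^sub>R v i)"
      for v :: "'i \<Rightarrow> 'c::real_vector"
      using insert.hyps e'I by (simp add: e'_def cong: sum.cong)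
    have eq: "a + (\<Sum>i\<in>insert j I. e' i *\<^sub>R z i) = a' + (\<Sum>i\<in>I. e i *\<^sub>R z i)"
      by (simp add: sum a'_def)
    show ?case
    proof (intro exI conjI allI)
      show "e' i \<in> {-1, 1}" for i using e s by (simp add: e'_def)
      show "norm (g a + (\<Sum>i\<in>insert j I. B (z i) i)) \<le>
        norm (g (a + (\<Sum>j\<in>insert j I. e' j *\<^sub>R z j)) +
          (\<Sum>i\<in>insert j I. e' i *\<^sub>R B (a + (\<Sum>j\<in>insert j I. e' j *\<^sub>R z j)) i))"
        unfolding eq unfolding sum using le le' insert.hyps
        by (simp add: S_def a'_def[symmetric] G_def add.assoc)
    qed
  qed
  from this[of 0 "\<lambda>_. 0"] show ?thesis
    using complex_vector.subspace_0[OF Z] by simp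
qed

text \<open>Random signs decouple one factor at a time: each step replaces a slot carrying \<open>z i\<close> by the
  single vector \<open>\<Sum>j\<in>I. e j *\<^sub>R z j\<close>, and the last remaining slot is handled by linearity.\<close>

lemma multilinear_diagonal_sum_bound:
  assumes F: "bounded_multilinear_on Z k F" and Z: "complex_vector.subspace Z"
    and M: "\<And>x. x \<in> {..<k} \<rightarrow>\<^sub>E Z \<Longrightarrow> norm (F x) \<le> M * (\<Prod>i<k. norm (x i))" "M \<ge> 0"
    and I: "finite I" "\<And>i. i \<in> I \<Longrightarrow> z i \<in> Z"
    and C: "\<And>s. (\<And>i. s i \<in> {-1, 1 :: real}) \<Longrightarrow> norm (\<Sum>i\<in>I. s i *\<^sub>R z i) \<le> C"
    and J: "finite J" "J \<noteq> {}" "J \<subseteq> {..<k}"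
    and c: "\<And>l. l < k \<Longrightarrow> c l \<in> Z" "\<And>l. l < k \<Longrightarrow> norm (c l) \<le> C"
    and s: "\<And>i. s i \<in> {-1, 1 :: real}"
  shows "norm (\<Sum>i\<in>I. s i *\<^sub>R F (\<lambda>l\<in>{..<k}. if l \<in> J then z i else c l)) \<le> M * C ^ k"
  using J c s
proof (induction J arbitrary: c s rule: finite_ne_induct)
  case (singleton m)
  define x where "x = (\<lambda>l\<in>{..<k}. c l)"
  have x: "x \<in> {..<k} \<rightarrow>\<^sub>E Z" using singleton by (auto simp: x_def)
  have m: "m < k" using singleton by simp
  have sumZ: "(\<Sum>i\<in>I. s i *\<^sub>R z i) \<in> Z"
    using I by (intro complex_vector.subspace_sum[OF Z] subspace_scaleR[OF Z]) auto
  have "(\<lambda>l\<in>{..<k}. if l \<in> {m} then y else c l) = x(m := y)" for y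
    using m by (auto simp: x_def fun_eq_iff)
  then have "(\<Sum>i\<in>I. s i *\<^sub>R F (\<lambda>l\<in>{..<k}. if l \<in> {m} then z i else c l)) =
      F (x(m := \<Sum>i\<in>I. s i *\<^sub>R z i))"
    using multilinear_slot_sum[OF F x m Z I] by simp
  also have "norm \<dots> \<le> M * C ^ k"
    by (rule multilinear_bound_power[OF M])
      (use x m sumZ C[OF singleton(4)] singleton in \<open>auto simp: x_def PiE_iff extensional_def\<close>)
  finally show ?case .
next
  case (insert m J)
  have m: "m < k" using insert.prems by simp
  define x where "x i = (\<lambda>l\<in>{..<k}. if l \<in> J then z i else c l)" for i
  have x: "x i \<in> {..<k} \<rightarrow>\<^sub>E Z" if "i \<in> I" for i
    using insert.prems I(2)[OF that] by (auto simp: x_def)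
  define B where "B y i = s i *\<^sub>R F ((x i)(m := y))" for y i
  have add: "B (y + y') i = B y i + B y' i" if "i \<in> I" "y \<in> Z" "y' \<in> Z" for i y y'
    using multilinear_slot_add[OF F x m, of i y y'] that by (simp add: B_def algebra_simps)
  obtain e where e: "\<And>i. e i \<in> {-1, 1}"
    "norm (\<Sum>i\<in>I. B (z i) i) \<le> norm (\<Sum>i\<in>I. e i *\<^sub>R B (\<Sum>j\<in>I. e j *\<^sub>R z j) i)"
    using exists_signs_norm_le[of Z I z B, OF Z I add] by blast
  define y where "y = (\<Sum>j\<in>I. e j *\<^sub>R z j)"
  have y: "y \<in> Z" "norm y \<le> C"
    unfolding y_def using I C[OF e(1)]
    by (auto intro!: complex_vector.subspace_sum[OF Z] subspace_scaleR[OF Z])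
  have xm: "(x i)(m := w) = (\<lambda>l\<in>{..<k}. if l \<in> J then z i else (c(m := w)) l)" for i w
    using m insert.hyps by (auto simp: x_def fun_eq_iff)
  have xm': "(\<lambda>l\<in>{..<k}. if l \<in> insert m J then z i else c l) = (x i)(m := z i)" for i
    using m insert.hyps by (auto simp: x_def fun_eq_iff)
  have "norm (\<Sum>i\<in>I. s i *\<^sub>R F (\<lambda>l\<in>{..<k}. if l \<in> insert m J then z i else c l)) =
      norm (\<Sum>i\<in>I. B (z i) i)"
    by (simp only: B_def xm')
  also have "\<dots> \<le> norm (\<Sum>i\<in>I. e i *\<^sub>R B y i)" using e(2) by (simp add: y_def)
  also have "(\<Sum>i\<in>I. e i *\<^sub>R B y i) =
      (\<Sum>i\<in>I. (e i * s i) *\<^sub>R F (\<lambda>l\<in>{..<k}. if l \<in> J then z i else (c(m := y)) l))"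
    by (simp add: B_def xm)
  also have "norm \<dots> \<le> M * C ^ k"
  proof (rule insert.IH)
    show "e i * s i \<in> {-1, 1}" for i using e(1)[of i] insert.prems(4)[of i] by auto
  qed (use insert.prems y in auto)
  finally show ?case .
qed

text \<open>Such a bound with one \<open>C\<close> for all finite \<open>I\<close> says that the
  series of the \<open>z i\<close> is weakly unconditionally Cauchy, as for the unit vectors of
  c_0.\<close>

definition signed_sums_le :: "'i set \<Rightarrow> ('i \<Rightarrow> 'a::real_normed_vector) \<Rightarrow> real \<Rightarrow> bool"
  where "signed_sums_le I z C \<longleftrightarrow>
    (\<forall>s. (\<forall>i. s i \<in> {-1, 1 :: real}) \<longrightarrow> norm (\<Sum>i\<in>I. s i *\<^sub>R z i) \<le> C)"

text \<open>Subtracting \<open>Q f\<close> removes exactly the term of the empty set from the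
  binomial expansion. Every other term has \<open>z i\<close> in some slot, so sign averaging bounds
  its sum over \<open>I\<close>. As \<open>C\<close> bounds \<open>f\<close> too, each term costs at
  most \<open>M * C ^ k\<close>, whatever \<open>I\<close> and \<open>z\<close> are.\<close>

lemma homogeneous_polynomial_difference_sum_bound:
  fixes Z :: "'a::complex_normed_vector set"
  assumes Q: "homogeneous_polynomial_on Z k Q" and Z: "complex_vector.subspace Z"
    and f: "f \<in> Z" "norm f \<le> C"
  shows "\<exists>D. \<forall>(I :: 'i set) z. finite I \<longrightarrow> z \<in> I \<rightarrow> Z \<longrightarrow> signed_sums_le I z C \<longrightarrow>
    norm (\<Sum>i\<in>I. Q (f + z i) - Q f) \<le> D"
proof -
  obtain F where F: "bounded_multilinear_on Z k F" and QF: "\<And>z. z \<in> Z \<Longrightarrow> Q z = F (\<lambda>i\<in>{..<k}. z)"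
    using Q unfolding homogeneous_polynomial_on_def by blast
  obtain M where M: "M \<ge> 0" "\<And>x. x \<in> {..<k} \<rightarrow>\<^sub>E Z \<Longrightarrow> norm (F x) \<le> M * (\<Prod>i<k. norm (x i))"
    using multilinear_bound[OF F] by blast
  let ?P = "Pow {..<k} - {{}}"
  show ?thesis
  proof (intro exI allI impI)
    fix I :: "'i set" and z :: "'i \<Rightarrow> 'a"
    assume I: "finite I" and z': "z \<in> I \<rightarrow> Z" and C': "signed_sums_le I z C"
    have z: "\<And>i. i \<in> I \<Longrightarrow> z i \<in> Z" using z' by auto
    have C: "norm (\<Sum>i\<in>I. s i *\<^sub>R z i) \<le> C" if "\<And>i. s i \<in> {-1, 1}" for s
      using C' that unfolding signed_sums_le_def by simp
    have "Q (f + z i) - Q f = (\<Sum>J\<in>?P. F (\<lambda>l\<in>{..<k}. if l \<in> J then z i else f))"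
      if "i \<in> I" for i
    proof -
      have "Q (f + z i) = (\<Sum>J\<in>Pow {..<k}. F (\<lambda>l\<in>{..<k}. if l \<in> J then z i else f))"
        using multilinear_binomial[OF F Z, of "\<lambda>_. f" "\<lambda>_. z i"] f z[OF that]
        by (simp add: QF complex_vector.subspace_add[OF Z])
      also have "\<dots> = Q f + (\<Sum>J\<in>?P. F (\<lambda>l\<in>{..<k}. if l \<in> J then z i else f))"
        using f by (subst sum.remove[of _ "{}"]) (auto simp: QF)
      finally show ?thesis by simp
    qed
    then have "(\<Sum>i\<in>I. Q (f + z i) - Q f) =
        (\<Sum>J\<in>?P. \<Sum>i\<in>I. 1 *\<^sub>R F (\<lambda>l\<in>{..<k}. if l \<in> J then z i else f))"
      by (subst sum.swap) simp
    also have "norm \<dots> \<le> real (card ?P) * (M * C ^ k)"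
    proof (rule sum_norm_bound)
      fix J assume J: "J \<in> ?P"
      then have "finite J" by (auto intro: finite_subset)
      with J show "norm (\<Sum>i\<in>I. 1 *\<^sub>R F (\<lambda>l\<in>{..<k}. if l \<in> J then z i else f)) \<le> M * C ^ k"
        by (intro multilinear_diagonal_sum_bound[OF F Z M(2,1) I z C]) (use f in auto)
    qed
    finally show "norm (\<Sum>i\<in>I. Q (f + z i) - Q f) \<le> real (card ?P) * (M * C ^ k)" .
  qed
qed

lemma polynomial_difference_sum_bound:
  fixes Z :: "'a::complex_normed_vector set"
  assumes P: "polynomial_on Z P" and Z: "complex_vector.subspace Z"
    and f: "f \<in> Z" "norm f \<le> C"
  shows "\<exists>D. \<forall>(I :: 'i set) z. finite I \<longrightarrow> z \<in> I \<rightarrow> Z \<longrightarrow> signed_sums_le I z C \<longrightarrow>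
    norm (\<Sum>i\<in>I. P (f + z i) - P f) \<le> D"
proof -
  obtain n :: nat and d Q where Q: "\<forall>j<n. homogeneous_polynomial_on Z (d j) (Q j)"
    and PQ: "\<forall>z\<in>Z. P z = (\<Sum>j<n. Q j z)"
    using P unfolding polynomial_on_def by blast
  have "\<forall>j\<in>{..<n}. \<exists>D. \<forall>(I :: 'i set) z. finite I \<longrightarrow> z \<in> I \<rightarrow> Z \<longrightarrow> signed_sums_le I z C \<longrightarrow>
      norm (\<Sum>i\<in>I. Q j (f + z i) - Q j f) \<le> D"
  proof
    fix j assume "j \<in> {..<n}"
    then have Qj: "homogeneous_polynomial_on Z (d j) (Q j)" using Q by simp
    show "\<exists>D. \<forall>(I :: 'i set) z. finite I \<longrightarrow> z \<in> I \<rightarrow> Z \<longrightarrow> signed_sums_le I z C \<longrightarrow>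
        norm (\<Sum>i\<in>I. Q j (f + z i) - Q j f) \<le> D"
      by (rule homogeneous_polynomial_difference_sum_bound[OF Qj Z f])
  qed
  from bchoice[OF this] obtain D where D: "\<forall>j\<in>{..<n}. \<forall>(I :: 'i set) z. finite I \<longrightarrow> z \<in> I \<rightarrow> Z \<longrightarrow>
      signed_sums_le I z C \<longrightarrow> norm (\<Sum>i\<in>I. Q j (f + z i) - Q j f) \<le> D j" ..
  show ?thesis
  proof (intro exI allI impI)
    fix I :: "'i set" and z :: "'i \<Rightarrow> 'a"
    assume I: "finite I" and z: "z \<in> I \<rightarrow> Z" and C: "signed_sums_le I z C"
    have "P (f + z i) - P f = (\<Sum>j<n. Q j (f + z i) - Q j f)" if "i \<in> I" for i
    proof -
      have "f + z i \<in> Z" using z that f by (auto intro: complex_vector.subspace_add[OF Z])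
      then show ?thesis using f PQ by (simp add: sum_subtractf)
    qed
    then have "(\<Sum>i\<in>I. P (f + z i) - P f) = (\<Sum>i\<in>I. \<Sum>j<n. Q j (f + z i) - Q j f)"
      by simp
    also have "\<dots> = (\<Sum>j<n. \<Sum>i\<in>I. Q j (f + z i) - Q j f)" by (rule sum.swap)
    also have "norm \<dots> \<le> (\<Sum>j<n. D j)"
      by (rule sum_norm_le) (rule D[rule_format, OF _ I z C])
    finally show "norm (\<Sum>i\<in>I. P (f + z i) - P f) \<le> (\<Sum>j<n. D j)" .
  qed
qed

section \<open>Values, bounds and radial continuity of polynomials\<close>

lemma homogeneous_polynomial_scaleC:
  assumes "homogeneous_polynomial_on Z k Q" "complex_vector.subspace Z" "z \<in> Z"
  shows "Q (c *\<^sub>C z) = c ^ k *\<^sub>C Q z"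
  using assms multilinear_diagonal_scaleC unfolding homogeneous_polynomial_on_def
  by (metis complex_vector.subspace_scale)

lemma homogeneous_polynomial_bound:
  assumes "homogeneous_polynomial_on Z k Q"
  shows "\<exists>M. \<forall>z\<in>unit_ball Z. norm (Q z) \<le> M"
proof -
  obtain F where F: "bounded_multilinear_on Z k F" and QF: "\<And>z. z \<in> Z \<Longrightarrow> Q z = F (\<lambda>i\<in>{..<k}. z)"
    using assms unfolding homogeneous_polynomial_on_def by blast
  obtain M where M: "M \<ge> 0" "\<And>x. x \<in> {..<k} \<rightarrow>\<^sub>E Z \<Longrightarrow> norm (F x) \<le> M * (\<Prod>i<k. norm (x i))"
    using multilinear_bound[OF F] by blast
  show ?thesis
  proof (intro exI ballI)
    fix z assume z: "z \<in> unit_ball Z"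
    have "norm (F (\<lambda>i\<in>{..<k}. z)) \<le> M * 1 ^ k"
    proof (rule multilinear_bound_power[OF M(2,1)])
      show "(\<lambda>i\<in>{..<k}. z) \<in> {..<k} \<rightarrow>\<^sub>E Z"
        unfolding restrict_PiE_iff using z by (simp add: unit_ball_def)
    qed (use z in \<open>simp_all add: unit_ball_def\<close>)
    then show "norm (Q z) \<le> M * 1 ^ k" using z by (simp add: QF unit_ball_def)
  qed
qed

lemma polynomial_in:
  assumes P: "polynomial_on Z P" and Z: "complex_vector.subspace Z" and "z \<in> Z"
  shows "P z \<in> Z"
proof -
  obtain n :: nat and d Q where Q: "\<forall>j<n. homogeneous_polynomial_on Z (d j) (Q j)"
    and PQ: "\<forall>z\<in>Z. P z = (\<Sum>j<n. Q j z)"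
    using P unfolding polynomial_on_def by blast
  have "Q j z \<in> Z" if "j < n" for j
  proof -
    obtain F where F: "bounded_multilinear_on Z (d j) F" "Q j z = F (\<lambda>i\<in>{..<d j}. z)"
      using Q \<open>j < n\<close> \<open>z \<in> Z\<close> unfolding homogeneous_polynomial_on_def by blast
    have "(\<lambda>i\<in>{..<d j}. z) \<in> {..<d j} \<rightarrow>\<^sub>E Z" using \<open>z \<in> Z\<close> by auto
    with F show ?thesis unfolding bounded_multilinear_on_def by simp
  qed
  then show ?thesis using PQ \<open>z \<in> Z\<close> by (auto intro!: complex_vector.subspace_sum[OF Z])
qed

lemma polynomial_bounded:
  assumes "polynomial_on Z P"
  obtains M where "\<And>z. z \<in> unit_ball Z \<Longrightarrow> norm (P z) \<le> M"
proof -
  obtain n :: nat and d Q where Q: "\<forall>j<n. homogeneous_polynomial_on Z (d j) (Q j)"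
    and PQ: "\<forall>z\<in>Z. P z = (\<Sum>j<n. Q j z)"
    using assms unfolding polynomial_on_def by blast
  have "\<forall>j\<in>{..<n}. \<exists>M. \<forall>z\<in>unit_ball Z. norm (Q j z) \<le> M"
    using Q homogeneous_polynomial_bound by blast
  from bchoice[OF this] obtain M where M: "\<forall>j\<in>{..<n}. \<forall>z\<in>unit_ball Z. norm (Q j z) \<le> M j"
    by blast
  have "norm (P z) \<le> (\<Sum>j<n. M j)" if "z \<in> unit_ball Z" for z
    using PQ M that by (auto simp: unit_ball_def intro!: sum_norm_le)
  then show ?thesis using that by blast
qed

text \<open>Along a ray P is an ordinary polynomial in \<open>r\<close> with the vectors
  \<open>Q j z\<close> as coefficients. This moves almost norming points into the open ball.\<close>

lemma polynomial_radial_limit: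
  assumes P: "polynomial_on Z P" and Z: "complex_vector.subspace Z" and z: "z \<in> Z"
  shows "((\<lambda>r. P (r *\<^sub>R z)) \<longlongrightarrow> P z) (at_left 1)"
proof -
  obtain n :: nat and d Q where Q: "\<forall>j<n. homogeneous_polynomial_on Z (d j) (Q j)"
    and PQ: "\<forall>z\<in>Z. P z = (\<Sum>j<n. Q j z)"
    using P unfolding polynomial_on_def by blast
  have "P (r *\<^sub>R z) = (\<Sum>j<n. r ^ d j *\<^sub>R Q j z)" for r
  proof -
    have "Q j (r *\<^sub>R z) = r ^ d j *\<^sub>R Q j z" if "j < n" for j
      using homogeneous_polynomial_scaleC[OF Q[rule_format, OF that] Z z, of "complex_of_real r"]
      by (simp add: scaleC_of_real flip: of_real_power)
    then show ?thesis using PQ subspace_scaleR[OF Z z, of r] by simp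
  qed
  moreover have "((\<lambda>r. \<Sum>j<n. r ^ d j *\<^sub>R Q j z) \<longlongrightarrow> (\<Sum>j<n. 1 ^ d j *\<^sub>R Q j z)) (at_left (1 :: real))"
    by (intro tendsto_intros)
  ultimately show ?thesis using PQ z by simp
qed

section \<open>Building polynomials: finite sums, constants, affine substitution\<close>

lemma polynomial_on_finite_sum:
  assumes "finite I" "\<And>i. i \<in> I \<Longrightarrow> homogeneous_polynomial_on Z (d i) (Q i)"
    and "\<And>z. z \<in> Z \<Longrightarrow> P z = (\<Sum>i\<in>I. Q i z)"
  shows "polynomial_on Z P"
proof -
  obtain h where h: "bij_betw h {..<card I} I"
    using ex_bij_betw_nat_finite[OF \<open>finite I\<close>] by (auto simp: atLeast0LessThan)
  have "P z = (\<Sum>j<card I. (Q \<circ> h) j z)" if "z \<in> Z" for z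
    using sum.reindex_bij_betw[OF h, of "\<lambda>i. Q i z"] assms(3)[OF that] by simp
  moreover have "homogeneous_polynomial_on Z ((d \<circ> h) j) ((Q \<circ> h) j)" if "j < card I" for j
    using assms(2) bij_betwE[OF h] that by simp
  ultimately show ?thesis unfolding polynomial_on_def by blast
qed

lemma homogeneous_polynomial_const:
  assumes "b \<in> Z"
  shows "homogeneous_polynomial_on Z 0 (\<lambda>_. b)"
  unfolding homogeneous_polynomial_on_def bounded_multilinear_on_def
  using assms by (intro exI[of _ "\<lambda>_. b"]) auto

lemma polynomial_on_const: "b \<in> Z \<Longrightarrow> polynomial_on Z (\<lambda>_. b)"
  by (rule polynomial_on_finite_sum[of "{()}" _ "\<lambda>_. 0" "\<lambda>_ _. b"])
    (auto intro: homogeneous_polynomial_const)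

definition bounded_clinear_on ::
  "'a::complex_normed_vector set \<Rightarrow> 'b::complex_normed_vector set \<Rightarrow> ('a \<Rightarrow> 'b) \<Rightarrow> bool"
  where "bounded_clinear_on X Y L \<longleftrightarrow> L \<in> X \<rightarrow> Y \<and>
    (\<forall>x\<in>X. \<forall>y\<in>X. L (x + y) = L x + L y) \<and> (\<forall>c. \<forall>x\<in>X. L (c *\<^sub>C x) = c *\<^sub>C L x) \<and>
    (\<exists>M. \<forall>x\<in>X. norm (L x) \<le> M * norm x)"

lemma bounded_clinear_on_bound:
  assumes "bounded_clinear_on X Y L"
  obtains M where "M \<ge> 0" "\<And>x. x \<in> X \<Longrightarrow> norm (L x) \<le> M * norm x"
proof -
  obtain M where M: "norm (L x) \<le> M * norm x" if "x \<in> X" for x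
    using assms unfolding bounded_clinear_on_def by blast
  have "norm (L x) \<le> max M 0 * norm x" if "x \<in> X" for x
    using M[OF that] mult_right_mono[of M "max M 0" "norm x"] by simp
  then show ?thesis using that[of "max M 0"] by simp
qed

lemma bounded_clinear_on_sum:
  assumes T: "bounded_clinear_on X Y T" and X: "complex_vector.subspace X"
    and "finite I" "\<And>i. i \<in> I \<Longrightarrow> f i \<in> X"
  shows "T (\<Sum>i\<in>I. f i) = (\<Sum>i\<in>I. T (f i))"
  using assms(3,4)
proof (induction I rule: finite_induct)
  case empty
  have "T (0 *\<^sub>C 0) = 0 *\<^sub>C T 0"
    using T complex_vector.subspace_0[OF X] unfolding bounded_clinear_on_def by blast
  then show ?case by simp
next
  case (insert j I)
  have "(\<Sum>i\<in>I. f i) \<in> X"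
    using insert.prems by (intro complex_vector.subspace_sum[OF X]) auto
  then show ?case using insert T unfolding bounded_clinear_on_def by simp
qed

text \<open>With the slots outside \<open>J\<close> frozen at \<open>u\<close>, one argument remains
  for each element of \<open>J\<close>. The bijection \<open>h\<close> renumbers these slots as an
  initial segment, the form in which powers of a space are encoded.\<close>

lemma homogeneous_polynomial_partial_substitution:
  fixes X :: "'a::complex_normed_vector set" and Z :: "'b::complex_normed_vector set"
  assumes F: "bounded_multilinear_on Z k F"
    and u: "u \<in> Z" and L: "bounded_clinear_on X Z L" and T: "bounded_clinear_on Z X T"
    and J: "J \<subseteq> {..<k}"
  shows "homogeneous_polynomial_on X (card J) (\<lambda>x. T (F (\<lambda>i\<in>{..<k}. if i \<in> J then L x else u)))"
proof -
  have "finite J" using J finite_subset by blast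
  then obtain h where h: "bij_betw h J {..<card J}"
    using ex_bij_betw_finite_nat[of J] by (auto simp: atLeast0LessThan)
  define S where "S y = (\<lambda>i\<in>{..<k}. if i \<in> J then L (y (h i)) else u)" for y :: "nat \<Rightarrow> 'a"
  have hJ: "h i < card J" if "i \<in> J" for i using bij_betwE[OF h] that by auto
  have LZ: "L x \<in> Z" if "x \<in> X" for x
    using L that unfolding bounded_clinear_on_def by auto
  have S: "S y \<in> {..<k} \<rightarrow>\<^sub>E Z" if "y \<in> {..<card J} \<rightarrow>\<^sub>E X" for y
    using that u LZ hJ by (auto simp: S_def PiE_iff)
  have FZ: "F x \<in> Z" if "x \<in> {..<k} \<rightarrow>\<^sub>E Z" for x
    using F that unfolding bounded_multilinear_on_def by blast
  have slot: "\<exists>i<k. \<forall>v. S (y(j := v)) = (S y)(i := L v)" if "j < card J" for y j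
  proof -
    obtain i where i: "i \<in> J" "h i = j"
      using h \<open>j < card J\<close> unfolding bij_betw_def by (metis imageE lessThan_iff)
    have hi: "h i' = j \<longleftrightarrow> i' = i" if "i' \<in> J" for i'
      using h i that unfolding bij_betw_def inj_on_def by blast
    have "i < k" using i J by auto
    moreover have "S (y(j := v)) l = ((S y)(i := L v)) l" for v l
      using i hi[of l] \<open>i < k\<close> by (cases "l \<in> J") (auto simp: S_def)
    ultimately show ?thesis by blast
  qed
  obtain BF where BF: "BF \<ge> 0" "\<And>x. x \<in> {..<k} \<rightarrow>\<^sub>E Z \<Longrightarrow> norm (F x) \<le> BF * (\<Prod>i<k. norm (x i))"
    using multilinear_bound[OF F] by blast
  obtain BL where BL: "BL \<ge> 0" "\<And>x. x \<in> X \<Longrightarrow> norm (L x) \<le> BL * norm x"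
    using bounded_clinear_on_bound[OF L] by blast
  obtain BT where BT: "BT \<ge> 0" "\<And>x. x \<in> Z \<Longrightarrow> norm (T x) \<le> BT * norm x"
    using bounded_clinear_on_bound[OF T] by blast
  have "bounded_multilinear_on X (card J) (\<lambda>y. T (F (S y)))"
    unfolding bounded_multilinear_on_def
  proof (intro conjI ballI allI impI)
    fix y assume y: "y \<in> {..<card J} \<rightarrow>\<^sub>E X"
    show "T (F (S y)) \<in> X" using T FZ[OF S[OF y]] unfolding bounded_clinear_on_def by auto
    fix j assume j: "j < card J"
    then have yj: "y j \<in> X" using y by auto
    obtain i where i: "i < k" "\<And>v. S (y(j := v)) = (S y)(i := L v)" using slot[OF j] by blast
    have Sy: "(S y)(i := L (y j)) = S y" using i(2)[of "y j"] by simp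
    have upd: "(S y)(i := v) \<in> {..<k} \<rightarrow>\<^sub>E Z" if "v \<in> Z" for v
      using S[OF y] i(1) that by (auto simp: PiE_iff extensional_def)
    show "T (F (S (y(j := c *\<^sub>C y j)))) = c *\<^sub>C T (F (S y))" for c
    proof -
      have "F (S (y(j := c *\<^sub>C y j))) = c *\<^sub>C F ((S y)(i := L (y j)))"
        unfolding i(2) using multilinear_slot_scaleC[OF F S[OF y] i(1) LZ[OF yj]] L yj
        unfolding bounded_clinear_on_def by metis
      then show ?thesis using T FZ[OF S[OF y]] unfolding Sy bounded_clinear_on_def by simp
    qed
    fix v assume v: "v \<in> X"
    have "F (S (y(j := y j + v))) = F ((S y)(i := L (y j))) + F ((S y)(i := L v))"
      unfolding i(2) using multilinear_slot_add[OF F S[OF y] i(1) LZ[OF yj] LZ[OF v]] L yj v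
      unfolding bounded_clinear_on_def by metis
    then show "T (F (S (y(j := y j + v)))) = T (F (S y)) + T (F (S (y(j := v))))"
      using T FZ[OF S[OF y]] FZ[OF upd[OF LZ[OF v]]] unfolding Sy i(2) bounded_clinear_on_def
      by simp
  next
    show "\<exists>M. \<forall>y\<in>{..<card J} \<rightarrow>\<^sub>E X. norm (T (F (S y))) \<le> M * (\<Prod>i<card J. norm (y i))"
    proof (intro exI ballI)
      fix y assume y: "y \<in> {..<card J} \<rightarrow>\<^sub>E X"
      have "(\<Prod>i<k. norm (S y i)) \<le> (\<Prod>i<k. if i \<in> J then BL * norm (y (h i)) else norm u)"
      proof (rule prod_mono)
        fix i assume "i \<in> {..<k}"
        moreover have "y (h i) \<in> X" if "i \<in> J" using y hJ[OF that] by auto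
        ultimately show "0 \<le> norm (S y i) \<and> norm (S y i) \<le> (if i \<in> J then BL * norm (y (h i)) else norm u)"
          using BL(2) by (auto simp: S_def)
      qed
      also have "\<dots> = (\<Prod>i\<in>{..<k} \<inter> J. BL * norm (y (h i))) * (\<Prod>i\<in>{..<k} \<inter> - J. norm u)"
        by (subst prod.If_cases) (auto simp: Int_def)
      also have "{..<k} \<inter> J = J" using J by auto
      also have "(\<Prod>i\<in>J. BL * norm (y (h i))) = BL ^ card J * (\<Prod>j<card J. norm (y j))"
        using prod.reindex_bij_betw[OF h, of "\<lambda>j. norm (y j)"] by (simp add: prod.distrib)
      finally have *: "(\<Prod>i<k. norm (S y i)) \<le>
          BL ^ card J * (\<Prod>j<card J. norm (y j)) * (\<Prod>i\<in>{..<k} \<inter> - J. norm u)" .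
      have "norm (T (F (S y))) \<le> BT * norm (F (S y))" by (rule BT(2)[OF FZ[OF S[OF y]]])
      also have "\<dots> \<le> BT * (BF * (\<Prod>i<k. norm (S y i)))"
        by (intro mult_left_mono BF(2) S y BT(1))
      also have "\<dots> \<le> BT * (BF * (BL ^ card J * (\<Prod>j<card J. norm (y j)) *
          (\<Prod>i\<in>{..<k} \<inter> - J. norm u)))"
        by (intro mult_left_mono * BT(1) BF(1))
      also have "\<dots> = BT * BF * BL ^ card J * (\<Prod>i\<in>{..<k} \<inter> - J. norm u) *
          (\<Prod>j<card J. norm (y j))"
        by (simp only: mult_ac)
      finally show "norm (T (F (S y))) \<le> BT * BF * BL ^ card J * (\<Prod>i\<in>{..<k} \<inter> - J. norm u) *
          (\<Prod>j<card J. norm (y j))" .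
    qed
  qed
  moreover have "S (\<lambda>j\<in>{..<card J}. x) = (\<lambda>i\<in>{..<k}. if i \<in> J then L x else u)" for x
    using hJ by (auto simp: S_def fun_eq_iff)
  ultimately show ?thesis unfolding homogeneous_polynomial_on_def by metis
qed

text \<open>Translation by \<open>u\<close> destroys homogeneity: the binomial expansion splits each
  summand into pieces of degree \<open>card J\<close>, one for each set \<open>J\<close> of slots
  that receive \<open>L x\<close>. The lemma serves in both directions, from A(K,X) to X with
  \<open>T\<close> an evaluation and from X to A(K,X) with \<open>T\<close> a tensor map.\<close>

lemma polynomial_on_affine_substitution:
  fixes X :: "'a::complex_normed_vector set" and Z :: "'b::complex_normed_vector set"
  assumes P: "polynomial_on Z P" and Z: "complex_vector.subspace Z"
    and u: "u \<in> Z" and L: "bounded_clinear_on X Z L" and T: "bounded_clinear_on Z X T"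
  shows "polynomial_on X (\<lambda>x. T (P (u + L x)))"
proof -
  obtain n :: nat and d Q where Q: "\<forall>j<n. homogeneous_polynomial_on Z (d j) (Q j)"
    and PQ: "\<forall>z\<in>Z. P z = (\<Sum>j<n. Q j z)"
    using P unfolding polynomial_on_def by blast
  have "\<forall>j\<in>{..<n}. \<exists>F. bounded_multilinear_on Z (d j) F \<and> (\<forall>z\<in>Z. Q j z = F (\<lambda>i\<in>{..<d j}. z))"
    using Q unfolding homogeneous_polynomial_on_def by blast
  from bchoice[OF this] obtain F where F: "\<And>j. j < n \<Longrightarrow> bounded_multilinear_on Z (d j) (F j)"
    and QF: "\<And>j z. j < n \<Longrightarrow> z \<in> Z \<Longrightarrow> Q j z = F j (\<lambda>i\<in>{..<d j}. z)"
    by blast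
  define H where "H j J x = T (F j (\<lambda>i\<in>{..<d j}. if i \<in> J then L x else u))" for j J x
  let ?I = "SIGMA j:{..<n}. Pow {..<d j}"
  show ?thesis
  proof (rule polynomial_on_finite_sum[of ?I _ "\<lambda>(j, J). card J" "\<lambda>(j, J). H j J"])
    show "finite ?I" by auto
    show "homogeneous_polynomial_on X (case p of (j, J) \<Rightarrow> card J) (case p of (j, J) \<Rightarrow> H j J)"
      if "p \<in> ?I" for p
      using that homogeneous_polynomial_partial_substitution[OF F u L T] by (auto simp: H_def[abs_def])
    fix x assume x: "x \<in> X"
    then have Lx: "L x \<in> Z" using L unfolding bounded_clinear_on_def by auto
    have FZ: "F j (\<lambda>i\<in>{..<d j}. if i \<in> J then L x else u) \<in> Z" if "j < n" for j J
    proof -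
      have "(\<lambda>i\<in>{..<d j}. if i \<in> J then L x else u) \<in> {..<d j} \<rightarrow>\<^sub>E Z" using u Lx by auto
      then show ?thesis using F[OF that] unfolding bounded_multilinear_on_def by blast
    qed
    have "P (u + L x) = (\<Sum>j<n. \<Sum>J\<in>Pow {..<d j}. F j (\<lambda>i\<in>{..<d j}. if i \<in> J then L x else u))"
      using PQ complex_vector.subspace_add[OF Z u Lx] u Lx
      by (auto simp: QF intro!: sum.cong multilinear_binomial[OF F Z])
    also have "\<dots> = (\<Sum>(j, J)\<in>?I. F j (\<lambda>i\<in>{..<d j}. if i \<in> J then L x else u))"
      by (rule sum.Sigma) auto
    also have "T \<dots> = (\<Sum>(j, J)\<in>?I. H j J x)"
      by (subst bounded_clinear_on_sum[OF T Z]) (use FZ in \<open>auto simp: H_def intro!: sum.cong\<close>)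
    finally show "T (P (u + L x)) = (\<Sum>p\<in>?I. (case p of (j, J) \<Rightarrow> H j J) x)"
      by (simp add: case_prod_beta)
  qed
qed

section \<open>Peaking functions in uniform algebras\<close>

lemma scaleC_complex_eq [simp]: "a *\<^sub>C b = a * b" for a b :: complex
  by (simp add: scaleC_complex_def)

lemma tensor_apply [simp]: "tensor f x t = f t *\<^sub>C x"
  by (simp add: tensor_def)

fun pointwise_power :: "('k::topological_space \<Rightarrow>\<^sub>C complex) \<Rightarrow> nat \<Rightarrow> ('k \<Rightarrow>\<^sub>C complex)"
  where
    "pointwise_power f 0 = const_bcontfun 1"
  | "pointwise_power f (Suc n) = f \<odot> pointwise_power f n"

lemma pointwise_power_apply [simp]: "pointwise_power f n t = f t ^ n"
  by (induction n) auto

lemma uniform_algebraD: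
  assumes "uniform_algebra A"
  shows "complex_vector.subspace A" "closed A" "const_bcontfun c \<in> A"
    "f \<in> A \<Longrightarrow> g \<in> A \<Longrightarrow> f \<odot> g \<in> A"
    "s \<noteq> t \<Longrightarrow> \<exists>f\<in>A. apply_bcontfun f s \<noteq> apply_bcontfun f t"
  using assms unfolding uniform_algebra_def by blast+

lemma pointwise_power_in:
  assumes "uniform_algebra A" "f \<in> A"
  shows "pointwise_power f n \<in> A"
  by (induction n) (use assms in \<open>auto intro: uniform_algebraD\<close>)

lemma norm_attained_on:
  fixes f :: "'k::topological_space \<Rightarrow>\<^sub>C 'a::real_normed_vector"
  assumes "compact E" "E \<noteq> {}"
  obtains t where "t \<in> E" "\<And>s. s \<in> E \<Longrightarrow> norm (f s) \<le> norm (f t)"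
  using continuous_attains_sup[OF assms, of "\<lambda>t. norm (f t)"] by (auto intro: continuous_on_norm)

lemma norm_attained:
  fixes f :: "'k::topological_space \<Rightarrow>\<^sub>C 'a::real_normed_vector"
  assumes "compact (UNIV :: 'k set)"
  obtains t where "norm (f t) = norm f"
proof -
  obtain t where "\<And>s. norm (f s) \<le> norm (f t)"
    using norm_attained_on[OF assms, of f] by auto
  then have "norm (f t) = norm f"
    using norm_bound[of f "norm (f t)"] norm_bounded[of f t] by simp
  then show ?thesis by (rule that)
qed

section \<open>Approximate peaking and the Shilov boundary\<close>

text \<open>The function and its point \<open>s\<close> may change with \<tau>, and \<open>s\<close>
  is merely somewhere in \<open>U\<close>. Exact peak points would be too much to ask: without
  metrizability of K there may be none.\<close>

definition peaks_in :: "('k::topological_space \<Rightarrow>\<^sub>C complex) set \<Rightarrow> 'k set \<Rightarrow> bool"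
  where "peaks_in A U \<longleftrightarrow> (\<forall>\<tau>>0. \<exists>g\<in>A. \<exists>s\<in>U. g s = 1 \<and> (\<forall>t. cmod (g t) \<le> 1) \<and>
    (\<forall>t. t \<notin> U \<longrightarrow> cmod (g t) \<le> \<tau>))"

definition norming_set :: "('k::topological_space \<Rightarrow>\<^sub>C complex) set \<Rightarrow> 'k set \<Rightarrow> bool"
  where "norming_set A E \<longleftrightarrow> (\<forall>f\<in>A. \<exists>t\<in>E. cmod (apply_bcontfun f t) = norm f)"

text \<open>A closed norming set meets every open \<open>U\<close> with \<open>peaks_in A U\<close>
  and hence contains this set, which is shown below to be norming when K is compact. So this is the
  smallest closed boundary, in a local form that hands out peaking functions near each of its
  points.\<close>

definition shilov_boundary :: "('k::topological_space \<Rightarrow>\<^sub>C complex) set \<Rightarrow> 'k set"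
  where "shilov_boundary A = {t. \<forall>U. open U \<longrightarrow> t \<in> U \<longrightarrow> peaks_in A U}"

lemma peaks_in_mono: "peaks_in A U \<Longrightarrow> U \<subseteq> V \<Longrightarrow> peaks_in A V"
  unfolding peaks_in_def by (meson subset_iff)

text \<open>Once the phase at \<open>s\<close> is divided out, powers of the single function
  \<open>G\<close> reach every tolerance.\<close>

lemma peaks_in_if_bounded_away:
  assumes A: "uniform_algebra A" and G: "G \<in> A" "cmod (G s) = 1" "\<And>t. cmod (G t) \<le> 1" "s \<in> V"
    and r: "r < 1" "\<And>t. t \<notin> V \<Longrightarrow> cmod (G t) \<le> r"
  shows "peaks_in A V"
  unfolding peaks_in_def
proof (intro allI impI)
  fix \<tau> :: real assume "\<tau> > 0"
  define q where "q = max r 0"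
  have q: "0 \<le> q" "q < 1" using r by (auto simp: q_def)
  obtain m where m: "q ^ m < \<tau>" using real_arch_pow_inv[OF \<open>\<tau> > 0\<close> q(2)] by blast
  define H where "H = pointwise_power (inverse (G s) *\<^sub>C G) m"
  have "H \<in> A"
    unfolding H_def
    by (intro pointwise_power_in A complex_vector.subspace_scale uniform_algebraD G)
  moreover have "G s \<noteq> 0" using G(2) by auto
  then have "H s = 1" by (simp add: H_def)
  moreover have cmodH: "cmod (H t) = cmod (G t) ^ m" for t
    using G(2) by (simp add: H_def norm_power norm_mult norm_inverse)
  moreover have "cmod (H t) \<le> 1" for t using G(3) by (simp add: cmodH power_le_one)
  moreover have "cmod (H t) \<le> \<tau>" if "t \<notin> V" for t
    using power_mono[of "cmod (G t)" q m] r(2)[OF that] m by (simp add: cmodH q_def)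
  ultimately show "\<exists>g\<in>A. \<exists>s\<in>V. g s = 1 \<and> (\<forall>t. cmod (g t) \<le> 1) \<and>
      (\<forall>t. t \<notin> V \<longrightarrow> cmod (g t) \<le> \<tau>)"
    using G(4) by blast
qed

text \<open>If \<open>f\<close> attains its norm nowhere on \<open>E - V\<close>, then for large \<open>n\<close> every product \<open>f ^ n * h\<close> with
  \<open>h\<close> among the functions defining \<open>V\<close> has norm below \<open>1\<close>, and off \<open>V\<close> some \<open>h\<close> has modulus at
  least \<open>1\<close>; hence \<open>f ^ n\<close> peaks only inside \<open>V\<close>.\<close>

lemma norming_set_Diff:
  fixes A :: "('k::topological_space \<Rightarrow>\<^sub>C complex) set"
  assumes K: "compact (UNIV :: 'k set)" and A: "uniform_algebra A"
    and E: "closed E" "norming_set A E" and H: "finite H" "H \<subseteq> A"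
    and V: "V = {t. \<forall>h\<in>H. cmod (h t) < 1}" and nopeak: "\<not> peaks_in A V"
  shows "norming_set A (E - V)"
proof (rule ccontr)
  assume "\<not> norming_set A (E - V)"
  then obtain f0 where f0: "f0 \<in> A" "\<And>t. t \<in> E - V \<Longrightarrow> cmod (f0 t) \<noteq> norm f0"
    unfolding norming_set_def by blast
  have "\<exists>f\<in>A. norm f > 0 \<and> (\<forall>t\<in>E - V. cmod (apply_bcontfun f t) < norm f)"
  proof (cases "norm f0 > 0")
    case True
    then show ?thesis using f0 norm_bounded[of f0] by (metis less_le)
  next
    \<comment> \<open>A zero \<open>f0\<close> attains its norm everywhere, so \<open>E - V\<close>
      is empty and the constant 1 meets the condition vacuously.\<close>
    case False
    then have "E - V = {}" using f0(2) by auto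
    moreover have "norm (const_bcontfun 1 :: 'k \<Rightarrow>\<^sub>C complex) \<ge> 1"
      using norm_bounded[of "const_bcontfun 1 :: 'k \<Rightarrow>\<^sub>C complex"] by simp
    ultimately show ?thesis
      using uniform_algebraD(3)[OF A, of 1] by (intro bexI[of _ "const_bcontfun 1"]) auto
  qed
  then obtain f where f: "f \<in> A" "norm f > 0" "\<And>t. t \<in> E - V \<Longrightarrow> cmod (f t) < norm f" by blast
  define g where "g = inverse (complex_of_real (norm f)) *\<^sub>C f"
  have gA: "g \<in> A"
    unfolding g_def by (intro complex_vector.subspace_scale uniform_algebraD A f)
  have cmodg: "cmod (g t) = cmod (f t) / norm f" for t
    by (simp add: g_def norm_mult norm_inverse norm_divide field_simps)
  have g1: "cmod (g t) \<le> 1" for t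
    using f(2) norm_bounded[of f t] by (simp add: cmodg)
  have "open V"
  proof -
    have "V = (\<Inter>h\<in>H. {t. cmod (apply_bcontfun h t) < 1})" by (auto simp: V)
    moreover have "open {t. cmod (apply_bcontfun h t) < 1}" for h :: "'k \<Rightarrow>\<^sub>C complex"
      by (intro open_Collect_less continuous_on_norm continuous_on_const) simp
    ultimately show ?thesis using H(1) by auto
  qed
  then have cEV: "compact (E - V)"
    using K E(1) compact_Int_closed[OF K, of "E - V"] by (simp add: closed_Diff)
  have "\<exists>q. 0 \<le> q \<and> q < 1 \<and> (\<forall>t\<in>E - V. cmod (g t) \<le> q)"
  proof (cases "E - V = {}")
    case False
    obtain t where t: "t \<in> E - V" "\<And>s. s \<in> E - V \<Longrightarrow> cmod (g s) \<le> cmod (g t)"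
      using norm_attained_on[OF cEV False, of g] by blast
    then have "cmod (g t) < 1" using f(2) f(3)[OF t(1)] by (simp add: cmodg)
    then show ?thesis using t by (intro exI[of _ "cmod (g t)"]) auto
  qed (auto intro: exI[of _ 0])
  then obtain q where q: "0 \<le> q" "q < 1" "\<And>t. t \<in> E - V \<Longrightarrow> cmod (g t) \<le> q" by blast
  define B where "B = (\<Sum>h\<in>H. norm h) + 1"
  have B: "norm h \<le> B" if "h \<in> H" for h
    using member_le_sum[OF that, of norm] H(1) by (auto simp: B_def)
  have "B > 0" unfolding B_def by (rule add_nonneg_pos) (auto intro: sum_nonneg)
  then have "1 / B > 0" by simp
  from real_arch_pow_inv[OF this q(2)] obtain n where "q ^ n < 1 / B" by blast
  then have n: "q ^ n * B < 1" using \<open>B > 0\<close> by (simp add: field_simps)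
  define G where "G = pointwise_power g n"
  have GA: "G \<in> A" unfolding G_def by (intro pointwise_power_in A gA)
  have G1: "cmod (G t) \<le> 1" for t using g1 by (simp add: G_def norm_power power_le_one)
  have Gh: "norm (G \<odot> h) < 1" if h: "h \<in> H" for h
  proof -
    have "G \<odot> h \<in> A" using H h GA uniform_algebraD(4)[OF A] by blast
    then obtain t where t: "t \<in> E" "cmod ((G \<odot> h) t) = norm (G \<odot> h)"
      using E(2) unfolding norming_set_def by blast
    have "cmod (G t) * cmod (h t) < 1"
    proof (cases "t \<in> V")
      case True
      then have "cmod (h t) < 1" using V h by simp
      then show ?thesis using G1[of t]
        by (meson le_less_trans mult_left_le_one_le norm_ge_zero)
    next
      case False
      then have "cmod (G t) \<le> q ^ n"
        using q t(1) by (simp add: G_def norm_power power_mono)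
      moreover have "cmod (h t) \<le> B" using B[OF h] norm_bounded[of h t] by simp
      ultimately have "cmod (G t) * cmod (h t) \<le> q ^ n * B"
        using q(1) by (intro mult_mono) auto
      then show ?thesis using n by simp
    qed
    then show ?thesis using t(2) by (simp add: norm_mult)
  qed
  define r where "r = Max (insert 0 ((\<lambda>h. norm (G \<odot> h)) ` H))"
  have r: "r < 1" using H(1) Gh by (auto simp: r_def)
  have Gr: "cmod (G t) \<le> r" if tV: "t \<notin> V" for t
  proof -
    obtain h where h: "h \<in> H" "cmod (h t) \<ge> 1" using tV V by (auto simp: not_less)
    have "cmod (G t) \<le> cmod (G t) * cmod (h t)"
      using h(2) by (simp add: mult_left_le mult_le_cancel_left1)
    also have "\<dots> \<le> norm (G \<odot> h)" using norm_bounded[of "G \<odot> h" t] by (simp add: norm_mult)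
    also have "\<dots> \<le> r" using H(1) h(1) by (simp add: r_def)
    finally show ?thesis .
  qed
  obtain s where "cmod (f s) = norm f" using norm_attained[OF K, of f] by blast
  then have s: "cmod (G s) = 1" using f(2) by (simp add: G_def norm_power cmodg)
  then have "s \<in> V" using Gr[of s] r by force
  then have "peaks_in A V" using peaks_in_if_bounded_away[OF A GA s G1 _ r Gr] by blast
  with nopeak show False ..
qed

text \<open>Norming sets are shrunk below by sets of the form \<open>cmod (h s) < 1\<close> for
  finitely many \<open>h\<close> in \<open>A\<close>, so these have to form a neighbourhood base.
  Separation gives, for \<open>s\<close> outside \<open>U\<close>, a function of \<open>A\<close>
  that is 0 at \<open>t\<close> and 2 at \<open>s\<close>; compactness of the complement leaves
  finitely many of them.\<close>

lemma algebra_neighbourhood: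
  fixes A :: "('k::topological_space \<Rightarrow>\<^sub>C complex) set"
  assumes K: "compact (UNIV :: 'k set)" and A: "uniform_algebra A" and U: "open U" "t \<in> U"
  obtains H where "finite H" "H \<subseteq> A" "\<forall>h\<in>H. cmod (apply_bcontfun h t) < 1"
    "{s. \<forall>h\<in>H. cmod (apply_bcontfun h s) < 1} \<subseteq> U"
proof -
  have "\<forall>s\<in>- U. \<exists>h. h \<in> A \<and> apply_bcontfun h t = 0 \<and> cmod (apply_bcontfun h s) > 1"
  proof
    fix s assume "s \<in> - U"
    then have "s \<noteq> t" using U by auto
    then obtain f where f: "f \<in> A" "f s \<noteq> f t" using uniform_algebraD(5)[OF A] by blast
    define h where "h = (2 / (f s - f t)) *\<^sub>C (f - const_bcontfun (f t))"
    have "h \<in> A"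
      unfolding h_def
      by (intro complex_vector.subspace_scale complex_vector.subspace_diff uniform_algebraD A f)
    moreover have "h t = 0" "h s = 2"
      using f(2) nonzero_eq_divide_eq[of "f s - f t" 2] by (simp_all add: h_def)
    ultimately show "\<exists>h. h \<in> A \<and> apply_bcontfun h t = 0 \<and> cmod (apply_bcontfun h s) > 1"
      by (intro exI[of _ h]) auto
  qed
  from bchoice[OF this] obtain h where
    h: "\<forall>s\<in>-U. h s \<in> A \<and> apply_bcontfun (h s) t = 0 \<and> cmod (apply_bcontfun (h s) s) > 1"
    by blast
  have "compact (- U)"
    using compact_Int_closed[OF K, of "- U"] closed_Compl[OF U(1)] by simp
  moreover have "open {s'. 1 < cmod (apply_bcontfun (h s) s')}" for s
    by (intro open_Collect_less continuous_on_norm continuous_on_const) simp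
  moreover have "- U \<subseteq> (\<Union>s\<in>-U. {s'. 1 < cmod (apply_bcontfun (h s) s')})" using h by auto
  ultimately obtain S where S: "S \<subseteq> - U" "finite S"
    "- U \<subseteq> (\<Union>s\<in>S. {s'. 1 < cmod (apply_bcontfun (h s) s')})"
    by (rule compactE_image) auto
  show ?thesis
  proof (rule that[of "h ` S"])
    show "\<forall>g\<in>h ` S. cmod (apply_bcontfun g t) < 1" using h S by auto
    show "{s. \<forall>g\<in>h ` S. cmod (apply_bcontfun g s) < 1} \<subseteq> U" using S(3) by fastforce
  qed (use h S in auto)
qed

text \<open>If \<open>f\<close> attained its norm nowhere on the boundary, finitely many
  neighbourhoods without peaking would cover the compact set where it does attain it. Removing them
  one by one leaves a norming set at each stage, and in the end \<open>f\<close> has no place left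
  to attain its norm.\<close>

lemma norming_set_shilov_boundary:
  fixes A :: "('k::topological_space \<Rightarrow>\<^sub>C complex) set"
  assumes K: "compact (UNIV :: 'k set)" and A: "uniform_algebra A"
  shows "norming_set A (shilov_boundary A)"
  unfolding norming_set_def
proof (rule ballI, rule ccontr)
  fix f assume f: "f \<in> A" "\<not> (\<exists>t\<in>shilov_boundary A. cmod (f t) = norm f)"
  define L where "L = {t. cmod (f t) = norm f}"
  define V where "V H = {s. \<forall>h\<in>H. cmod (apply_bcontfun h s) < 1}" for H :: "('k \<Rightarrow>\<^sub>C complex) set"
  have "closed L" unfolding L_def by (intro closed_Collect_eq continuous_on_norm continuous_on_const) simp
  then have cL: "compact L" using compact_Int_closed[OF K] by auto
  have "\<forall>t\<in>L. \<exists>H. finite H \<and> H \<subseteq> A \<and> t \<in> V H \<and> \<not> peaks_in A (V H)"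
  proof
    fix t assume "t \<in> L"
    then have "t \<notin> shilov_boundary A" using f by (auto simp: L_def)
    then obtain U where U: "open U" "t \<in> U" "\<not> peaks_in A U" by (auto simp: shilov_boundary_def)
    obtain H where H: "finite H" "H \<subseteq> A" "\<forall>h\<in>H. cmod (apply_bcontfun h t) < 1"
      "{s. \<forall>h\<in>H. cmod (apply_bcontfun h s) < 1} \<subseteq> U"
      by (rule algebra_neighbourhood[OF K A U(1,2)])
    then have "t \<in> V H" "V H \<subseteq> U" by (auto simp: V_def)
    with H(1,2) show "\<exists>H. finite H \<and> H \<subseteq> A \<and> t \<in> V H \<and> \<not> peaks_in A (V H)"
      using U(3) peaks_in_mono[of A "V H" U] by (intro exI[of _ H] conjI) auto
  qed
  from bchoice[OF this] obtain H where
    "\<forall>t\<in>L. finite (H t) \<and> H t \<subseteq> A \<and> t \<in> V (H t) \<and> \<not> peaks_in A (V (H t))" ..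
  then have H: "finite (H t) \<and> H t \<subseteq> A \<and> t \<in> V (H t) \<and> \<not> peaks_in A (V (H t))" if "t \<in> L" for t
    using that by (rule bspec)
  have oV: "open (V (H t))" if "t \<in> L" for t
  proof -
    have "V (H t) = (\<Inter>h\<in>H t. {s. cmod (apply_bcontfun h s) < 1})" by (auto simp: V_def)
    moreover have "open {s. cmod (apply_bcontfun h s) < 1}" for h :: "'k \<Rightarrow>\<^sub>C complex"
      by (intro open_Collect_less continuous_on_norm continuous_on_const) simp
    ultimately show ?thesis using H[OF that] by auto
  qed
  obtain T where T: "T \<subseteq> L" "finite T" "L \<subseteq> (\<Union>t\<in>T. V (H t))"
    by (rule compactE_image[OF cL, of L "\<lambda>t. V (H t)"]) (use oV H in auto)
  have "norming_set A (UNIV - (\<Union>t\<in>T. V (H t)))"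
    using T(2,1)
  proof (induction T rule: finite_induct)
    case empty
    show ?case using norm_attained[OF K] by (auto simp: norming_set_def)
  next
    case (insert t T)
    have "closed (UNIV - (\<Union>t\<in>T. V (H t)))" using oV insert.prems by (auto intro: closed_Diff)
    moreover have "norming_set A (UNIV - (\<Union>t\<in>T. V (H t)))" using insert by simp
    ultimately have "norming_set A (UNIV - (\<Union>t\<in>T. V (H t)) - V (H t))"
      using H[of t] insert.prems by (intro norming_set_Diff[OF K A _ _ _ _ V_def]) auto
    moreover have "UNIV - (\<Union>t\<in>T. V (H t)) - V (H t) = UNIV - (\<Union>t\<in>insert t T. V (H t))" by auto
    ultimately show ?case by simp
  qed
  then obtain t where "t \<notin> (\<Union>t\<in>T. V (H t))" "cmod (f t) = norm f"
    using f(1) unfolding norming_set_def by blast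
  then show False using T(3) by (auto simp: L_def)
qed

lemma function_spaceD:
  assumes "function_space_over A S"
  shows "complex_vector.subspace S" "uniform_algebra A"
    "f \<in> A \<Longrightarrow> tensor f x \<in> S" "g \<in> A \<Longrightarrow> h \<in> S \<Longrightarrow> g \<odot> h \<in> S"
    "bounded_functional \<phi> \<Longrightarrow> h \<in> S \<Longrightarrow> apply_bcontfun g = \<phi> \<circ> apply_bcontfun h \<Longrightarrow> g \<in> A"
  using assms unfolding function_space_over_def base_algebra_def by blast+

lemma function_space_norm_attained:
  fixes S :: "('k::topological_space \<Rightarrow>\<^sub>C 'x::complex_normed_vector) set"
  assumes K: "compact (UNIV :: 'k set)" and S: "function_space_over A S" and h: "h \<in> S"
  obtains t where "t \<in> shilov_boundary A" "norm (h t) = norm h"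
proof -
  obtain s where s: "norm (h s) = norm h" using norm_attained[OF K, of h] by blast
  obtain \<phi> where \<phi>: "bounded_functional \<phi>" "\<And>x. cmod (\<phi> x) \<le> norm x"
    "\<phi> (h s) = complex_of_real (norm (h s))"
    using hahn_banach_norming[of "h s"] by blast
  have "\<phi> \<circ> apply_bcontfun h \<in> bcontfun"
  proof (rule bcontfun_normI)
    have "bounded_linear \<phi>" using \<phi>(1) by (simp add: bounded_functional_def)
    then show "continuous_on UNIV (\<phi> \<circ> apply_bcontfun h)"
      unfolding o_def by (rule bounded_linear.continuous_on) simp
    show "norm ((\<phi> \<circ> apply_bcontfun h) x) \<le> norm h" for x
      using \<phi>(2)[of "h x"] norm_bounded[of h x] by simp
  qed
  then obtain g where g: "\<phi> \<circ> apply_bcontfun h = apply_bcontfun g" by (rule bcontfunE)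
  have gt: "g t = \<phi> (h t)" for t using fun_cong[OF g, of t] by simp
  have "g \<in> A" using function_spaceD(5)[OF S \<phi>(1) h] g by simp
  then obtain t where t: "t \<in> shilov_boundary A" "cmod (g t) = norm g"
    using norming_set_shilov_boundary[OF K function_spaceD(2)[OF S]] unfolding norming_set_def by blast
  have "norm h \<le> norm g" using norm_bounded[of g s] by (simp add: gt \<phi>(3) s)
  also have "\<dots> \<le> norm (h t)" using \<phi>(2)[of "h t"] by (simp add: t(2)[symmetric] gt)
  finally have "norm (h t) = norm h" using norm_bounded[of h t] by simp
  with t(1) show ?thesis using that by blast
qed

text \<open>Norms of functions in \<open>A\<close> can be read off on the boundary, where peaking
  functions normalised at \<open>t0\<close> differ by at most the sum of their tolerances. They are
  therefore uniformly Cauchy on K; the remaining point is that their limit vanishes off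
  \<open>t0\<close> also outside the boundary.\<close>

lemma indicator_in_algebra:
  fixes A :: "('k::topological_space \<Rightarrow>\<^sub>C complex) set"
  assumes K: "compact (UNIV :: 'k set)" and A: "uniform_algebra A"
    and t0: "t0 \<in> shilov_boundary A" and U: "open U" "t0 \<in> U" "U \<inter> shilov_boundary A \<subseteq> {t0}"
  obtains e where "e \<in> A" "apply_bcontfun e = indicator {t0}"
proof -
  have norming: "\<exists>t\<in>shilov_boundary A. cmod (f t) = norm f" if "f \<in> A" for f :: "'k \<Rightarrow>\<^sub>C complex"
    using norming_set_shilov_boundary[OF K A] that unfolding norming_set_def by blast
  have peak: "\<exists>G\<in>A. G t0 = 1 \<and> (\<forall>t\<in>shilov_boundary A - {t0}. cmod (G t) \<le> \<tau>)" (is "?P \<tau>")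
    if \<tau>: "0 < \<tau>" "\<tau> < 1" for \<tau> :: real
  proof -
    have "peaks_in A U" using t0 U by (auto simp: shilov_boundary_def)
    then obtain g s where g: "g \<in> A" "g s = 1" "\<And>t. cmod (g t) \<le> 1" "\<And>t. t \<notin> U \<Longrightarrow> cmod (g t) \<le> \<tau>"
      using \<tau> unfolding peaks_in_def by blast
    \<comment> \<open>The point \<open>s\<close> need not lie in the boundary, but the norm of
      \<open>g\<close> is attained on it, and this can only happen in \<open>U\<close>, hence at
      \<open>t0\<close>.\<close>
    obtain t where t: "t \<in> shilov_boundary A" "cmod (g t) = norm g" using norming[OF g(1)] by blast
    have "cmod (g t) \<ge> 1" using norm_bounded[of g s] g(2) t(2) by simp
    then have "t \<in> U" using g(4)[of t] \<tau> by force
    then have "t = t0" using t(1) U(3) by auto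
    with \<open>cmod (g t) \<ge> 1\<close> have gt0: "cmod (g t0) = 1" using g(3)[of t0] by simp
    show ?thesis
    proof (intro bexI conjI ballI)
      show "inverse (g t0) *\<^sub>C g \<in> A" by (intro complex_vector.subspace_scale uniform_algebraD A g)
      show "(inverse (g t0) *\<^sub>C g) t0 = 1" using gt0 by (cases "g t0 = 0") auto
      fix t assume "t \<in> shilov_boundary A - {t0}"
      then have "t \<notin> U" using U by auto
      then show "cmod ((inverse (g t0) *\<^sub>C g) t) \<le> \<tau>"
        using g(4)[of t] gt0 by (simp add: norm_mult norm_inverse)
    qed
  qed
  \<comment> \<open>\<open>Suc\<close> keeps the tolerance below 1 also for
    \<open>n = 0\<close>.\<close>
  have "?P ((1/2) ^ Suc n)" for n
    by (rule peak) (auto simp: power_Suc_less_one simp del: power_Suc)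
  then obtain G where G: "\<And>n. G n \<in> A" "\<And>n. apply_bcontfun (G n) t0 = 1"
    "\<And>n t. t \<in> shilov_boundary A \<Longrightarrow> t \<noteq> t0 \<Longrightarrow> cmod (apply_bcontfun (G n) t) \<le> (1/2) ^ Suc n"
    by (metis Diff_iff singletonD)
  have pow0: "(\<lambda>n. (1/2 :: real) ^ Suc n) \<longlonglongrightarrow> 0"
    by (intro LIMSEQ_Suc LIMSEQ_realpow_zero) auto
  have ptw: "(\<lambda>n. apply_bcontfun (G n) s) \<longlonglongrightarrow> indicator {t0} s" for s
  proof (cases "s = t0")
    case False
    obtain f where f: "f \<in> A" "f s \<noteq> f t0" using uniform_algebraD(5)[OF A False] by blast
    have le: "cmod (apply_bcontfun (G n) s) \<le> (2 * norm f / cmod (f s - f t0)) * (1/2) ^ Suc n" for n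
    proof -
      \<comment> \<open>The factor vanishes at \<open>t0\<close>, where \<open>G n\<close> is large,
        so \<open>F\<close> is uniformly small, while at \<open>s\<close> the factor is not
        0.\<close>
      define F where "F = (f - const_bcontfun (f t0)) \<odot> G n"
      have "F \<in> A"
        unfolding F_def by (intro uniform_algebraD A complex_vector.subspace_diff f G)
      then obtain t where t: "t \<in> shilov_boundary A" "cmod (F t) = norm F" using norming by blast
      have "cmod (F t) \<le> 2 * norm f * (1/2) ^ Suc n"
      proof (cases "t = t0")
        case False
        have "cmod (f t - f t0) \<le> 2 * norm f"
          using norm_triangle_ineq4[of "f t" "f t0"] norm_bounded[of f t] norm_bounded[of f t0] by simp
        then show ?thesis
          using G(3)[OF t(1) False, of n]
          by (simp add: F_def norm_mult del: power_Suc) (intro mult_mono, auto)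
      qed (simp add: F_def)
      moreover have "cmod (f s - f t0) * cmod (apply_bcontfun (G n) s) \<le> norm F"
        using norm_bounded[of F s] by (simp add: F_def norm_mult)
      ultimately have "cmod (f s - f t0) * cmod (apply_bcontfun (G n) s) \<le> 2 * norm f * (1/2) ^ Suc n"
        using t(2) by linarith
      then show ?thesis using f(2) by (simp add: pos_le_divide_eq mult.commute del: power_Suc)
    qed
    have "(\<lambda>n. apply_bcontfun (G n) s) \<longlonglongrightarrow> 0"
      by (rule Lim_null_comparison[OF always_eventually[OF allI[OF le]] tendsto_mult_right_zero[OF pow0]])
    then show ?thesis using False by simp
  qed (simp add: G)
  have dist: "cmod (apply_bcontfun (G n) s - apply_bcontfun (G m) s) \<le> (1/2) ^ Suc n + (1/2) ^ Suc m"
    for n m s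
  proof -
    have "G n - G m \<in> A" by (intro complex_vector.subspace_diff uniform_algebraD A G)
    then obtain t where t: "t \<in> shilov_boundary A" "cmod ((G n - G m) t) = norm (G n - G m)"
      using norming by blast
    have "cmod ((G n - G m) t) \<le> (1/2) ^ Suc n + (1/2) ^ Suc m"
    proof (cases "t = t0")
      case False
      then show ?thesis
        using G(3)[OF t(1) False, of n] G(3)[OF t(1) False, of m]
          norm_triangle_ineq4[of "apply_bcontfun (G n) t" "apply_bcontfun (G m) t"]
        by (simp del: power_Suc)
    qed (simp add: G(2))
    then show ?thesis using norm_bounded[of "G n - G m" s] t(2) by (simp del: power_Suc)
  qed
  have close: "cmod (apply_bcontfun (G n) s - indicator {t0} s) \<le> (1/2) ^ Suc n" for n s
  proof -
    have "(\<lambda>m. cmod (apply_bcontfun (G n) s - apply_bcontfun (G m) s)) \<longlonglongrightarrow>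
        cmod (apply_bcontfun (G n) s - indicator {t0} s)"
      by (intro tendsto_intros ptw)
    moreover have "(\<lambda>m. (1/2 :: real) ^ Suc n + (1/2) ^ Suc m) \<longlonglongrightarrow> (1/2) ^ Suc n + 0"
      by (intro tendsto_add pow0 tendsto_const)
    ultimately have "cmod (apply_bcontfun (G n) s - indicator {t0} s) \<le> (1/2) ^ Suc n + 0"
      by (rule LIMSEQ_le) (use dist in auto)
    then show ?thesis by simp
  qed
  have ul: "uniform_limit UNIV (\<lambda>n. apply_bcontfun (G n)) (indicator {t0}) sequentially"
  proof (rule uniform_limitI)
    fix \<epsilon> :: real assume "\<epsilon> > 0"
    with pow0 have "\<forall>\<^sub>F n in sequentially. (1/2 :: real) ^ Suc n < \<epsilon>" by (rule order_tendstoD)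
    then show "\<forall>\<^sub>F n in sequentially. \<forall>s\<in>UNIV. dist (apply_bcontfun (G n) s) (indicator {t0} s) < \<epsilon>"
      by eventually_elim (use close in \<open>auto simp: dist_norm simp del: power_Suc intro: le_less_trans\<close>)
  qed
  have "continuous_on UNIV (indicator {t0} :: 'k \<Rightarrow> complex)"
    by (rule uniform_limit_theorem[OF _ ul]) auto
  then have "(indicator {t0} :: 'k \<Rightarrow> complex) \<in> bcontfun"
    by (rule bcontfun_normI[where b = 1]) (simp add: indicator_def)
  then obtain e where e: "indicator {t0} = apply_bcontfun (e :: 'k \<Rightarrow>\<^sub>C complex)" by (rule bcontfunE)
  have "G \<longlonglongrightarrow> e"
    using ul unfolding e by (rule uniform_limit_tendsto_bcontfun)
  then have "e \<in> A"
    using closed_sequentially[OF uniform_algebraD(2)[OF A]] G(1) by blast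
  then show ?thesis using that e by metis
qed

text \<open>The coefficients are those of \<open>Ln (1 - \<rho> w) / ln (1 - \<rho>)\<close>. The imaginary part of the
  logarithm stays bounded while the denominator is large for \<open>\<rho>\<close> close to \<open>1\<close>, so the unit disc is
  mapped into a thin neighbourhood of the segment from \<open>0\<close> to \<open>1\<close>.\<close>

lemma exists_thin_power_series:
  assumes "\<eta> > 0"
  obtains a :: "nat \<Rightarrow> real" where "\<And>n. a n \<ge> 0" "a 0 = 0" "a sums 1"
    "\<And>w h. cmod w \<le> 1 \<Longrightarrow> (\<lambda>n. of_real (a n) * w ^ n) sums h \<Longrightarrow> cmod h + cmod (1 - h) \<le> 1 + \<eta>"
proof -
  \<comment> \<open>The estimate at the end costs 1/M twice for the real part of \<open>h\<close>
    below 0 and 2/M twice for its imaginary part, together 6/M. The choice of \<rho> makes the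
    logarithm of 1 - \<rho> equal to -M.\<close>
  define M where "M = 6 / \<eta>"
  define \<rho> where "\<rho> = 1 - exp (- M)"
  \<comment> \<open>Division by zero gives the coefficient 0 at \<open>n = 0\<close>, the correct
    constant term.\<close>
  define a where "a n = \<rho> ^ n / (real n * M)" for n
  have M: "M > 0" using assms by (simp add: M_def)
  have \<rho>: "0 \<le> \<rho>" "\<rho> < 1" using M by (auto simp: \<rho>_def)
  have series: "(\<lambda>n. of_real (a n) * w ^ n) sums (- Ln (1 - of_real \<rho> * w) / of_real M)"
    if w: "cmod w \<le> 1" for w
  proof -
    have "\<rho> * cmod w < 1" using mult_left_mono[OF w \<rho>(1)] \<rho>(2) by simp
    then have "cmod (- (of_real \<rho> * w)) < 1" using \<rho>(1) by (simp add: norm_mult)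
    from sums_divide[OF sums_minus[OF Ln_series'[OF this]], of "of_real M"]
    show ?thesis by (simp add: a_def power_mult_distrib field_simps)
  qed
  show ?thesis
  proof (rule that[of a])
    show "a n \<ge> 0" for n using \<rho> M by (simp add: a_def)
    show "a 0 = 0" by (simp add: a_def)
    have "complex_of_real (1 - \<rho>) = of_real (exp (- M))" by (simp add: \<rho>_def)
    then have "Ln (1 - of_real \<rho> * 1) = of_real (- M)" by (simp flip: exp_of_real)
    with series[of 1] have "(\<lambda>n. complex_of_real (a n)) sums 1" using M by simp
    then show "a sums 1" using sums_of_real_iff[of a 1, where 'a = complex] by simp
  next
    fix w h assume w: "cmod w \<le> 1" and h: "(\<lambda>n. of_real (a n) * w ^ n) sums h"
    define v where "v = 1 - of_real \<rho> * w"
    have heq: "h = - Ln v / of_real M" using sums_unique2[OF h series[OF w]] by (simp add: v_def)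
    have \<rho>w: "cmod (of_real \<rho> * w) \<le> \<rho>" using mult_left_mono[OF w \<rho>(1)] \<rho>(1) by (simp add: norm_mult)
    have "Re (of_real \<rho> * w) \<le> \<rho>" using complex_Re_le_cmod[of "of_real \<rho> * w"] \<rho>w by simp
    then have Rev: "Re v > 0" using \<rho>(2) by (simp add: v_def)
    then have v0: "v \<noteq> 0" by auto
    have "cmod v \<le> 2" using norm_triangle_ineq4[of 1 "of_real \<rho> * w"] \<rho>w \<rho>(2) by (simp add: v_def)
    then have "ln (cmod v) \<le> ln 2" using v0 by simp
    also have "ln 2 \<le> (1 :: real)" using ln_2_less_1 by simp
    finally have up: "Re (Ln v) \<le> 1" using v0 by (simp add: Re_Ln)
    have "exp (- M) \<le> cmod v"
      using norm_triangle_ineq2[of 1 "of_real \<rho> * w"] \<rho>w by (simp add: v_def \<rho>_def)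
    then have "ln (exp (- M)) \<le> ln (cmod v)" using v0 by (subst ln_le_cancel_iff) auto
    then have lo: "- M \<le> Re (Ln v)" using v0 by (simp add: Re_Ln)
    have "\<bar>Im (Ln v)\<bar> < pi / 2" by (rule Re_Ln_pos_lt_imp[OF Rev])
    then have im: "\<bar>Im (Ln v)\<bar> \<le> 2" using pi_less_4 by simp
    have Reh: "Re h = - Re (Ln v) / M" "Im h = - Im (Ln v) / M" by (simp_all add: heq)
    have "Re h \<le> 1" "- 1 / M \<le> Re h" "\<bar>Im h\<bar> \<le> 2 / M"
      using up lo im M by (auto simp: Reh field_simps)
    moreover have "cmod h \<le> \<bar>Re h\<bar> + \<bar>Im h\<bar>" by (rule cmod_le)
    moreover have "cmod (1 - h) \<le> \<bar>1 - Re h\<bar> + \<bar>Im h\<bar>" using cmod_le[of "1 - h"] by simp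
    ultimately have "cmod h + cmod (1 - h) \<le> 1 + 2 * (1 / M) + 2 * (2 / M)" using M by (auto simp: abs_if split: if_splits)
    also have "\<dots> = 1 + \<eta>" using assms by (simp add: M_def field_simps)
    finally show "cmod h + cmod (1 - h) \<le> 1 + \<eta>" .
  qed
qed

lemma power_series_in_algebra:
  fixes A :: "('k::topological_space \<Rightarrow>\<^sub>C complex) set"
  assumes A: "uniform_algebra A" and \<psi>: "\<psi> \<in> A" "\<And>t. cmod (\<psi> t) \<le> 1"
    and a: "\<And>n. a n \<ge> 0" "summable (a :: nat \<Rightarrow> real)"
  obtains \<phi> where "\<phi> \<in> A" "\<And>t. (\<lambda>n. of_real (a n) * \<psi> t ^ n) sums \<phi> t"
proof -
  define p where "p n = (\<Sum>i<n. of_real (a i) *\<^sub>C pointwise_power \<psi> i)" for n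
  have pA: "p n \<in> A" for n
    unfolding p_def
    by (intro complex_vector.subspace_sum complex_vector.subspace_scale uniform_algebraD A pointwise_power_in \<psi>)
  have papp: "apply_bcontfun (p n) t = (\<Sum>i<n. of_real (a i) * \<psi> t ^ i)" for n t
    by (induction n) (simp_all add: p_def)
  define l where "l t = (\<Sum>n. of_real (a n) * \<psi> t ^ n)" for t
  have le: "cmod (of_real (a n) * \<psi> t ^ n) \<le> a n" for n t
    using a(1)[of n] \<psi>(2)[of t] by (simp add: norm_mult norm_power mult_left_le power_le_one)
  have "uniform_limit UNIV (\<lambda>n t. \<Sum>i<n. of_real (a i) * \<psi> t ^ i) l sequentially"
    unfolding l_def by (rule Weierstrass_m_test) (use le a in auto)
  then have ul: "uniform_limit UNIV (\<lambda>n. apply_bcontfun (p n)) l sequentially"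
    by (simp add: papp[abs_def])
  have cont: "continuous_on UNIV l" by (rule uniform_limit_theorem[OF _ ul]) auto
  have summ: "summable (\<lambda>n. of_real (a n) * \<psi> t ^ n)" for t
    by (rule summable_comparison_test[OF _ a(2)]) (use le in auto)
  have "cmod (l t) \<le> suminf a" for t
    unfolding l_def by (rule norm_suminf_le) (use le a in auto)
  with cont have "l \<in> bcontfun" by (rule bcontfun_normI)
  then obtain \<phi> where \<phi>: "l = apply_bcontfun \<phi>" by (rule bcontfunE)
  have "p \<longlonglongrightarrow> \<phi>"
    using ul unfolding \<phi> by (rule uniform_limit_tendsto_bcontfun)
  then have "\<phi> \<in> A" using closed_sequentially[OF uniform_algebraD(2)[OF A]] pA by blast
  moreover have "(\<lambda>n. of_real (a n) * \<psi> t ^ n) sums \<phi> t" for t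
    unfolding \<phi>[symmetric] l_def by (rule summable_sums[OF summ])
  ultimately show ?thesis by (rule that)
qed

text \<open>The thin power series is applied to a peaking function \<psi>. Nonnegative coefficients
  with sum 1 and no constant term give cmod \<phi> \<le> cmod \<psi>, so the decay off
  \<open>U\<close> and the value 1 at \<open>s\<close> both survive.\<close>

lemma peaks_in_thin:
  assumes A: "uniform_algebra A" and U: "peaks_in A U" and "\<eta> > 0" "\<tau> > 0"
  obtains \<phi> s where "\<phi> \<in> A" "s \<in> U" "\<phi> s = 1" "\<And>t. cmod (\<phi> t) + cmod (1 - \<phi> t) \<le> 1 + \<eta>"
    "\<And>t. cmod (\<phi> t) \<le> 1" "\<And>t. t \<notin> U \<Longrightarrow> cmod (\<phi> t) \<le> \<tau>"
proof -
  obtain \<psi> s where \<psi>: "\<psi> \<in> A" "s \<in> U" "\<psi> s = 1" "\<And>t. cmod (\<psi> t) \<le> 1"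
    "\<And>t. t \<notin> U \<Longrightarrow> cmod (\<psi> t) \<le> \<tau>"
    using U \<open>\<tau> > 0\<close> unfolding peaks_in_def by blast
  obtain a :: "nat \<Rightarrow> real" where a: "\<And>n. a n \<ge> 0" "a 0 = 0" "a sums 1"
    and thin: "\<And>w h. cmod w \<le> 1 \<Longrightarrow> (\<lambda>n. of_real (a n) * w ^ n) sums h \<Longrightarrow>
      cmod h + cmod (1 - h) \<le> 1 + \<eta>"
    using exists_thin_power_series[OF \<open>\<eta> > 0\<close>] by blast
  obtain \<phi> where \<phi>: "\<phi> \<in> A" "\<And>t. (\<lambda>n. of_real (a n) * \<psi> t ^ n) sums \<phi> t"
    by (rule power_series_in_algebra[OF A \<psi>(1,4) a(1) sums_summable[OF a(3)]]) blast
  have le: "cmod (\<phi> t) \<le> cmod (\<psi> t)" for t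
  proof -
    have "cmod (of_real (a n) * \<psi> t ^ n) \<le> a n * cmod (\<psi> t)" for n
    proof (cases n)
      case (Suc m)
      have "cmod (\<psi> t) ^ n \<le> cmod (\<psi> t) ^ 1"
        using \<psi>(4)[of t] Suc by (intro power_decreasing) auto
      then show ?thesis using a(1)[of n] by (simp add: norm_mult norm_power mult_left_mono)
    qed (simp add: a(2))
    moreover have "(\<lambda>n. a n * cmod (\<psi> t)) sums (1 * cmod (\<psi> t))" by (intro sums_mult2 a)
    ultimately have "cmod (\<Sum>n. of_real (a n) * \<psi> t ^ n) \<le> (\<Sum>n. a n * cmod (\<psi> t))"
      by (intro norm_suminf_le) (auto simp: sums_iff)
    then show ?thesis using \<open>(\<lambda>n. a n * cmod (\<psi> t)) sums (1 * cmod (\<psi> t))\<close> \<phi>(2)[of t]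
      by (simp add: sums_iff)
  qed
  show ?thesis
  proof (rule that[OF \<phi>(1) \<psi>(2)])
    have "(\<lambda>n. complex_of_real (a n)) sums of_real 1" using a(3) by (simp only: sums_of_real_iff)
    then show "\<phi> s = 1" using \<phi>(2)[of s] by (simp add: \<psi>(3) sums_iff)
    show "cmod (\<phi> t) + cmod (1 - \<phi> t) \<le> 1 + \<eta>" for t by (rule thin[OF \<psi>(4) \<phi>(2)])
    show "cmod (\<phi> t) \<le> 1" for t using le[of t] \<psi>(4)[of t] by linarith
    show "cmod (\<phi> t) \<le> \<tau>" if "t \<notin> U" for t using le[of t] \<psi>(5)[OF that] by linarith
  qed
qed

section \<open>The polynomial Daugavetian index\<close>

lemma zero_in_unit_ball: "complex_vector.subspace Z \<Longrightarrow> 0 \<in> unit_ball Z"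
  by (simp add: unit_ball_def complex_vector.subspace_0)

lemma norm_le_poly_norm:
  assumes "\<And>z. z \<in> unit_ball Z \<Longrightarrow> norm (P z) \<le> M" "z \<in> unit_ball Z"
  shows "norm (P z) \<le> poly_norm Z P"
  unfolding poly_norm_def by (rule cSUP_upper[OF assms(2) bdd_aboveI2[where M = M]]) (use assms in auto)

lemma polynomial_norm_le:
  assumes "polynomial_on Z P" "z \<in> unit_ball Z"
  shows "norm (P z) \<le> poly_norm Z P"
  using polynomial_bounded[OF assms(1)] norm_le_poly_norm assms(2) by metis

lemma id_plus_polynomial_norm_le:
  assumes "polynomial_on Z P" "z \<in> unit_ball Z"
  shows "norm (z + P z) \<le> poly_norm Z (\<lambda>z. z + P z)"
proof (rule norm_le_poly_norm[OF _ assms(2)])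
  fix z assume "z \<in> unit_ball Z"
  then show "norm (z + P z) \<le> 1 + poly_norm Z P"
    using polynomial_norm_le[OF assms(1), of z] norm_triangle_ineq[of z "P z"]
    by (simp add: unit_ball_def)
qed

lemma poly_norm_le:
  assumes "complex_vector.subspace Z" "\<And>z. z \<in> unit_ball Z \<Longrightarrow> norm (P z) \<le> b"
  shows "poly_norm Z P \<le> b"
  unfolding poly_norm_def by (rule cSUP_least) (use assms zero_in_unit_ball in auto)

lemma poly_norm_nonneg:
  assumes "complex_vector.subspace Z" "polynomial_on Z P"
  shows "0 \<le> poly_norm Z P"
  using polynomial_norm_le[OF assms(2) zero_in_unit_ball[OF assms(1)]] norm_ge_zero order_trans by blast

text \<open>The strict inequality \<open>norm f < 1\<close> is the room that later modifications of
  \<open>f\<close> use up.\<close>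

lemma poly_norm_approximated:
  assumes Z: "complex_vector.subspace Z" and P: "polynomial_on Z P" and "\<epsilon> > 0"
  obtains f where "f \<in> Z" "norm f < 1" "norm (P f) > poly_norm Z P - \<epsilon>"
proof -
  have "\<exists>z\<in>unit_ball Z. norm (P z) > poly_norm Z P - \<epsilon>"
    using poly_norm_le[OF Z, of P "poly_norm Z P - \<epsilon>"] \<open>\<epsilon> > 0\<close> by force
  then obtain z where z: "z \<in> Z" "norm z \<le> 1" "norm (P z) > poly_norm Z P - \<epsilon>"
    by (auto simp: unit_ball_def)
  have "((\<lambda>r. norm (P (r *\<^sub>R z))) \<longlongrightarrow> norm (P z)) (at_left 1)"
    by (intro tendsto_norm polynomial_radial_limit[OF P Z z(1)])
  then have "\<forall>\<^sub>F r in at_left 1. poly_norm Z P - \<epsilon> < norm (P (r *\<^sub>R z))"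
    using z(3) by (rule order_tendstoD)
  moreover have "\<forall>\<^sub>F r in at_left 1. r \<in> {0<..<1 :: real}"
    by (rule eventually_at_leftI[of 0]) auto
  ultimately have "\<forall>\<^sub>F r in at_left 1. poly_norm Z P - \<epsilon> < norm (P (r *\<^sub>R z)) \<and> r \<in> {0<..<1 :: real}"
    by (rule eventually_conj)
  then obtain r where r: "poly_norm Z P - \<epsilon> < norm (P (r *\<^sub>R z))" "0 < r" "r < 1"
    using eventually_happens[of _ "at_left (1 :: real)"] by fastforce
  have "r * norm z \<le> r * 1" using r z(2) by (intro mult_left_mono) auto
  then have "norm (r *\<^sub>R z) < 1" using r unfolding norm_scaleR by linarith
  then show ?thesis using that[of "r *\<^sub>R z"] r(1) subspace_scaleR[OF Z z(1)] by blast
qed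

section \<open>Admissible constants and the range of the index\<close>

definition daugavet_constants :: "'a::complex_normed_vector set \<Rightarrow> real set"
  where "daugavet_constants Z = {m. 0 \<le> m \<and>
    (\<forall>P. compact_polynomial_on Z P \<longrightarrow> poly_norm Z (\<lambda>z. z + P z) \<ge> 1 + m * poly_norm Z P)}"

lemma Daug_p_eq_greatest: "Daug_p Z = (GREATEST m. m \<in> daugavet_constants Z)"
  by (simp add: Daug_p_def daugavet_constants_def)

lemma Daug_p_eqI:
  assumes "m \<in> daugavet_constants Z" "\<And>m'. m' \<in> daugavet_constants Z \<Longrightarrow> m' \<le> m"
  shows "Daug_p Z = m"
  unfolding Daug_p_eq_greatest by (rule Greatest_equality) (use assms in auto)

text \<open>Constant maps are compact polynomials, and for the constant \<open>b\<close> the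
  triangle inequality allows at most \<open>1 + norm b\<close>.\<close>

lemma daugavet_constant_le_1:
  assumes Z: "complex_vector.subspace Z" "b \<in> Z" "b \<noteq> 0" and m: "m \<in> daugavet_constants Z"
  shows "m \<le> 1"
proof -
  have ball: "unit_ball Z \<noteq> {}" using zero_in_unit_ball[OF Z(1)] by blast
  have poly: "polynomial_on Z (\<lambda>_. b)" by (rule polynomial_on_const[OF Z(2)])
  have "(\<lambda>_. b) ` unit_ball Z = {b}" using ball by auto
  then have "compact_polynomial_on Z (\<lambda>_. b)"
    using poly Z(2) by (simp add: compact_polynomial_on_def)
  then have "1 + m * poly_norm Z (\<lambda>_. b) \<le> poly_norm Z (\<lambda>z. z + b)"
    using m by (simp add: daugavet_constants_def)
  also have "poly_norm Z (\<lambda>_. b) = norm b"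
    using ball by (simp add: poly_norm_def)
  also have "poly_norm Z (\<lambda>z. z + b) \<le> 1 + norm b"
    by (rule poly_norm_le[OF Z(1)]) (auto simp: unit_ball_def intro: norm_triangle_le)
  finally have "m * norm b \<le> 1 * norm b" by simp
  then show ?thesis using Z(3) by simp
qed

text \<open>If \<open>b\<close> has distance \<open>d > 0\<close> from the closed span of
  \<open>B\<close>, then the coefficient of \<open>b\<close> in a vector \<open>x\<close> is at most
  \<open>norm x / d\<close>. The coefficients along a convergent sequence thus converge in the
  complex numbers.\<close>

lemma closed_span_finite:
  fixes B :: "'a::complex_normed_vector set"
  assumes "finite B"
  shows "closed (complex_vector.span B)"
  using assms
proof (induction B rule: finite_induct)
  case (insert b B)
  show ?case
  proof (cases "b \<in> complex_vector.span B")
    case True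
    then show ?thesis using insert.IH by (simp add: complex_vector.span_redundant)
  next
    case False
    define F where "F = complex_vector.span B"
    define d where "d = infdist b F"
    have F: "complex_vector.subspace F" unfolding F_def by (rule complex_vector.subspace_span)
    then have "F \<noteq> {}" using complex_vector.subspace_0 by blast
    then have d: "d > 0"
      using False insert.IH in_closed_iff_infdist_zero[of F b] infdist_nonneg[of b F]
      by (auto simp: F_def d_def less_le)
    have le: "cmod c * d \<le> norm x" if "x - c *\<^sub>C b \<in> F" for x c
    proof (cases "c = 0")
      case False
      have "- inverse c *\<^sub>C (x - c *\<^sub>C b) \<in> F"
        using complex_vector.subspace_scale[OF F that] .
      then have "d \<le> dist b (- inverse c *\<^sub>C (x - c *\<^sub>C b))" unfolding d_def by (rule infdist_le)
      also have "b - - inverse c *\<^sub>C (x - c *\<^sub>C b) = inverse c *\<^sub>C x"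
        using False by (simp add: complex_vector.scale_right_diff_distrib)
      then have "dist b (- inverse c *\<^sub>C (x - c *\<^sub>C b)) = norm x / cmod c"
        by (simp add: dist_norm norm_scaleC norm_inverse divide_inverse mult.commute)
      finally show ?thesis using False by (simp add: field_simps)
    qed simp
    show ?thesis
      unfolding closed_sequential_limits
    proof (intro allI impI, elim conjE)
      fix x l assume x: "\<forall>n. x n \<in> complex_vector.span (insert b B)" and l: "x \<longlonglongrightarrow> l"
      have "\<forall>n. \<exists>c. x n - c *\<^sub>C b \<in> F"
        using x by (simp add: complex_vector.span_breakdown_eq F_def)
      then obtain c where c: "x n - c n *\<^sub>C b \<in> F" for n by metis
      have diff: "cmod (c m - c n) * d \<le> norm (x m - x n)" for m n
      proof (rule le)
        have eq: "(x m - x n) - (c m - c n) *\<^sub>C b = (x m - c m *\<^sub>C b) - (x n - c n *\<^sub>C b)"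
          by (simp add: complex_vector.scale_left_diff_distrib)
        show "(x m - x n) - (c m - c n) *\<^sub>C b \<in> F"
          unfolding eq by (rule complex_vector.subspace_diff[OF F c c])
      qed
      have "Cauchy c"
        unfolding Cauchy_iff
      proof (intro allI impI)
        fix e :: real assume "e > 0"
        then have "e * d > 0" using d by simp
        then obtain M where M: "\<forall>m\<ge>M. \<forall>n\<ge>M. norm (x m - x n) < e * d"
          using LIMSEQ_imp_Cauchy[OF l] unfolding Cauchy_iff by blast
        have "cmod (c m - c n) < e" if "m \<ge> M" "n \<ge> M" for m n
          using diff[of m n] M that d by (meson le_less_trans mult_less_cancel_right_pos)
        then show "\<exists>M. \<forall>m\<ge>M. \<forall>n\<ge>M. norm (c m - c n) < e" by blast
      qed
      then obtain c' where c': "c \<longlonglongrightarrow> c'" using Cauchy_convergent_iff convergent_def by blast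
      have lim: "(\<lambda>n. x n - c n *\<^sub>C b) \<longlonglongrightarrow> l - c' *\<^sub>C b"
        by (intro tendsto_diff l bounded_bilinear.tendsto[OF bounded_bilinear_scaleC c' tendsto_const])
      have "l - c' *\<^sub>C b \<in> F"
        by (rule closed_sequentially[OF insert.IH[folded F_def] c lim])
      then show "l \<in> complex_vector.span (insert b B)"
        unfolding complex_vector.span_breakdown_eq F_def by blast
    qed
  qed
qed simp

text \<open>If \<open>I + P\<close> had norm below \<open>1\<close>, then the unit ball would lie within distance \<open>q < 1\<close> of a
  finite-dimensional subspace, which would then be all of \<open>Z\<close>.\<close>

lemma one_le_poly_norm_id_plus:
  fixes Z :: "'a::complex_normed_vector set"
  assumes Z: "complex_vector.subspace Z" "infinite_dim Z" and P: "compact_polynomial_on Z P"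
  shows "1 \<le> poly_norm Z (\<lambda>z. z + P z)"
proof (rule ccontr)
  define r where "r = poly_norm Z (\<lambda>z. z + P z)"
  assume "\<not> 1 \<le> poly_norm Z (\<lambda>z. z + P z)"
  then have r1: "r < 1" by (simp add: r_def)
  have poly: "polynomial_on Z P" using P by (simp add: compact_polynomial_on_def)
  have r: "norm (z + P z) \<le> r" if "z \<in> unit_ball Z" for z
    unfolding r_def by (rule id_plus_polynomial_norm_le[OF poly that])
  have "r \<ge> 0" using r[OF zero_in_unit_ball[OF Z(1)]] norm_ge_zero order_trans by blast
  \<comment> \<open>The bound \<open>r\<close> plus the radius \<open>(1 - r) / 2\<close> of the
    covering balls.\<close>
  define q where "q = (1 + r) / 2"
  have q: "0 < q" "q < 1" using \<open>r \<ge> 0\<close> r1 by (auto simp: q_def)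
  have "compact (Z \<inter> closure (P ` unit_ball Z))" using P by (simp add: compact_polynomial_on_def)
  then obtain B where B: "B \<subseteq> Z \<inter> closure (P ` unit_ball Z)" "finite B"
    "Z \<inter> closure (P ` unit_ball Z) \<subseteq> (\<Union>x\<in>B. ball x ((1 - r) / 2))"
    by (rule compactE_image[where C = "Z \<inter> closure (P ` unit_ball Z)" and f = "\<lambda>x. ball x ((1 - r) / 2)"])
      (use r1 in auto)
  define F where "F = complex_vector.span B"
  have F: "complex_vector.subspace F" unfolding F_def by (rule complex_vector.subspace_span)
  have FZ: "F \<subseteq> Z" unfolding F_def using B(1) by (intro complex_vector.span_minimal Z) auto
  have "closed F" unfolding F_def by (rule closed_span_finite[OF B(2)])
  have ball: "\<exists>g\<in>F. norm (z - g) \<le> q" if z: "z \<in> unit_ball Z" for z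
  proof -
    have "P z \<in> Z \<inter> closure (P ` unit_ball Z)"
      using polynomial_in[OF poly Z(1), of z] z closure_subset[of "P ` unit_ball Z"]
      by (auto simp: unit_ball_def)
    then obtain x where x: "x \<in> B" "P z \<in> ball x ((1 - r) / 2)" using B(3) by blast
    have "norm (z - - x) \<le> norm (z + P z) + norm (x - P z)"
      using norm_triangle_ineq[of "z + P z" "x - P z"] by simp
    also have "\<dots> \<le> r + (1 - r) / 2" using r[OF z] x(2) by (intro add_mono) (simp_all add: dist_norm)
    also have "\<dots> = q" by (simp add: q_def field_simps)
    finally show ?thesis
      using complex_vector.subspace_neg[OF F complex_vector.span_base[OF x(1), folded F_def]] by blast
  qed
  have near: "\<exists>g\<in>F. norm (w - g) \<le> q * norm w" if w: "w \<in> Z" "w \<noteq> 0" for w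
  proof -
    have "inverse (norm w) *\<^sub>R w \<in> unit_ball Z"
      using w subspace_scaleR[OF Z(1)] by (simp add: unit_ball_def)
    then obtain g where g: "g \<in> F" "norm (inverse (norm w) *\<^sub>R w - g) \<le> q" using ball by blast
    have "w - norm w *\<^sub>R g = norm w *\<^sub>R (inverse (norm w) *\<^sub>R w - g)"
      using w by (simp add: scaleR_diff_right)
    then have "norm (w - norm w *\<^sub>R g) = norm w * norm (inverse (norm w) *\<^sub>R w - g)"
      by simp
    also have "\<dots> \<le> norm w * q" using g(2) by (intro mult_left_mono) auto
    finally show ?thesis using subspace_scaleR[OF F g(1)] by (metis mult.commute)
  qed
  have "\<not> Z \<subseteq> F" using Z(2) B(1,2) unfolding infinite_dim_def F_def by blast
  then obtain z where z: "z \<in> Z" "z \<notin> F" by blast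
  define \<delta> where "\<delta> = infdist z F"
  have ne: "F \<noteq> {}" using complex_vector.subspace_0[OF F] by blast
  have "\<delta> > 0"
    using z(2) in_closed_iff_infdist_zero[OF \<open>closed F\<close> ne] infdist_nonneg[of z F]
    by (auto simp: \<delta>_def less_le)
  \<comment> \<open>Improving a nearly best approximation of \<open>z\<close> by the factor
    \<open>q\<close> would beat the distance \<delta>.\<close>
  then have "\<delta> < \<delta> / q" using q by (simp add: less_divide_eq)
  then have "\<exists>f\<in>F. dist z f < \<delta> / q"
    using ne unfolding \<delta>_def infdist_def
    by (simp add: cINF_less_iff[OF _ bdd_belowI2[where m = 0]])
  then obtain f where f: "f \<in> F" "norm (z - f) < \<delta> / q" by (auto simp: dist_norm)
  have "z - f \<in> Z" "z - f \<noteq> 0"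
    using f z FZ complex_vector.subspace_diff[OF Z(1)] by auto
  then obtain g where g: "g \<in> F" "norm (z - f - g) \<le> q * norm (z - f)" using near by blast
  have "\<delta> \<le> dist z (f + g)"
    unfolding \<delta>_def by (rule infdist_le[OF complex_vector.subspace_add[OF F f(1) g(1)]])
  also have "\<dots> \<le> q * norm (z - f)" using g(2) by (simp add: dist_norm diff_diff_eq)
  also have "\<dots> < \<delta>" using f(2) q by (simp add: field_simps)
  finally show False by simp
qed

lemma zero_in_daugavet_constants:
  assumes "complex_vector.subspace Z" "infinite_dim Z"
  shows "0 \<in> daugavet_constants Z"
  using one_le_poly_norm_id_plus[OF assms] by (simp add: daugavet_constants_def)

lemma infinite_dim_nonzero:
  assumes "infinite_dim Z"
  obtains b where "b \<in> Z" "b \<noteq> 0"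
proof -
  have "\<not> Z \<subseteq> complex_vector.span {}" using assms unfolding infinite_dim_def by blast
  then show ?thesis using that by auto
qed

text \<open>\<open>GREATEST\<close> says something only if a greatest element exists. It does, since
  each defining inequality is closed in the constant and so passes to the supremum.\<close>

lemma Daug_p_bounds:
  assumes Z: "complex_vector.subspace Z" "infinite_dim Z"
  shows "0 \<le> Daug_p Z" "Daug_p Z \<le> 1"
proof -
  obtain b where b: "b \<in> Z" "b \<noteq> 0" using infinite_dim_nonzero[OF Z(2)] .
  define D where "D = daugavet_constants Z"
  have le1: "m \<le> 1" if "m \<in> D" for m
    using daugavet_constant_le_1[OF Z(1) b] that by (simp add: D_def)
  then have bdd: "bdd_above D" by (rule bdd_aboveI)
  have D0: "0 \<in> D" unfolding D_def by (rule zero_in_daugavet_constants[OF Z])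
  have Sup0: "0 \<le> Sup D" by (rule cSup_upper[OF D0 bdd])
  have "Sup D \<in> daugavet_constants Z"
    unfolding daugavet_constants_def
  proof (intro CollectI conjI allI impI)
    fix P assume P: "compact_polynomial_on Z P"
    then have nn: "0 \<le> poly_norm Z P"
      by (intro poly_norm_nonneg Z) (simp add: compact_polynomial_on_def)
    have m: "1 + m * poly_norm Z P \<le> poly_norm Z (\<lambda>z. z + P z)" if "m \<in> D" for m
      using that P by (simp add: D_def daugavet_constants_def)
    show "1 + Sup D * poly_norm Z P \<le> poly_norm Z (\<lambda>z. z + P z)"
    proof (cases "poly_norm Z P = 0")
      case False
      have "Sup D \<le> (poly_norm Z (\<lambda>z. z + P z) - 1) / poly_norm Z P"
        by (rule cSup_least) (use D0 m nn False in \<open>auto simp: field_simps\<close>)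
      then show ?thesis using nn False by (simp add: field_simps)
    qed (use m[OF D0] in simp)
  qed (rule Sup0)
  then have "Daug_p Z = Sup D" "Sup D \<le> 1"
    using le1 cSup_upper[OF _ bdd] by (auto simp: D_def intro!: Daug_p_eqI)
  then show "0 \<le> Daug_p Z" "Daug_p Z \<le> 1" using Sup0 by auto
qed

section \<open>Prescribing the value of a function at a point near the boundary\<close>

text \<open>With \<open>c = 1 - 3 * \<eta>\<close>, the norm exceeds \<open>c\<close> by at most
  2\<eta> everywhere: on \<open>U\<close> by the oscillation of \<open>f\<close> and the thinness of
  \<phi>, off \<open>U\<close> by \<phi> times a vector of norm at most 2.\<close>

lemma function_space_modification:
  fixes S :: "('k::topological_space \<Rightarrow>\<^sub>C 'x::complex_normed_vector) set"
    and f :: "'k \<Rightarrow>\<^sub>C 'x"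
  assumes S: "function_space_over A S" and f: "norm f \<le> 1 - 3 * \<eta>" and \<eta>: "0 < \<eta>" "3 * \<eta> < 1"
    and U: "open U" "t0 \<in> U" "t0 \<in> shilov_boundary A"
    and osc: "\<And>s t. s \<in> U \<Longrightarrow> t \<in> U \<Longrightarrow> norm (f s - f t) \<le> \<eta>" and "\<tau> > 0"
  obtains t \<phi> where "t \<in> U" "\<phi> \<in> A" "\<phi> t = 1" "\<forall>s. cmod (apply_bcontfun \<phi> s) \<le> 1"
    "\<forall>s. s \<notin> U \<longrightarrow> cmod (apply_bcontfun \<phi> s) \<le> \<tau>"
    "\<forall>x. norm x \<le> 1 \<longrightarrow> norm (f + tensor \<phi> ((1 - 3 * \<eta>) *\<^sub>R x - apply_bcontfun f t)) \<le> 1"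
proof -
  define c where "c = 1 - 3 * \<eta>"
  have c: "0 \<le> c" "c \<le> 1" using \<eta> by (auto simp: c_def)
  have "peaks_in A U" using U by (auto simp: shilov_boundary_def)
  \<comment> \<open>\<eta> serves the norm estimate off \<open>U\<close>, \<tau> is the decay asked
    for by the caller.\<close>
  moreover have "min \<tau> \<eta> > 0" using \<eta> \<open>\<tau> > 0\<close> by simp
  ultimately obtain \<phi> t where \<phi>: "\<phi> \<in> A" "t \<in> U" "\<phi> t = 1"
    "\<And>s. cmod (\<phi> s) + cmod (1 - \<phi> s) \<le> 1 + \<eta>" "\<And>s. cmod (\<phi> s) \<le> 1"
    "\<And>s. s \<notin> U \<Longrightarrow> cmod (\<phi> s) \<le> min \<tau> \<eta>"
    using peaks_in_thin[OF function_spaceD(2)[OF S] _ \<eta>(1)] by metis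
  have "norm (f + tensor \<phi> (c *\<^sub>R x - f t)) \<le> 1" if x: "norm x \<le> 1" for x
  proof (rule norm_bound)
    fix s
    have ft: "norm (f t) \<le> c" using norm_bounded[of f t] f by (simp add: c_def)
    have fs: "norm (f s) \<le> c" using norm_bounded[of f s] f by (simp add: c_def)
    have cx: "norm (c *\<^sub>R x) \<le> c" using c x by (simp add: mult_left_le)
    show "norm ((f + tensor \<phi> (c *\<^sub>R x - f t)) s) \<le> 1"
    proof (cases "s \<in> U")
      case True
      have "(f + tensor \<phi> (c *\<^sub>R x - f t)) s =
          (f s - f t) + ((1 - \<phi> s) *\<^sub>C f t + \<phi> s *\<^sub>C (c *\<^sub>R x))"
        by (simp add: complex_vector.scale_left_diff_distrib complex_vector.scale_right_diff_distrib)
      also have "norm \<dots> \<le> norm (f s - f t) + (norm ((1 - \<phi> s) *\<^sub>C f t) + norm (\<phi> s *\<^sub>C (c *\<^sub>R x)))"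
        by (intro norm_triangle_le add_left_mono norm_triangle_ineq)
      also have "\<dots> \<le> \<eta> + (cmod (1 - \<phi> s) * c + cmod (\<phi> s) * c)"
        unfolding norm_scaleC using osc[OF True \<phi>(2)] ft cx by (intro add_mono mult_left_mono) auto
      also have "\<dots> = \<eta> + (cmod (\<phi> s) + cmod (1 - \<phi> s)) * c" by (simp add: algebra_simps)
      also have "\<dots> \<le> \<eta> + (1 + \<eta>) * c" using \<phi>(4)[of s] c by (intro add_left_mono mult_right_mono) auto
      also have "\<dots> \<le> \<eta> + (c + \<eta>)" using mult_left_le[OF c(2), of \<eta>] \<eta> by (simp add: algebra_simps)
      also have "\<dots> \<le> 1" using \<eta> by (simp add: c_def)
      finally show ?thesis .
    next
      case False
      have "norm ((f + tensor \<phi> (c *\<^sub>R x - f t)) s) \<le> norm (f s) + cmod (\<phi> s) * norm (c *\<^sub>R x - f t)"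
        using norm_triangle_ineq[of "f s" "\<phi> s *\<^sub>C (c *\<^sub>R x - f t)"] by (simp add: norm_scaleC)
      also have "\<dots> \<le> c + \<eta> * 2"
      proof (intro add_mono mult_mono fs)
        show "cmod (\<phi> s) \<le> \<eta>" using \<phi>(6)[OF False] by simp
        show "norm (c *\<^sub>R x - f t) \<le> 2"
          using norm_triangle_ineq4[of "c *\<^sub>R x" "f t"] cx ft c(2) by linarith
      qed (use \<eta> in auto)
      also have "\<dots> \<le> 1" using \<eta> by (simp add: c_def)
      finally show ?thesis .
    qed
  qed
  then show ?thesis using that[of t \<phi>] \<phi> by (simp add: c_def)
qed

lemma bounded_clinear_on_eval:
  fixes S :: "('k::topological_space \<Rightarrow>\<^sub>C 'x::complex_normed_vector) set"
  shows "bounded_clinear_on S UNIV (\<lambda>f. f t)"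
  unfolding bounded_clinear_on_def using norm_bounded by (auto intro!: exI[of _ 1])

lemma bounded_clinear_on_tensor:
  assumes S: "function_space_over A S" and "\<phi> \<in> A"
  shows "bounded_clinear_on UNIV S (\<lambda>x. tensor \<phi> (c *\<^sub>R x))"
  unfolding bounded_clinear_on_def
proof (intro conjI allI ballI exI)
  show "(\<lambda>x. tensor \<phi> (c *\<^sub>R x)) \<in> UNIV \<rightarrow> S" using function_spaceD(3)[OF S \<open>\<phi> \<in> A\<close>] by auto
  show "tensor \<phi> (c *\<^sub>R (x + y)) = tensor \<phi> (c *\<^sub>R x) + tensor \<phi> (c *\<^sub>R y)" for x y
    by (rule bcontfun_eqI) (simp add: scaleR_add_right scaleC_add_right)
  show "tensor \<phi> (c *\<^sub>R a *\<^sub>C x) = a *\<^sub>C tensor \<phi> (c *\<^sub>R x)" for a x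
    by (rule bcontfun_eqI) (simp add: scaleC_of_real[symmetric] scaleC_scaleC mult_ac)
  show "norm (tensor \<phi> (c *\<^sub>R x)) \<le> norm \<phi> * \<bar>c\<bar> * norm x" for x
  proof (rule norm_bound)
    fix t
    have "cmod (\<phi> t) * (\<bar>c\<bar> * norm x) \<le> norm \<phi> * (\<bar>c\<bar> * norm x)"
      by (intro mult_right_mono norm_bounded) auto
    then show "norm (tensor \<phi> (c *\<^sub>R x) t) \<le> norm \<phi> * \<bar>c\<bar> * norm x"
      by (simp add: norm_scaleC mult.assoc)
  qed
qed

lemma compact_closure_subset:
  fixes C :: "'a::t2_space set"
  assumes "compact C" "X \<subseteq> C"
  shows "compact (closure X)"
proof -
  have "closure X \<subseteq> C" using assms by (intro closure_minimal compact_imp_closed)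
  then have "closure X = C \<inter> closure X" by auto
  then show ?thesis using compact_Int_closed[OF assms(1) closed_closure[of X]] by simp
qed

section \<open>The index of X as a lower bound\<close>

lemma daugavet_constants_range_subset:
  fixes S :: "('k::topological_space \<Rightarrow>\<^sub>C 'x::complex_normed_vector) set"
  assumes K: "compact (UNIV :: 'k set)" and S: "function_space_over A S"
    and m: "m \<in> daugavet_constants (UNIV :: 'x set)"
  shows "m \<in> daugavet_constants S"
  unfolding daugavet_constants_def
proof (intro CollectI conjI allI impI)
  show m0: "0 \<le> m" using m by (simp add: daugavet_constants_def)
  fix P assume P: "compact_polynomial_on S P"
  then have poly: "polynomial_on S P" by (simp add: compact_polynomial_on_def)
  note sub = function_spaceD(1)[OF S]
  define N where "N = poly_norm S P"
  define R where "R = poly_norm S (\<lambda>z. z + P z)"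
  have "1 + m * N \<le> R + \<epsilon> * (1 + m)" if \<epsilon>: "\<epsilon> > 0" for \<epsilon>
  proof -
    obtain f where f: "f \<in> S" "norm f < 1" "norm (P f) > N - \<epsilon>"
      using poly_norm_approximated[OF sub poly \<epsilon>] unfolding N_def by blast
    \<comment> \<open>With 4 instead of 3 in the denominator, \<open>3 * \<eta> < 1\<close> is
      strict also for \<open>f = 0\<close>.\<close>
    define \<eta> where "\<eta> = min \<epsilon> (1 - norm f) / 4"
    have "0 < \<eta>" "4 * \<eta> \<le> \<epsilon>" "4 * \<eta> \<le> 1 - norm f" using \<epsilon> f(2) by (simp_all add: \<eta>_def)
    then have \<eta>: "0 < \<eta>" "3 * \<eta> < 1" "norm f \<le> 1 - 3 * \<eta>" "3 * \<eta> \<le> \<epsilon>"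
      using norm_ge_zero[of f] by linarith+
    define c where "c = 1 - 3 * \<eta>"
    have c: "0 < c" "c \<le> 1" "1 - c \<le> \<epsilon>" using \<eta> by (auto simp: c_def)
    have PfS: "P f \<in> S" by (rule polynomial_in[OF poly sub f(1)])
    obtain t0 where t0: "t0 \<in> shilov_boundary A" "norm (P f t0) = norm (P f)"
      by (rule function_space_norm_attained[OF K S PfS])
    define U where "U = {s. norm (P f s) > N - \<epsilon>} \<inter> {s. norm (f s - f t0) < \<eta> / 2}"
    have "open U"
      unfolding U_def
      by (intro open_Int open_Collect_less continuous_on_norm continuous_on_const continuous_on_diff) auto
    moreover have "t0 \<in> U" using t0(2) f(3) \<eta>(1) by (simp add: U_def)
    moreover have "norm (f s - f t) \<le> \<eta>" if "s \<in> U" "t \<in> U" for s t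
      using that norm_triangle_ineq4[of "f s - f t0" "f t - f t0"] by (simp add: U_def)
    ultimately obtain t \<phi> where t: "t \<in> U" and \<phi>: "\<phi> \<in> A" "\<phi> t = 1"
      and modif: "\<forall>x. norm x \<le> 1 \<longrightarrow> norm (f + tensor \<phi> (c *\<^sub>R x - f t)) \<le> 1"
      using function_space_modification[OF S \<eta>(3,1,2) _ _ t0(1), of U 1] unfolding c_def by (metis zero_less_one)
    define u where "u = f - tensor \<phi> (f t)"
    define \<Phi> where "\<Phi> x = u + tensor \<phi> (c *\<^sub>R x)" for x
    define Q where "Q x = P (\<Phi> x) t" for x
    have uS: "u \<in> S"
      unfolding u_def by (intro complex_vector.subspace_diff sub f(1) function_spaceD(3)[OF S \<phi>(1)])
    have \<Phi>_eq: "\<Phi> x = f + tensor \<phi> (c *\<^sub>R x - f t)" for x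
      by (rule bcontfun_eqI) (simp add: \<Phi>_def u_def complex_vector.scale_right_diff_distrib)
    have \<Phi>S: "\<Phi> x \<in> S" for x
      unfolding \<Phi>_def by (intro complex_vector.subspace_add sub uS function_spaceD(3)[OF S \<phi>(1)])
    have \<Phi>ball: "\<Phi> x \<in> unit_ball S" if "x \<in> unit_ball UNIV" for x
      using that modif \<Phi>S[of x] by (simp add: unit_ball_def \<Phi>_eq)
    have \<Phi>t: "\<Phi> x t = c *\<^sub>R x" for x by (simp add: \<Phi>_eq \<phi>(2))
    have Qpoly: "polynomial_on UNIV Q"
      unfolding Q_def \<Phi>_def
      by (rule polynomial_on_affine_substitution[OF poly sub uS
            bounded_clinear_on_tensor[OF S \<phi>(1)] bounded_clinear_on_eval])
    define C where "C = S \<inter> closure (P ` unit_ball S)"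
    have "compact C" using P by (simp add: C_def compact_polynomial_on_def)
    moreover have "continuous_on C (\<lambda>g. apply_bcontfun g t)"
      by (intro continuous_at_imp_continuous_on ballI linear_continuous_at
          bounded_linear_intro[where K = 1]) (auto simp: norm_bounded)
    ultimately have "compact ((\<lambda>g. apply_bcontfun g t) ` C)" by (intro compact_continuous_image)
    moreover have "Q ` unit_ball UNIV \<subseteq> (\<lambda>g. apply_bcontfun g t) ` C"
    proof
      fix y assume "y \<in> Q ` unit_ball UNIV"
      then obtain x where x: "x \<in> unit_ball UNIV" "y = P (\<Phi> x) t" by (auto simp: Q_def)
      have "P (\<Phi> x) \<in> C"
        using \<Phi>ball[OF x(1)] polynomial_in[OF poly sub \<Phi>S] closure_subset[of "P ` unit_ball S"]
        by (auto simp: C_def)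
      then show "y \<in> (\<lambda>g. apply_bcontfun g t) ` C" using x(2) by blast
    qed
    ultimately have "compact (closure (Q ` unit_ball UNIV))"
      by (rule compact_closure_subset)
    then have "compact_polynomial_on UNIV Q" using Qpoly by (simp add: compact_polynomial_on_def)
    then have "1 + m * poly_norm UNIV Q \<le> poly_norm UNIV (\<lambda>x. x + Q x)"
      using m by (simp add: daugavet_constants_def)
    also have "\<dots> \<le> R + \<epsilon>"
    proof (rule poly_norm_le)
      fix x :: 'x assume x: "x \<in> unit_ball UNIV"
      \<comment> \<open>At \<open>t\<close> the function \<open>\<Phi> x\<close> is only
        \<open>c *\<^sub>R x\<close>; the missing part costs at most \<epsilon>.\<close>
      have "x + Q x = (1 - c) *\<^sub>R x + (\<Phi> x + P (\<Phi> x)) t" by (simp add: \<Phi>t Q_def algebra_simps)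
      also have "norm \<dots> \<le> norm ((1 - c) *\<^sub>R x) + norm ((\<Phi> x + P (\<Phi> x)) t)"
        by (rule norm_triangle_ineq)
      also have "norm ((1 - c) *\<^sub>R x) \<le> \<epsilon>"
        using x c mult_left_le[of "norm x" "1 - c"] by (simp add: unit_ball_def)
      also have "norm ((\<Phi> x + P (\<Phi> x)) t) \<le> R"
        using norm_bounded[of "\<Phi> x + P (\<Phi> x)" t] id_plus_polynomial_norm_le[OF poly \<Phi>ball[OF x]]
        unfolding R_def by linarith
      finally show "norm (x + Q x) \<le> R + \<epsilon>" by simp
    qed simp
    finally have main: "1 + m * poly_norm UNIV Q \<le> R + \<epsilon>" .
    \<comment> \<open>The parameter at which the affine copy passes through \<open>f\<close>; it
      lies in the ball because \<open>norm f\<close> is at most \<open>c\<close>. Thus Q inherits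
      the almost norming value of P.\<close>
    define x0 where "x0 = inverse c *\<^sub>R f t"
    have "norm x0 \<le> 1"
      using norm_bounded[of f t] \<eta>(3) c(1) by (simp add: x0_def c_def field_simps)
    then have "x0 \<in> unit_ball UNIV" by (simp add: unit_ball_def)
    from polynomial_norm_le[OF Qpoly this] have "norm (Q x0) \<le> poly_norm UNIV Q" .
    moreover have "\<Phi> x0 = f"
      by (rule bcontfun_eqI) (use c(1) in \<open>simp add: \<Phi>_eq x0_def\<close>)
    then have "norm (Q x0) > N - \<epsilon>" using t by (simp add: Q_def U_def)
    ultimately have "m * (N - \<epsilon>) \<le> m * poly_norm UNIV Q" using m0 by (intro mult_left_mono) auto
    then show ?thesis using main by (simp add: algebra_simps)
  qed
  then have "1 + m * N \<le> R + \<epsilon>" if "\<epsilon> > 0" for \<epsilon>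
    using that m0 spec[of "\<lambda>e. e > 0 \<longrightarrow> 1 + m * N \<le> R + e * (1 + m)" "\<epsilon> / (1 + m)"] by simp
  then show "1 + m * poly_norm S P \<le> poly_norm S (\<lambda>z. z + P z)"
    unfolding N_def[symmetric] R_def[symmetric] by (rule field_le_epsilon)
qed

section \<open>Consequences of an indicator in the algebra\<close>

text \<open>P is lifted so that it acts on the value at \<open>t0\<close> only. Away from
  \<open>t0\<close> the function \<open>f + P' f\<close> is just \<open>f\<close>, which is the
  source of the 1 in the maximum; that 1 is harmless for infinite-dimensional X and decisive for the
  scalars.\<close>

lemma daugavet_constant_isolated_point:
  fixes S :: "('k::topological_space \<Rightarrow>\<^sub>C 'x::complex_normed_vector) set"
  assumes S: "function_space_over A S" and e: "e \<in> A" "apply_bcontfun e = indicator {t0}"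
    and m: "m \<in> daugavet_constants S" and P: "compact_polynomial_on (UNIV :: 'x set) P"
  shows "1 + m * poly_norm UNIV P \<le> max 1 (poly_norm UNIV (\<lambda>x. x + P x))"
proof -
  note sub = function_spaceD(1)[OF S]
  have poly: "polynomial_on UNIV P" using P by (simp add: compact_polynomial_on_def)
  have m0: "0 \<le> m" using m by (simp add: daugavet_constants_def)
  define P' where "P' f = tensor e (1 *\<^sub>R P (0 + apply_bcontfun f t0))" for f :: "'k \<Rightarrow>\<^sub>C 'x"
  have poly': "polynomial_on S P'"
    unfolding P'_def
    by (rule polynomial_on_affine_substitution[OF poly _ _
          bounded_clinear_on_eval bounded_clinear_on_tensor[OF S e(1)]]) auto
  have et: "e t = (if t = t0 then 1 else 0)" for t by (simp add: e(2))
  have ballt0: "f t0 \<in> unit_ball UNIV" if "f \<in> unit_ball S" for f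
    using that norm_bounded[of f t0] by (simp add: unit_ball_def)
  define C where "C = closure (P ` unit_ball UNIV)"
  define T where "T x = tensor e x" for x :: 'x
  have TS: "T x \<in> S" for x unfolding T_def by (rule function_spaceD(3)[OF S e(1)])
  have normT: "norm (T x) \<le> norm x" for x by (rule norm_bound) (simp add: T_def et)
  have "bounded_linear T"
  proof (rule bounded_linear_intro[where K = 1])
    show "T (x + y) = T x + T y" for x y
      by (rule bcontfun_eqI) (simp add: T_def scaleC_add_right)
    show "T (r *\<^sub>R x) = r *\<^sub>R T x" for r x
      by (rule bcontfun_eqI) (simp add: T_def et)
  qed (simp add: normT)
  then have "compact (T ` C)"
    using P by (intro compact_continuous_image linear_continuous_on)
      (simp_all add: C_def compact_polynomial_on_def)
  moreover have "P' ` unit_ball S \<subseteq> T ` C"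
    using ballt0 closure_subset[of "P ` unit_ball UNIV"] by (auto simp: P'_def T_def C_def)
  ultimately have "closure (P' ` unit_ball S) \<subseteq> T ` C"
    by (intro closure_minimal compact_imp_closed)
  then have "S \<inter> closure (P' ` unit_ball S) = T ` C \<inter> closure (P' ` unit_ball S)" using TS by auto
  then have "compact_polynomial_on S P'"
    using poly' compact_Int_closed[OF \<open>compact (T ` C)\<close> closed_closure]
    by (simp add: compact_polynomial_on_def)
  then have "1 + m * poly_norm S P' \<le> poly_norm S (\<lambda>z. z + P' z)"
    using m by (simp add: daugavet_constants_def)
  also have "\<dots> \<le> max 1 (poly_norm UNIV (\<lambda>x. x + P x))"
  proof (intro poly_norm_le[OF sub] norm_bound)
    fix f t assume f: "f \<in> unit_ball S"
    show "norm ((f + P' f) t) \<le> max 1 (poly_norm UNIV (\<lambda>x. x + P x))"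
    proof (cases "t = t0")
      case True
      then show ?thesis
        using id_plus_polynomial_norm_le[OF poly ballt0[OF f]] by (simp add: P'_def et)
    next
      case False
      then show ?thesis using f norm_bounded[of f t] by (simp add: P'_def et unit_ball_def le_max_iff_disj)
    qed
  qed
  finally have "1 + m * poly_norm S P' \<le> max 1 (poly_norm UNIV (\<lambda>x. x + P x))" .
  moreover have "poly_norm UNIV P \<le> poly_norm S P'"
  proof (rule poly_norm_le)
    fix x :: 'x assume x: "x \<in> unit_ball UNIV"
    then have Tx: "T x \<in> unit_ball S" using TS[of x] normT[of x] by (simp add: unit_ball_def)
    have "norm (P x) = norm (P' (T x) t0)" by (simp add: P'_def T_def et)
    also have "\<dots> \<le> poly_norm S P'"
      using norm_bounded[of "P' (T x)" t0] polynomial_norm_le[OF poly' Tx] by linarith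
    finally show "norm (P x) \<le> poly_norm S P'" .
  qed simp
  then have "m * poly_norm UNIV P \<le> m * poly_norm S P'" using m0 by (rule mult_left_mono)
  ultimately show ?thesis by linarith
qed

section \<open>Boundaries without isolated points\<close>

lemma exists_aligned_unit_vector:
  fixes y :: "'x::complex_normed_vector"
  assumes "(v :: 'x) \<noteq> 0" "c \<ge> 0"
  obtains x where "norm x = 1" "norm (c *\<^sub>R x + y) = c + norm y"
proof (cases "y = 0")
  case True
  then show ?thesis using that[of "sgn v"] assms by (simp add: norm_sgn)
next
  case False
  have "c *\<^sub>R sgn y + y = (c + norm y) *\<^sub>R sgn y"
    using False by (simp add: sgn_div_norm distrib_right scaleR_add_left)
  then have "norm (c *\<^sub>R sgn y + y) = c + norm y"
    using False assms(2) by (simp add: norm_sgn)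
  then show ?thesis using that[of "sgn y"] False by (simp add: norm_sgn)
qed

text \<open>An open set meeting \<open>D\<close> contains two disjoint open sets that meet
  \<open>D\<close>. The first member of each pair is kept for the sequence and the second is split
  again.\<close>

lemma disjoint_open_sequence:
  fixes D W :: "'k::t2_space set"
  assumes W: "open W" "W \<inter> D \<noteq> {}"
    and noiso: "\<And>V t. open V \<Longrightarrow> t \<in> V \<inter> D \<Longrightarrow> \<not> V \<inter> D \<subseteq> {t}"
  obtains U :: "nat \<Rightarrow> 'k set" where "\<forall>n. open (U n) \<and> U n \<subseteq> W \<and> U n \<inter> D \<noteq> {}"
    "\<forall>m n. m \<noteq> n \<longrightarrow> U m \<inter> U n = {}"
proof -
  define Q where "Q p \<longleftrightarrow> open (fst p) \<and> open (snd p) \<and> fst p \<inter> snd p = {} \<and>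
    fst p \<inter> D \<noteq> {} \<and> snd p \<inter> D \<noteq> {}" for p :: "'k set \<times> 'k set"
  have split: "\<exists>p. Q p \<and> fst p \<subseteq> V \<and> snd p \<subseteq> V" if V: "open V" "V \<inter> D \<noteq> {}" for V
  proof -
    obtain s where s: "s \<in> V \<inter> D" using V(2) by blast
    then obtain t where t: "t \<in> V \<inter> D" "t \<noteq> s" using noiso[OF V(1)] by blast
    obtain X Y where XY: "open X" "open Y" "s \<in> X" "t \<in> Y" "X \<inter> Y = {}"
      using hausdorff[of s t] t(2) by metis
    show ?thesis
      using V(1) s t XY by (intro exI[of _ "(V \<inter> X, V \<inter> Y)"]) (auto simp: Q_def intro!: open_Int)
  qed
  have "\<exists>f. \<forall>n. (Q (f n) \<and> fst (f n) \<subseteq> W \<and> snd (f n) \<subseteq> W) \<and>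
      (fst (f (Suc n)) \<subseteq> snd (f n) \<and> snd (f (Suc n)) \<subseteq> snd (f n))"
  proof (rule dependent_nat_choice)
    show "\<exists>p. Q p \<and> fst p \<subseteq> W \<and> snd p \<subseteq> W" by (rule split[OF W])
    fix p and n :: nat assume p: "Q p \<and> fst p \<subseteq> W \<and> snd p \<subseteq> W"
    then have "open (snd p)" "snd p \<inter> D \<noteq> {}" by (simp_all add: Q_def)
    from split[OF this] obtain p' where p': "Q p'" "fst p' \<subseteq> snd p" "snd p' \<subseteq> snd p"
      by (elim exE conjE)
    show "\<exists>p'. (Q p' \<and> fst p' \<subseteq> W \<and> snd p' \<subseteq> W) \<and> fst p' \<subseteq> snd p \<and> snd p' \<subseteq> snd p"
      using p p' by (intro exI[of _ p']) auto
  qed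
  then obtain f where f: "\<And>n. Q (f n)" "\<And>n. fst (f n) \<subseteq> W"
    "\<And>n. fst (f (Suc n)) \<subseteq> snd (f n)" "\<And>n. snd (f (Suc n)) \<subseteq> snd (f n)" by blast
  have sub: "snd (f n) \<subseteq> snd (f m)" if "m \<le> n" for m n
    by (rule lift_Suc_antimono_le[of "\<lambda>n. snd (f n)", OF f(4) that])
  have disj: "fst (f m) \<inter> fst (f n) = {}" if mn: "m < n" for m n
  proof -
    obtain k where k: "n = Suc k" "m \<le> k" using mn by (cases n) auto
    have "fst (f n) \<subseteq> snd (f m)" using f(3)[of k] sub[OF k(2)] k(1) by blast
    then show ?thesis using f(1)[of m] unfolding Q_def by blast
  qed
  show ?thesis
  proof (rule that[of "\<lambda>n. fst (f n)"])
    show "\<forall>n. open (fst (f n)) \<and> fst (f n) \<subseteq> W \<and> fst (f n) \<inter> D \<noteq> {}"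
      using f(1,2) unfolding Q_def by blast
    show "\<forall>m n. m \<noteq> n \<longrightarrow> fst (f m) \<inter> fst (f n) = {}"
      using disj by (metis inf_commute linorder_neqE_nat)
  qed
qed

text \<open>A point lies in at most one \<open>U i\<close>, which contributes at most 1; the tails
  of the other peaks add up to at most the geometric sum 2. The factor 2 in \<open>z\<close> turns 1
  + 2 into 6.\<close>

lemma signed_sums_le_disjoint_peaks:
  fixes z :: "nat \<Rightarrow> 'k::topological_space \<Rightarrow>\<^sub>C 'x::complex_normed_vector" and \<phi> :: "nat \<Rightarrow> 'k \<Rightarrow>\<^sub>C complex"
  assumes disj: "\<forall>m n. m \<noteq> n \<longrightarrow> U m \<inter> U n = {}"
    and \<phi>1: "\<forall>n s. cmod (apply_bcontfun (\<phi> n) s) \<le> 1"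
    and \<phi>U: "\<forall>n s. s \<notin> U n \<longrightarrow> cmod (apply_bcontfun (\<phi> n) s) \<le> (1/2) ^ n"
    and z: "\<forall>n s. norm (apply_bcontfun (z n) s) \<le> 2 * cmod (apply_bcontfun (\<phi> n) s)"
    and "finite I"
  shows "signed_sums_le I z 6"
  unfolding signed_sums_le_def
proof (intro allI impI norm_bound)
  fix e :: "nat \<Rightarrow> real" and s assume e: "\<forall>i. e i \<in> {-1, 1}"
  have le: "cmod (apply_bcontfun (\<phi> i) s) \<le> (if s \<in> U i then 1 else 0) + (1/2) ^ i" for i
  proof (cases "s \<in> U i")
    case True
    have "cmod (apply_bcontfun (\<phi> i) s) \<le> 1" using \<phi>1 by blast
    also have "1 \<le> 1 + (1/2 :: real) ^ i" by simp
    finally show ?thesis using True by simp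
  qed (use \<phi>U in auto)
  have "\<forall>i\<in>{i \<in> I. s \<in> U i}. \<forall>j\<in>{i \<in> I. s \<in> U i}. i = j" using disj by blast
  then have card: "card {i \<in> I. s \<in> U i} \<le> 1"
    using card_le_Suc0_iff_eq[of "{i \<in> I. s \<in> U i}"] \<open>finite I\<close> by simp
  have geo: "(\<Sum>i\<in>I. (1/2 :: real) ^ i) \<le> 2"
    using sum_le_suminf[OF summable_geometric[of "1/2 :: real"] \<open>finite I\<close>]
    by (simp add: suminf_geometric)
  have apply_sum: "apply_bcontfun (\<Sum>i\<in>I. e i *\<^sub>R z i) s = (\<Sum>i\<in>I. e i *\<^sub>R apply_bcontfun (z i) s)"
    using \<open>finite I\<close> by (induction I rule: finite_induct) auto
  have "norm (\<Sum>i\<in>I. e i *\<^sub>R apply_bcontfun (z i) s) \<le> (\<Sum>i\<in>I. 2 * ((if s \<in> U i then 1 else 0) + (1/2) ^ i))"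
  proof (rule sum_norm_le)
    fix i
    have "\<bar>e i\<bar> = 1" using e[rule_format, of i] by auto
    then show "norm (e i *\<^sub>R apply_bcontfun (z i) s) \<le> 2 * ((if s \<in> U i then 1 else 0) + (1/2) ^ i)"
      using z[rule_format, of i s] le[of i] by simp
  qed
  also have "\<dots> = 2 * (real (card {i \<in> I. s \<in> U i}) + (\<Sum>i\<in>I. (1/2) ^ i))"
    using \<open>finite I\<close> by (simp add: sum_distrib_left[symmetric] sum.distrib sum.If_cases Int_def)
  also have "\<dots> \<le> 6" using card geo by simp
  finally show "norm (apply_bcontfun (\<Sum>i\<in>I. e i *\<^sub>R z i) s) \<le> 6" unfolding apply_sum .
qed

text \<open>Sums of the differences \<open>P (f + z n) - P f\<close> are bounded independently of the number of
  summands, so by compactness these differences cannot stay away from \<open>0\<close>.\<close>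

lemma compact_polynomial_difference_small:
  fixes S :: "'a::complex_normed_vector set" and z :: "nat \<Rightarrow> 'a"
  assumes S: "complex_vector.subspace S" and P: "compact_polynomial_on S P"
    and f: "f \<in> S" "norm f \<le> C" and z: "\<And>n. z n \<in> S" "\<And>n. norm (f + z n) \<le> 1"
    and sums: "\<And>I. finite I \<Longrightarrow> signed_sums_le I z C" and "\<epsilon> > 0"
  obtains n where "norm (P (f + z n) - P f) < \<epsilon>"
proof -
  have poly: "polynomial_on S P" using P by (simp add: compact_polynomial_on_def)
  obtain D where D: "\<And>I. finite I \<Longrightarrow> norm (\<Sum>i\<in>I. P (f + z i) - P f) \<le> D"
  proof -
    from polynomial_difference_sum_bound[OF poly S f, where 'i = nat] obtain D where
      D: "\<forall>(I :: nat set) z. finite I \<longrightarrow> z \<in> I \<rightarrow> S \<longrightarrow> signed_sums_le I z C \<longrightarrow>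
        norm (\<Sum>i\<in>I. P (f + z i) - P f) \<le> D" ..
    have "norm (\<Sum>i\<in>I. P (f + z i) - P f) \<le> D" if "finite I" for I
      using D that z(1) sums[OF that] by blast
    then show ?thesis by (rule that)
  qed
  have "f + z n \<in> unit_ball S" for n
    using z f complex_vector.subspace_add[OF S] by (simp add: unit_ball_def)
  then have "P (f + z n) \<in> S \<inter> closure (P ` unit_ball S)" for n
    using polynomial_in[OF poly S] closure_subset[of "P ` unit_ball S"] by (auto simp: unit_ball_def)
  moreover have "seq_compact (S \<inter> closure (P ` unit_ball S))"
    using P by (simp add: compact_polynomial_on_def compact_imp_seq_compact)
  ultimately obtain l r where r: "strict_mono (r :: nat \<Rightarrow> nat)" and l: "((\<lambda>n. P (f + z n)) \<circ> r) \<longlonglongrightarrow> l"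
    using seq_compactE[of _ "\<lambda>n. P (f + z n)"] by metis
  define w where "w k = P (f + z (r k)) - P f" for k
  define v where "v = l - P f"
  have w: "w \<longlonglongrightarrow> v"
    unfolding w_def v_def using l by (intro tendsto_diff tendsto_const) (simp add: o_def)
  have "norm v \<le> 0 + \<delta>" if \<delta>: "\<delta> > 0" for \<delta>
  proof -
    obtain k0 where k0: "\<And>k. k \<ge> k0 \<Longrightarrow> norm (w k - v) < \<delta> / 2"
      using LIMSEQ_D[OF w, of "\<delta> / 2"] \<delta> by auto
    \<comment> \<open>Enough terms that their total share of the error exceeds \<open>D\<close>:
      writing m v as the sum of the \<open>w k\<close> and of the \<open>v - w k\<close> then gives
      \<open>norm v < \<delta>\<close>.\<close>
    obtain m :: nat where m: "D / (\<delta> / 2) < real m" using reals_Archimedean2 by blast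
    define I where "I = r ` {k0..<k0 + m}"
    have "inj_on r {k0..<k0 + m}" using r strict_mono_imp_inj_on by (metis inj_on_subset subset_UNIV)
    then have "(\<Sum>i\<in>I. P (f + z i) - P f) = (\<Sum>k\<in>{k0..<k0 + m}. w k)"
      by (simp add: I_def sum.reindex w_def)
    then have 1: "norm (\<Sum>k\<in>{k0..<k0 + m}. w k) \<le> D" using D[of I] by (simp add: I_def)
    have "norm (\<Sum>k\<in>{k0..<k0 + m}. v - w k) \<le> (\<Sum>k\<in>{k0..<k0 + m}. \<delta> / 2)"
      by (rule sum_norm_le) (use k0 in \<open>auto simp: norm_minus_commute intro: less_imp_le\<close>)
    then have 2: "norm (\<Sum>k\<in>{k0..<k0 + m}. v - w k) \<le> real m * (\<delta> / 2)" by simp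
    have "real m *\<^sub>R v = (\<Sum>k\<in>{k0..<k0 + m}. w k) + (\<Sum>k\<in>{k0..<k0 + m}. v - w k)"
      by (simp add: sum_subtractf scaleR_conv_of_real sum_constant_scaleR)
    then have "norm (real m *\<^sub>R v) \<le> D + real m * (\<delta> / 2)"
      using norm_triangle_ineq[of "\<Sum>k\<in>{k0..<k0 + m}. w k" "\<Sum>k\<in>{k0..<k0 + m}. v - w k"] 1 2
      by simp
    then have *: "real m * norm v \<le> D + real m * (\<delta> / 2)" by simp
    have D0: "0 \<le> D" using D[of "{}"] by simp
    have "D < real m * (\<delta> / 2)" using m \<delta> by (simp add: field_simps)
    then have "real m * norm v < real m * \<delta>" "m > 0" using * D0 \<delta> by (auto simp: field_simps intro: gr0I)
    then show ?thesis by simp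
  qed
  then have "v = 0" using field_le_epsilon[of "norm v" 0] by simp
  then obtain k where "norm (w k - 0) < \<epsilon>" using LIMSEQ_D[OF w \<open>\<epsilon> > 0\<close>] by blast
  then show ?thesis using that[of "r k"] by (simp add: w_def)
qed

text \<open>\<open>x n\<close> is aligned with \<open>P f (t n)\<close>, which is known before the
  modification is made. For some \<open>n\<close> the polynomial changes by less than \<epsilon>
  between \<open>f\<close> and \<open>f + z n\<close>, and at \<open>t n\<close> the latter equals
  \<open>c *\<^sub>R x n\<close>, so the alignment is good for \<open>P (f + z n)\<close> as
  well.\<close>

lemma one_in_daugavet_constants:
  fixes S :: "('k::t2_space \<Rightarrow>\<^sub>C 'x::complex_normed_vector) set"
  assumes K: "compact (UNIV :: 'k set)" and S: "function_space_over A S" and v: "(v :: 'x) \<noteq> 0"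
    and noind: "\<And>e t. e \<in> A \<Longrightarrow> apply_bcontfun e \<noteq> indicator {t}"
  shows "1 \<in> daugavet_constants S"
  unfolding daugavet_constants_def
proof (intro CollectI conjI allI impI)
  fix P assume P: "compact_polynomial_on S P"
  then have poly: "polynomial_on S P" by (simp add: compact_polynomial_on_def)
  note sub = function_spaceD(1)[OF S]
  define N where "N = poly_norm S P"
  define R where "R = poly_norm S (\<lambda>z. z + P z)"
  have "1 + N \<le> R + \<epsilon> * 3" if \<epsilon>: "\<epsilon> > 0" for \<epsilon>
  proof -
    obtain f where f: "f \<in> S" "norm f < 1" "norm (P f) > N - \<epsilon>"
      using poly_norm_approximated[OF sub poly \<epsilon>] unfolding N_def by blast
    define \<eta> where "\<eta> = min \<epsilon> (1 - norm f) / 4"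
    have "0 < \<eta>" "4 * \<eta> \<le> \<epsilon>" "4 * \<eta> \<le> 1 - norm f" using \<epsilon> f(2) by (simp_all add: \<eta>_def)
    then have \<eta>: "0 < \<eta>" "3 * \<eta> < 1" "norm f \<le> 1 - 3 * \<eta>" "3 * \<eta> \<le> \<epsilon>"
      using norm_ge_zero[of f] by linarith+
    define c where "c = 1 - 3 * \<eta>"
    have c: "0 < c" "c \<le> 1" "1 - c \<le> \<epsilon>" using \<eta> by (auto simp: c_def)
    have PfS: "P f \<in> S" by (rule polynomial_in[OF poly sub f(1)])
    obtain t0 where t0: "t0 \<in> shilov_boundary A" "norm (P f t0) = norm (P f)"
      by (rule function_space_norm_attained[OF K S PfS])
    define W where "W = {s. norm (P f s) > N - \<epsilon>} \<inter> {s. norm (f s - f t0) < \<eta> / 2}"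
    have oW: "open W"
      unfolding W_def
      by (intro open_Int open_Collect_less continuous_on_norm continuous_on_const continuous_on_diff) auto
    have "t0 \<in> W" using t0(2) f(3) \<eta>(1) by (simp add: W_def)
    then have ne: "W \<inter> shilov_boundary A \<noteq> {}" using t0(1) by blast
    have noiso: "\<not> V \<inter> shilov_boundary A \<subseteq> {t}" if oV: "open V" and tV: "t \<in> V \<inter> shilov_boundary A" for V t
    proof
      assume V: "V \<inter> shilov_boundary A \<subseteq> {t}"
      have tD: "t \<in> shilov_boundary A" "t \<in> V" using tV by auto
      obtain e where "e \<in> A" "apply_bcontfun e = indicator {t}"
        by (rule indicator_in_algebra[OF K function_spaceD(2)[OF S] tD(1) oV tD(2) V])
      then show False using noind by blast
    qed
    obtain U :: "nat \<Rightarrow> 'k set" where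
      U: "\<forall>n. open (U n) \<and> U n \<subseteq> W \<and> U n \<inter> shilov_boundary A \<noteq> {}"
      and disj: "\<forall>m n. m \<noteq> n \<longrightarrow> U m \<inter> U n = {}"
      by (rule disjoint_open_sequence[OF oW ne noiso])
    have "\<exists>t \<phi>. t \<in> U n \<and> \<phi> \<in> A \<and> apply_bcontfun \<phi> t = 1 \<and> (\<forall>s. cmod (apply_bcontfun \<phi> s) \<le> 1) \<and>
      (\<forall>s. s \<notin> U n \<longrightarrow> cmod (apply_bcontfun \<phi> s) \<le> (1/2) ^ n) \<and>
      (\<forall>x. norm x \<le> 1 \<longrightarrow> norm (f + tensor \<phi> (c *\<^sub>R x - f t)) \<le> 1)" for n
    proof -
      obtain t1 where t1: "t1 \<in> U n" "t1 \<in> shilov_boundary A" using U by blast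
      have osc: "norm (f s - f t) \<le> \<eta>" if "s \<in> U n" "t \<in> U n" for s t
      proof -
        have "s \<in> W" "t \<in> W" using U that by blast+
        then show ?thesis using norm_triangle_ineq4[of "f s - f t0" "f t - f t0"] by (simp add: W_def)
      qed
      have "open (U n)" using U by blast
      have "(0 :: real) < (1/2) ^ n" by simp
      obtain t \<phi> where "t \<in> U n" "\<phi> \<in> A" "\<phi> t = 1" "\<forall>s. cmod (apply_bcontfun \<phi> s) \<le> 1"
        "\<forall>s. s \<notin> U n \<longrightarrow> cmod (apply_bcontfun \<phi> s) \<le> (1/2) ^ n"
        "\<forall>x. norm x \<le> 1 \<longrightarrow> norm (f + tensor \<phi> (c *\<^sub>R x - f t)) \<le> 1"
        unfolding c_def
        by (rule function_space_modification[OF S \<eta>(3,1,2) \<open>open (U n)\<close> t1 osc \<open>0 < (1/2) ^ n\<close>])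
      then show ?thesis by (intro exI[of _ t] exI[of _ \<phi>] conjI)
    qed
    then obtain t \<phi> where t: "\<And>n. t n \<in> U n" and \<phi>: "\<And>n. \<phi> n \<in> A"
      "\<And>n. apply_bcontfun (\<phi> n) (t n) = 1" "\<forall>n s. cmod (apply_bcontfun (\<phi> n) s) \<le> 1"
      "\<forall>n s. s \<notin> U n \<longrightarrow> cmod (apply_bcontfun (\<phi> n) s) \<le> (1/2) ^ n"
      and modif: "\<And>n x. norm x \<le> 1 \<Longrightarrow> norm (f + tensor (\<phi> n) (c *\<^sub>R x - f (t n))) \<le> 1"
      by metis
    have "\<exists>x. norm x = 1 \<and> norm (c *\<^sub>R x + P f (t n)) = c + norm (P f (t n))" for n
      using exists_aligned_unit_vector[OF v, of c "P f (t n)"] c(1) by (metis less_imp_le)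
    then obtain x where x: "\<And>n. norm (x n) = 1"
      "\<And>n. norm (c *\<^sub>R x n + P f (t n)) = c + norm (P f (t n))" by metis
    define z where "z n = tensor (\<phi> n) (c *\<^sub>R x n - f (t n))" for n
    have zS: "z n \<in> S" for n unfolding z_def by (rule function_spaceD(3)[OF S \<phi>(1)])
    have fz: "norm (f + z n) \<le> 1" for n unfolding z_def by (rule modif) (simp add: x)
    have "norm (apply_bcontfun (z n) s) \<le> 2 * cmod (apply_bcontfun (\<phi> n) s)" for n s
    proof -
      have "norm (c *\<^sub>R x n - f (t n)) \<le> 2"
        using norm_triangle_ineq4[of "c *\<^sub>R x n" "f (t n)"] norm_bounded[of f "t n"] x(1)[of n] c f(2)
        by simp
      from mult_left_mono[OF this, of "cmod (\<phi> n s)"] show ?thesis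
        by (simp add: z_def norm_scaleC mult.commute)
    qed
    then have sums: "signed_sums_le I z 6" if "finite I" for I
      using signed_sums_le_disjoint_peaks[OF disj \<phi>(3,4) _ that] by blast
    have "norm f \<le> 6" using f(2) by simp
    from compact_polynomial_difference_small[OF sub P f(1) this zS fz sums \<epsilon>]
    obtain n where n: "norm (P (f + z n) - P f) < \<epsilon>" by blast
    have ball: "f + z n \<in> unit_ball S"
      using fz zS f(1) complex_vector.subspace_add[OF sub] by (simp add: unit_ball_def)
    have fzt: "(f + z n) (t n) = c *\<^sub>R x n" by (simp add: z_def \<phi>(2))
    have "c + norm (P f (t n)) = norm (c *\<^sub>R x n + P f (t n))" by (simp add: x(2))
    also have "c *\<^sub>R x n + P f (t n) = ((f + z n) + P (f + z n)) (t n) - (P (f + z n) - P f) (t n)"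
      using fzt by simp
    also have "norm \<dots> \<le> norm ((f + z n) + P (f + z n)) + norm (P (f + z n) - P f)"
      by (intro order_trans[OF norm_triangle_ineq4] add_mono norm_bounded)
    also have "\<dots> \<le> R + \<epsilon>"
      using id_plus_polynomial_norm_le[OF poly ball] n unfolding R_def by linarith
    finally have "c + norm (P f (t n)) \<le> R + \<epsilon>" .
    moreover have "norm (P f (t n)) > N - \<epsilon>" using t[of n] U by (auto simp: W_def)
    ultimately show ?thesis using c(3) by linarith
  qed
  then have "1 + N \<le> R + \<epsilon>" if "\<epsilon> > 0" for \<epsilon>
    using that spec[of "\<lambda>e. e > 0 \<longrightarrow> 1 + N \<le> R + e * 3" "\<epsilon> / 3"] by simp
  then show "1 + 1 * poly_norm S P \<le> poly_norm S (\<lambda>z. z + P z)"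
    unfolding N_def[symmetric] R_def[symmetric] mult_1_left by (rule field_le_epsilon)
qed simp

section \<open>The scalar case and the final case distinction\<close>

text \<open>Complex functionals on the complex numbers are multiplications by
  \<open>\<phi> 1\<close>, so composing with them does not leave \<open>A\<close>.\<close>

lemma uniform_algebra_function_space:
  fixes A :: "('k::topological_space \<Rightarrow>\<^sub>C complex) set"
  assumes A: "uniform_algebra A"
  shows "function_space_over A A"
proof -
  have tensor: "tensor f x = x *\<^sub>C f" for f :: "'k \<Rightarrow>\<^sub>C complex" and x
    by (rule bcontfun_eqI) simp
  have "base_algebra A = A"
  proof
    show "A \<subseteq> base_algebra A"
    proof
      fix g assume "g \<in> A"
      moreover have "bounded_functional (\<lambda>z. z)"
        by (simp add: bounded_functional_def)
      ultimately show "g \<in> base_algebra A"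
        unfolding base_algebra_def by (auto intro!: exI[of _ "\<lambda>z. z"] exI[of _ g])
    qed
    show "base_algebra A \<subseteq> A"
    proof
      fix g assume "g \<in> base_algebra A"
      then obtain \<phi> f where \<phi>: "bounded_functional \<phi>" and f: "f \<in> A" "apply_bcontfun g = \<phi> \<circ> apply_bcontfun f"
        unfolding base_algebra_def by blast
      have "\<phi> z = \<phi> 1 * z" for z
        using \<phi> unfolding bounded_functional_def by (metis mult.commute mult.right_neutral scaleC_complex_eq)
      then have "\<phi> (f t) = \<phi> 1 * f t" for t by blast
      then have "g t = (\<phi> 1 *\<^sub>C f) t" for t
        unfolding f(2) o_apply scaleC_bcontfun_apply scaleC_complex_eq by blast
      then have "g = \<phi> 1 *\<^sub>C f" by (rule bcontfun_eqI)
      then show "g \<in> A"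
        using complex_vector.subspace_scale[OF uniform_algebraD(1)[OF A] f(1)] by simp
    qed
  qed
  then show ?thesis
    unfolding function_space_over_def tensor
    using A uniform_algebraD(1,4)[OF A] complex_vector.subspace_scale[OF uniform_algebraD(1)[OF A]]
    by simp
qed

text \<open>Test polynomial for the scalars: it is compact because the disc is, and it cancels the
  identity. Together with an indicator in \<open>A\<close> it excludes every positive constant for
  \<open>A\<close>.\<close>

lemma compact_polynomial_uminus_complex: "compact_polynomial_on (UNIV :: complex set) uminus"
  and poly_norm_uminus_complex: "poly_norm (UNIV :: complex set) uminus = 1"
  and poly_norm_id_plus_uminus_complex: "poly_norm (UNIV :: complex set) (\<lambda>z. z + - z) \<le> 1"
proof -
  have ball: "unit_ball (UNIV :: complex set) = cball 0 1"
    by (auto simp: unit_ball_def)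
  have "bounded_multilinear_on UNIV 1 (\<lambda>x. - x 0 :: complex)"
    unfolding bounded_multilinear_on_def
  proof (intro conjI ballI allI impI exI)
    show "norm (- x 0) \<le> 1 * (\<Prod>i<1. norm (x i))" for x :: "nat \<Rightarrow> complex" by simp
  qed simp_all
  then have "homogeneous_polynomial_on UNIV 1 (uminus :: complex \<Rightarrow> complex)"
    unfolding homogeneous_polynomial_on_def by (intro exI[of _ "\<lambda>x. - x 0"]) simp
  then have "polynomial_on UNIV (uminus :: complex \<Rightarrow> complex)"
    by (intro polynomial_on_finite_sum[of "{()}" _ "\<lambda>_. 1" "\<lambda>_. uminus"]) auto
  then show "compact_polynomial_on (UNIV :: complex set) uminus"
    by (simp add: compact_polynomial_on_def ball)
  show "poly_norm (UNIV :: complex set) uminus = 1"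
    unfolding poly_norm_def
  proof (rule cSup_eq_maximum)
    show "1 \<in> (\<lambda>z. norm (- z)) ` unit_ball (UNIV :: complex set)"
      by (rule image_eqI[of _ _ 1]) (auto simp: unit_ball_def)
  qed (auto simp: unit_ball_def)
  show "poly_norm (UNIV :: complex set) (\<lambda>z. z + - z) \<le> 1"
    by (rule poly_norm_le) auto
qed

theorem theorem4p11:
  fixes AKX :: "('k::t2_space \<Rightarrow>\<^sub>C 'x::complex_banach) set"
    and A :: "('k \<Rightarrow>\<^sub>C complex) set"
  assumes "compact (UNIV :: 'k set)"
    and "infinite_dim (UNIV :: 'x set)"
    and "function_space_over A AKX"
    and "infinite_dim A"
  shows "Daug_p AKX = max (Daug_p A) (Daug_p (UNIV :: 'x set))"
proof -
  note K = assms(1) and S = assms(3)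
  have A: "uniform_algebra A" by (rule function_spaceD(2)[OF S])
  note subA = uniform_algebraD(1)[OF A]
  have AA: "function_space_over A A" by (rule uniform_algebra_function_space[OF A])
  have subX: "complex_vector.subspace (UNIV :: 'x set)" by simp
  note X = Daug_p_bounds[OF subX assms(2)]
  show ?thesis
  \<comment> \<open>An indicator in \<open>A\<close> is what the isolated-point lemma consumes; by
    \<open>indicator_in_algebra\<close> its absence rules out isolated points of the
    boundary.\<close>
  proof (cases "\<exists>e\<in>A. \<exists>t. apply_bcontfun e = indicator {t}")
    case True
    then obtain e t where e: "e \<in> A" "apply_bcontfun e = indicator {t}" by blast
    have "m \<le> 0" if "m \<in> daugavet_constants A" for m
      using daugavet_constant_isolated_point[OF AA e that compact_polynomial_uminus_complex]
        poly_norm_uminus_complex poly_norm_id_plus_uminus_complex by (simp add: max_def split: if_splits)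
    then have "Daug_p A = 0"
      by (intro Daug_p_eqI zero_in_daugavet_constants[OF subA assms(4)])
    moreover have "daugavet_constants AKX = daugavet_constants (UNIV :: 'x set)"
    proof
      show "daugavet_constants (UNIV :: 'x set) \<subseteq> daugavet_constants AKX"
        using daugavet_constants_range_subset[OF K S] by blast
      show "daugavet_constants AKX \<subseteq> daugavet_constants (UNIV :: 'x set)"
      proof
        fix m assume m: "m \<in> daugavet_constants AKX"
        have "1 + m * poly_norm UNIV P \<le> poly_norm UNIV (\<lambda>x. x + P x)"
          if P: "compact_polynomial_on (UNIV :: 'x set) P" for P
          using daugavet_constant_isolated_point[OF S e m P] one_le_poly_norm_id_plus[OF subX assms(2) P]
          by simp
        then show "m \<in> daugavet_constants (UNIV :: 'x set)"
          using m by (simp add: daugavet_constants_def)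
      qed
    qed
    then have "Daug_p AKX = Daug_p (UNIV :: 'x set)" by (simp add: Daug_p_eq_greatest)
    ultimately show ?thesis using X(1) by simp
  next
    case False
    then have noind: "\<And>e t. e \<in> A \<Longrightarrow> apply_bcontfun e \<noteq> indicator {t}" by blast
    obtain v :: 'x where v: "v \<noteq> 0" using infinite_dim_nonzero[OF assms(2)] by metis
    have one: "const_bcontfun 1 \<in> A" by (rule uniform_algebraD(3)[OF A])
    have one_nz: "const_bcontfun 1 \<noteq> (0 :: 'k \<Rightarrow>\<^sub>C complex)"
      by (metis const_bcontfun.rep_eq zero_bcontfun.rep_eq zero_neq_one)
    \<comment> \<open>Types are inhabited, so \<open>undefined\<close> is some point of K, at which
      the function is seen to be nonzero.\<close>
    have "tensor (const_bcontfun 1) v (undefined :: 'k) = v" by simp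
    then have "tensor (const_bcontfun 1) v \<noteq> (0 :: 'k \<Rightarrow>\<^sub>C 'x)" using v by (metis zero_bcontfun.rep_eq)
    then have "Daug_p AKX = 1"
      using daugavet_constant_le_1[OF function_spaceD(1)[OF S] function_spaceD(3)[OF S one]]
      by (intro Daug_p_eqI one_in_daugavet_constants[OF K S v noind])
    moreover have "Daug_p A = 1"
      using daugavet_constant_le_1[OF subA one one_nz]
      by (intro Daug_p_eqI one_in_daugavet_constants[OF K AA one_neq_zero noind])
    ultimately show ?thesis using X(2) by simp
  qed
qed

end
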